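(* There exists an obstructed Thurston map $f\colon S^2\to S^2$ whose iterated monodromy group $\operatorname{IMG}(f)$ has exponential growth.
   Context: A Thurston map is an orientation-preserving branched covering $f\colon S^2\to S^2$ of topological degree $d\ge2$ whose postcritical set $\operatorname{post}(f)=\bigcup_{n\ge1}f^n(\operatorname{crit}(f))$ is finite. Two Thurston maps $f\colon S^2\to S^2$, $g\colon \widetilde S^2\to\widetilde S^2$ are Thurston equivalent if there are homeomorphisms $h_0,h_1\colon S^2\to\widetilde S^2$, isotopic rel. $\operatorname{post}(f)$, with $h_0\circ f=g\circ h_1$. A Thurston map is obstructed if it is not Thurston equivalent to a rational map. Iterated monodromy group: fix $t\in S^2\setminus\operatorname{post}(f)$; $\pi_1(S^2\setminus\operatorname{post}(f),t)$ acts on the rooted $d$-ary tree $\bigsqcup_{n\ge0}f^{-n}(t)$ by path lifting (the image of $p\in f^{-n}(t)$ under $[\gamma]$ is the endpoint of the $f^n$-lift of $\gamma$ starting at $p$); $\operatorname{IMG}(f)$ is the quotient of the fundamental group by the kernel of this action. A finitely generated group has exponential growth if, for a finite symmetric generating set, the number of elements of word length $\le n$ is at least $c\,e^{\alpha n}$ for some $c,\alpha>0$. *)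

theory Defs
  imports "HOL-Complex_Analysis.Complex_Analysis" "HOL-Computational_Algebra.Polynomial"
begin

definition S2 :: "(real^3) set" where
  "S2 = sphere 0 1"

definition north_pole :: "real^3" where
  "north_pole = vector [0, 0, 1]"

definition south_pole :: "real^3" where
  "south_pole = vector [0, 0, -1]"

text \<open>Stereographic projection from the north pole (this identifies S2 with the
  Riemann sphere, the north pole corresponding to infinity) and its inverse.\<close>
definition stereo :: "real^3 \<Rightarrow> complex" where
  "stereo x = Complex (x$1 / (1 - x$3)) (x$2 / (1 - x$3))"

definition stereo_inv :: "complex \<Rightarrow> real^3" where
  "stereo_inv z = vector [2 * Re z / (1 + (cmod z)^2), 2 * Im z / (1 + (cmod z)^2),
                          ((cmod z)^2 - 1) / ((cmod z)^2 + 1)]"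

text \<open>Conjugated stereographic projection from the south pole; the transition map
  to stereo is z \<mapsto> 1/z, so both charts define the same orientation.\<close>
definition stereoS :: "real^3 \<Rightarrow> complex" where
  "stereoS x = Complex (x$1 / (1 + x$3)) (- (x$2) / (1 + x$3))"

definition stereoS_inv :: "complex \<Rightarrow> real^3" where
  "stereoS_inv z = vector [2 * Re z / (1 + (cmod z)^2), - 2 * Im z / (1 + (cmod z)^2),
                           (1 - (cmod z)^2) / (1 + (cmod z)^2)]"

definition loc_orient_pres :: "complex set \<Rightarrow> (complex \<Rightarrow> complex) \<Rightarrow> bool" where
  "loc_orient_pres W g \<longleftrightarrow>
     (\<forall>z\<in>W. \<exists>r>0. cball z r \<subseteq> W \<and>
        (\<forall>\<rho>. 0 < \<rho> \<and> \<rho> \<le> r \<longrightarrow> winding_number (g \<circ> circlepath z \<rho>) (g z) = 1))"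

definition oriented_chart :: "(real^3) set \<Rightarrow> (real^3 \<Rightarrow> complex) \<Rightarrow> bool" where
  "oriented_chart U \<phi> \<longleftrightarrow>
     loc_orient_pres (stereo ` (U - {north_pole})) (\<phi> \<circ> stereo_inv) \<and>
     loc_orient_pres (stereoS ` (U - {south_pole})) (\<phi> \<circ> stereoS_inv)"

definition local_model :: "(real^3 \<Rightarrow> real^3) \<Rightarrow> real^3 \<Rightarrow> nat \<Rightarrow> bool" where
  "local_model f p k \<longleftrightarrow>
     (\<exists>U V \<phi> \<phi>' \<psi> \<psi>'. openin (top_of_set S2) U \<and> openin (top_of_set S2) V \<and>
        p \<in> U \<and> f ` U \<subseteq> V \<and>
        homeomorphism U (ball 0 1) \<phi> \<phi>' \<and> homeomorphism V (ball 0 1) \<psi> \<psi>' \<and>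
        oriented_chart U \<phi> \<and> oriented_chart V \<psi> \<and>
        \<phi> p = 0 \<and> \<psi> (f p) = 0 \<and>
        (\<forall>z\<in>ball 0 1. \<psi> (f (\<phi>' z)) = z ^ k))"

definition branched_cover :: "(real^3 \<Rightarrow> real^3) \<Rightarrow> bool" where
  "branched_cover f \<longleftrightarrow> continuous_on S2 f \<and> f ` S2 \<subseteq> S2 \<and>
     (\<forall>p\<in>S2. \<exists>k\<ge>1. local_model f p k)"

definition top_degree :: "(real^3 \<Rightarrow> real^3) \<Rightarrow> nat" where
  "top_degree f = Sup {card (S2 \<inter> f -` {q}) | q. q \<in> S2}"

definition crit :: "(real^3 \<Rightarrow> real^3) \<Rightarrow> (real^3) set" where
  "crit f = {p \<in> S2. \<exists>k\<ge>2. local_model f p k}"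

definition post :: "(real^3 \<Rightarrow> real^3) \<Rightarrow> (real^3) set" where
  "post f = {(f ^^ n) c | n c. n \<ge> 1 \<and> c \<in> crit f}"

definition thurston_map :: "(real^3 \<Rightarrow> real^3) \<Rightarrow> bool" where
  "thurston_map f \<longleftrightarrow> branched_cover f \<and> top_degree f \<ge> 2 \<and> finite (post f)"

text \<open>A rational map of the Riemann sphere, transported to S2 via stereo: the
  continuous extension of z \<mapsto> p(z)/q(z).\<close>
definition rational_map :: "(real^3 \<Rightarrow> real^3) \<Rightarrow> bool" where
  "rational_map g \<longleftrightarrow> (\<exists>p q :: complex poly. q \<noteq> 0 \<and>
     continuous_on S2 g \<and> g ` S2 \<subseteq> S2 \<and>
     (\<forall>z. poly q z \<noteq> 0 \<longrightarrow> g (stereo_inv z) = stereo_inv (poly p z / poly q z)))"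

definition isotopic_rel :: "(real^3) set \<Rightarrow> (real^3 \<Rightarrow> real^3) \<Rightarrow> (real^3 \<Rightarrow> real^3) \<Rightarrow> bool" where
  "isotopic_rel P h0 h1 \<longleftrightarrow>
     homotopic_with_canon (\<lambda>h. (\<exists>h'. homeomorphism S2 S2 h h') \<and> (\<forall>x\<in>P. h x = h0 x))
       S2 S2 h0 h1"

definition thurston_equiv :: "(real^3 \<Rightarrow> real^3) \<Rightarrow> (real^3 \<Rightarrow> real^3) \<Rightarrow> bool" where
  "thurston_equiv f g \<longleftrightarrow> (\<exists>h0 h0' h1 h1'.
     homeomorphism S2 S2 h0 h0' \<and> homeomorphism S2 S2 h1 h1' \<and>
     isotopic_rel (post f) h0 h1 \<and> (\<forall>x\<in>S2. h0 (f x) = g (h1 x)))"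

definition obstructed :: "(real^3 \<Rightarrow> real^3) \<Rightarrow> bool" where
  "obstructed f \<longleftrightarrow> thurston_map f \<and> \<not> (\<exists>g. rational_map g \<and> thurston_equiv f g)"

definition preimage_tree :: "(real^3 \<Rightarrow> real^3) \<Rightarrow> real^3 \<Rightarrow> (nat \<times> (real^3)) set" where
  "preimage_tree f t = {(n, p). p \<in> S2 \<and> (f ^^ n) p = t}"

definition lift_end :: "(real^3 \<Rightarrow> real^3) \<Rightarrow> nat \<Rightarrow> (real \<Rightarrow> real^3) \<Rightarrow> real^3 \<Rightarrow> real^3" where
  "lift_end f n \<gamma> p = (THE q. \<exists>\<delta>. path \<delta> \<and> path_image \<delta> \<subseteq> S2 \<and> pathstart \<delta> = p \<and>
       pathfinish \<delta> = q \<and> (\<forall>s\<in>{0..1}. (f ^^ n) (\<delta> s) = \<gamma> s))"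

definition loops :: "(real^3 \<Rightarrow> real^3) \<Rightarrow> real^3 \<Rightarrow> (real \<Rightarrow> real^3) set" where
  "loops f t = {\<gamma>. path \<gamma> \<and> path_image \<gamma> \<subseteq> S2 - post f \<and> pathstart \<gamma> = t \<and> pathfinish \<gamma> = t}"

definition monodromy :: "(real^3 \<Rightarrow> real^3) \<Rightarrow> real^3 \<Rightarrow> (real \<Rightarrow> real^3) \<Rightarrow> nat \<times> (real^3) \<Rightarrow> nat \<times> (real^3)" where
  "monodromy f t \<gamma> = (\<lambda>(n, p). if (n, p) \<in> preimage_tree f t then (n, lift_end f n \<gamma> p) else (n, p))"

text \<open>IMG(f): the image of the fundamental group in the permutation group of the tree
  (isomorphic to the quotient of the fundamental group by the kernel of the action).\<close>
definition IMG :: "(real^3 \<Rightarrow> real^3) \<Rightarrow> real^3 \<Rightarrow> (nat \<times> (real^3) \<Rightarrow> nat \<times> (real^3)) set" where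
  "IMG f t = monodromy f t ` loops f t"

definition word_ball :: "('a \<Rightarrow> 'a) set \<Rightarrow> nat \<Rightarrow> ('a \<Rightarrow> 'a) set" where
  "word_ball S n = {foldr (\<circ>) ws id | ws. set ws \<subseteq> S \<and> length ws \<le> n}"

definition fin_sym_gen_set :: "('a \<Rightarrow> 'a) set \<Rightarrow> ('a \<Rightarrow> 'a) set \<Rightarrow> bool" where
  "fin_sym_gen_set G S \<longleftrightarrow> finite S \<and> S \<subseteq> G \<and> (\<forall>s\<in>S. inv s \<in> S) \<and>
     G = (\<Union>n. word_ball S n)"

definition exponential_growth :: "('a \<Rightarrow> 'a) set \<Rightarrow> bool" where
  "exponential_growth G \<longleftrightarrow> (\<exists>S. fin_sym_gen_set G S) \<and>
     (\<forall>S. fin_sym_gen_set G S \<longrightarrow>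
        (\<exists>c \<alpha>. c > 0 \<and> \<alpha> > 0 \<and> (\<forall>n. c * exp (\<alpha> * real n) \<le> real (card (word_ball S n)))))"

end

theory Submission
  imports Defs
begin

text \<open>The example is \<open>f = R \<circ> h\<close>, where \<open>R y = y (1 - 2 y\<^sup>2) / (2 - y\<^sup>2)\<close> has four simple real critical
  points and \<open>h\<close> is a radial stretch \<open>z |z| powr (\<kappa> - 1)\<close> that moves the critical values of \<open>R\<close> to its
  critical points. So \<open>f\<close> has degree three and four fixed critical points, which form its postcritical
  set. (Up to equivalence, \<open>f\<close> arises from the identity by blowing up two disjoint arcs.)

  A rational map of degree three cannot have four superattracting fixed points, by the holomorphic
  index formula, or more simply because \<open>(z q - p)' - q\<close> has degree at most three and would vanish at
  all of them. Hence \<open>f\<close> is obstructed.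

  The real circle is mapped to itself, and the preimages of its complement lie in three sheets.
  Labelling an iterated preimage of the base point by the sheets of its orbit turns the monodromy
  into an explicit automaton: crossing an arc of the real circle acts by an involution of itineraries.
  The path lifts are followed one step at a time through the arcs they cross, so no homotopies are
  needed. Two products of these involutions generate a free monoid, which gives exponential growth.\<close>

no_notation fps_nth (infixl "$" 75)

section \<open>The sphere and its charts\<close>

text \<open>Up to sign, R is the Blaschke product with zeros 0, 1/sqrt 2 and -1/sqrt 2. It is odd
  with real coefficients, so it preserves the unit disc and the real circle and commutes with
  \<open>y -> - y\<close> and \<open>y -> 1 / y\<close>, as the stretch does. The half turn
  \<open>flip\<close> is \<open>z -> 1 / z\<close> on the sphere, so computations are needed only on
  the closed lower hemisphere. By symmetry the critical points are c, -c, 1/c, -1/c with values v,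
  -v, 1/v, -1/v, and the single equation \<open>v powr \<kappa> = c\<close> makes f fix all four
  values as critical points. The nonreal part of the preimage of the real circle consists of a loop
  around the arc from v to 1/v and its mirror image. Each loop bounds a bulb, which f maps onto the
  complement of the arc inside it; the third sheet is the outside. Two features of the definitions
  shape the proof. \<open>crit\<close> and \<open>oriented_chart\<close> speak of arbitrary
  topological charts, so criticality is tested by local injectivity, which survives homeomorphisms,
  and orientation by an isotopy from the stretch to the identity. A rational map equivalent to f has
  no degree given in advance; it is recovered by counting fibres.\<close>

definition flip :: "real^3 \<Rightarrow> real^3" where
  "flip x = vector [x$1, - x$2, - x$3]"

lemma flip_nth [simp]: "flip x $ 1 = x $ 1" "flip x $ 2 = - x $ 2" "flip x $ 3 = - x $ 3"
  by (simp_all add: flip_def)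

lemma vec3_eq_iff: "x = y \<longleftrightarrow> x$1 = y$1 \<and> x$2 = y$2 \<and> x$3 = y$3" for x y :: "real^3"
  by (simp add: vec_eq_iff forall_3)

lemma flip_flip [simp]: "flip (flip x) = x"
  by (simp add: vec3_eq_iff)

lemma S2_iff: "x \<in> S2 \<longleftrightarrow> (x$1)^2 + (x$2)^2 + (x$3)^2 = 1"
  by (simp add: S2_def norm_eq_1 inner_vec_def sum_3 power2_eq_square)

lemma flip_S2 [simp]: "flip x \<in> S2 \<longleftrightarrow> x \<in> S2"
  by (simp add: S2_iff)

lemma continuous_on_vec3:
  fixes g :: "'a::topological_space \<Rightarrow> real^3"
  assumes "continuous_on A (\<lambda>x. g x $ 1)" "continuous_on A (\<lambda>x. g x $ 2)" "continuous_on A (\<lambda>x. g x $ 3)"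
  shows "continuous_on A g"
proof -
  have "continuous_on A (\<lambda>x. \<chi> i. g x $ i)"
    using assms by (intro continuous_on_vec_lambda) (metis exhaust_3)
  then show ?thesis by simp
qed

lemma continuous_on_flip [continuous_intros]: "continuous_on A g \<Longrightarrow> continuous_on A (\<lambda>x. flip (g x))"
  by (rule continuous_on_vec3) (auto intro!: continuous_intros)

lemma north_nth [simp]: "north_pole $ 1 = 0" "north_pole $ 2 = 0" "north_pole $ 3 = 1"
  and south_nth [simp]: "south_pole $ 1 = 0" "south_pole $ 2 = 0" "south_pole $ 3 = - 1"
  by (simp_all add: north_pole_def south_pole_def)

lemma north_S2 [simp]: "north_pole \<in> S2" and south_S2 [simp]: "south_pole \<in> S2"
  by (simp_all add: S2_iff)

lemma flip_north [simp]: "flip north_pole = south_pole" and flip_south [simp]: "flip south_pole = north_pole"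
  by (simp_all add: vec3_eq_iff)

lemma S2_eq_north_iff: "x \<in> S2 \<Longrightarrow> x = north_pole \<longleftrightarrow> x$3 = 1"
  by (auto simp: S2_iff vec3_eq_iff sum_power2_eq_zero_iff)

lemma S2_eq_south_iff: "x \<in> S2 \<Longrightarrow> x = south_pole \<longleftrightarrow> x$3 = - 1"
  by (auto simp: S2_iff vec3_eq_iff sum_power2_eq_zero_iff)

lemma stereo_inv_nth [simp]:
  "stereo_inv z $ 1 = 2 * Re z / (1 + (cmod z)^2)"
  "stereo_inv z $ 2 = 2 * Im z / (1 + (cmod z)^2)"
  "stereo_inv z $ 3 = ((cmod z)^2 - 1) / ((cmod z)^2 + 1)"
  by (simp_all add: stereo_inv_def)

lemma cmod_pos_simps [simp]: "1 + (cmod z)^2 \<noteq> 0" "(cmod z)^2 + 1 \<noteq> 0" "1 + (cmod z)^2 > 0" "(cmod z)^2 + 1 > 0"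
  by (auto intro: add_pos_nonneg add_nonneg_pos simp: add_nonneg_eq_0_iff)

lemma stereo_inv_S2 [simp]: "stereo_inv z \<in> S2"
proof -
  have "4 * (Re z)^2 + 4 * (Im z)^2 + ((cmod z)^2 - 1)^2 = (1 + (cmod z)^2)^2"
    unfolding cmod_power2 by (simp add: power2_eq_square algebra_simps)
  then show ?thesis
    by (simp add: S2_iff power_divide power_mult_distrib add.commute[of _ 1] flip: add_divide_distrib)
qed

lemma stereo_inv_nth3_less: "stereo_inv z $ 3 < 1"
  by (simp add: divide_simps)

lemma stereo_inv_ne_north [simp]: "stereo_inv z \<noteq> north_pole"
  using stereo_inv_nth3_less[of z] by (metis less_irrefl north_nth(3))

lemma stereo_stereo_inv [simp]: "stereo (stereo_inv z) = z"
proof -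
  have "1 - stereo_inv z $ 3 = 2 / (1 + (cmod z)^2)"
    by (simp add: field_simps)
  then show ?thesis
    unfolding stereo_def by (simp add: complex_eq_iff)
qed

lemma cmod_stereo: assumes "x \<in> S2" "x \<noteq> north_pole" shows "(cmod (stereo x))^2 = (1 + x$3) / (1 - x$3)"
proof -
  have "x$3 \<noteq> 1" using assms S2_eq_north_iff by blast
  moreover have "(x$1)^2 + (x$2)^2 = (1 + x$3) * (1 - x$3)"
    using assms by (simp add: S2_iff algebra_simps power2_eq_square)
  ultimately show ?thesis
    by (simp add: stereo_def cmod_power2 power_divide flip: add_divide_distrib) (simp add: power2_eq_square)
qed

lemma stereo_inv_stereo: assumes "x \<in> S2" "x \<noteq> north_pole" shows "stereo_inv (stereo x) = x"
proof -
  have "x$3 \<noteq> 1" using assms S2_eq_north_iff by blast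
  then have "1 + (cmod (stereo x))^2 = 2 / (1 - x$3)" "(cmod (stereo x))^2 - 1 = 2 * x$3 / (1 - x$3)"
    by (simp_all add: cmod_stereo[OF assms] field_simps)
  moreover have "Re (stereo x) = x$1 / (1 - x$3)" "Im (stereo x) = x$2 / (1 - x$3)"
    by (simp_all add: stereo_def)
  ultimately show ?thesis
    using \<open>x$3 \<noteq> 1\<close> by (simp add: vec3_eq_iff add.commute[of _ 1] del: stereo_inv_nth(1,2,3)) (simp add: add.commute[of _ 1])
qed

lemma continuous_on_stereo_inv [continuous_intros]:
  "continuous_on A g \<Longrightarrow> continuous_on A (\<lambda>x. stereo_inv (g x))"
  by (rule continuous_on_vec3) (auto intro!: continuous_intros)

lemma continuous_on_Complex [continuous_intros]:
  "continuous_on A g \<Longrightarrow> continuous_on A k \<Longrightarrow> continuous_on A (\<lambda>x. Complex (g x) (k x))"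
  by (simp add: Complex_eq continuous_intros)

lemma continuous_on_stereo: "continuous_on (S2 - {north_pole}) stereo"
  unfolding stereo_def
  by (intro continuous_intros) (auto simp: S2_eq_north_iff)

lemma stereoS_eq: "stereoS x = stereo (flip x)"
  by (simp add: stereoS_def stereo_def)

lemma stereoS_inv_eq: "stereoS_inv z = flip (stereo_inv z)"
  by (simp add: stereoS_inv_def vec3_eq_iff divide_simps)

lemma flip_stereo_inv: "w \<noteq> 0 \<Longrightarrow> flip (stereo_inv w) = stereo_inv (1 / w)"
proof -
  assume "w \<noteq> 0"
  then have p: "(cmod w)^2 > 0" by simp
  have "Re (1/w) = Re w / (cmod w)^2" "Im (1/w) = - Im w / (cmod w)^2"
    by (simp_all add: Re_divide Im_divide cmod_power2)
  moreover have "(cmod (1/w))^2 = 1 / (cmod w)^2"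
    by (simp add: norm_divide power_divide)
  ultimately show ?thesis using p
    by (simp only: vec3_eq_iff flip_nth stereo_inv_nth) (simp add: divide_simps del: norm_eq_zero, simp add: algebra_simps)
qed

lemma stereo_flip: assumes "x \<in> S2" "x \<noteq> north_pole" "x \<noteq> south_pole" shows "stereo (flip x) = 1 / stereo x"
proof -
  have ne: "stereo x \<noteq> 0"
    using assms cmod_stereo[of x] S2_eq_south_iff[of x] S2_eq_north_iff[of x] by auto
  show ?thesis
    by (metis flip_stereo_inv ne assms(1,2) stereo_inv_stereo stereo_stereo_inv)
qed

lemma stereo_inv_inj: "stereo_inv z = stereo_inv w \<longleftrightarrow> z = w"
  by (metis stereo_stereo_inv)

lemma stereo_inv_nth3_le: "stereo_inv z $ 3 \<le> 0 \<longleftrightarrow> cmod z \<le> 1"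
  by (simp add: pos_divide_le_eq[OF cmod_pos_simps(4)] abs_square_le_1)

lemma stereo_inv_nth3_neg: "stereo_inv z $ 3 < 0 \<longleftrightarrow> cmod z < 1"
  by (simp add: pos_divide_less_eq[OF cmod_pos_simps(4)] abs_square_less_1)

lemma cmod_stereo_le: "x \<in> S2 \<Longrightarrow> x$3 \<le> 0 \<Longrightarrow> cmod (stereo x) \<le> 1"
  by (metis stereo_inv_nth3_le stereo_inv_stereo north_nth(3) not_one_le_zero)

lemma hemisphere_cases:
  assumes "x \<in> S2"
  obtains (lower) z where "cmod z \<le> 1" "x = stereo_inv z" | (upper) z where "cmod z \<le> 1" "x = flip (stereo_inv z)"
proof (cases "x$3 \<le> 0")
  case True
  then show ?thesis
    using assms lower[of "stereo x"] by (metis cmod_stereo_le stereo_inv_stereo north_nth(3) not_one_le_zero)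
next
  case False
  then have "flip x \<in> S2" "flip x $ 3 \<le> 0" using assms by auto
  then show ?thesis
    using upper[of "stereo (flip x)"] by (metis cmod_stereo_le flip_flip stereo_inv_stereo north_nth(3) not_one_le_zero)
qed

section \<open>The cubic rational map and the radial twist\<close>

definition rmap :: "complex \<Rightarrow> complex" where
  "rmap y = y * (1 - 2 * y^2) / (2 - y^2)"

text \<open>Smaller positive zero of \<open>2 y^4 - 11 y^2 + 2\<close>, the numerator of the
  derivative of \<open>rmap\<close>; the other positive zero is its reciprocal.\<close>

definition crit_pt :: real where
  "crit_pt = sqrt ((11 - sqrt 105) / 4)"

definition crit_val :: real where
  "crit_val = crit_pt * (1 - 2 * crit_pt^2) / (2 - crit_pt^2)"

lemma crit_pt_sq: "crit_pt^2 = (11 - sqrt 105) / 4"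
  unfolding crit_pt_def by (rule real_sqrt_pow2) (simp add: real_le_lsqrt)

lemma crit_pt_eq: "2 * crit_pt^4 - 11 * crit_pt^2 + 2 = 0"
proof -
  have "crit_pt^4 = (crit_pt^2)^2" by simp
  then show ?thesis unfolding crit_pt_sq by (simp add: power2_eq_square field_simps)
qed

lemma crit_pt_sq_bounds: "0 < crit_pt^2" "crit_pt^2 < 1/4"
proof -
  have "sqrt 100 < sqrt 105" "sqrt 105 < sqrt 121" by (simp_all only: real_sqrt_less_iff)
  moreover have "sqrt 100 = 10" "sqrt 121 = 11" by (auto intro: real_sqrt_unique)
  ultimately show "0 < crit_pt^2" "crit_pt^2 < 1/4" unfolding crit_pt_sq by auto
qed

lemma crit_pt_pos: "0 < crit_pt"
proof -
  have "0 \<le> crit_pt" unfolding crit_pt_def by (rule real_sqrt_ge_zero) (simp add: real_le_lsqrt)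
  then show ?thesis using crit_pt_sq_bounds(1) by (simp add: order_less_le)
qed

lemma crit_pt_less: "crit_pt < 1/2"
  using crit_pt_sq_bounds(2) power_less_imp_less_base[of crit_pt 2 "1/2"] by (simp add: power_divide)

lemma crit_val_pos: "0 < crit_val"
  unfolding crit_val_def using crit_pt_sq_bounds crit_pt_pos by simp

lemma crit_val_less: "crit_val < crit_pt"
proof -
  have "(1 - 2 * crit_pt^2) / (2 - crit_pt^2) < 1"
    using crit_pt_sq_bounds by (subst divide_less_eq_1_pos) linarith+
  then show ?thesis
    unfolding crit_val_def using crit_pt_pos mult_strict_left_mono[of _ 1 crit_pt] by (metis mult.right_neutral times_divide_eq_right)
qed

text \<open>Solves \<open>crit_val powr twist_exp = crit_pt\<close>. Since
  \<open>crit_val < crit_pt < 1\<close>, the exponent lies strictly between 0 and 1: the factor in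
  \<open>twist\<close> is unbounded near 0, while the stretch itself still tends to 0 there.\<close>

definition twist_exp :: real where
  "twist_exp = ln crit_pt / ln crit_val"

lemma twist_exp_pos: "0 < twist_exp"
  unfolding twist_exp_def using crit_pt_pos crit_pt_less crit_val_pos crit_val_less
  by (intro divide_neg_neg) auto

definition twist :: "complex \<Rightarrow> complex" where
  "twist z = of_real (cmod z powr (twist_exp - 1)) * z"

lemma twist_0 [simp]: "twist 0 = 0" by (simp add: twist_def)

lemma cmod_twist: "cmod (twist z) = cmod z powr twist_exp"
proof (cases "z = 0")
  case False
  then have "cmod z powr (twist_exp - 1) * cmod z powr 1 = cmod z powr twist_exp"
    by (subst powr_add[symmetric]) simp
  then show ?thesis using False by (simp add: twist_def norm_mult)
qed (simp add: twist_def)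

lemma twist_eq_0_iff [simp]: "twist z = 0 \<longleftrightarrow> z = 0"
  by (auto simp: twist_def)

lemma cmod_twist_less_mono: "cmod z < cmod w \<Longrightarrow> cmod (twist z) < cmod (twist w)"
  unfolding cmod_twist using twist_exp_pos by (intro powr_less_mono2) auto

lemma cmod_twist_less_iff: "cmod (twist z) < cmod (twist w) \<longleftrightarrow> cmod z < cmod w"
  by (metis cmod_twist cmod_twist_less_mono not_less_iff_gr_or_eq)

lemma cmod_twist_le_iff: "cmod (twist z) \<le> cmod (twist w) \<longleftrightarrow> cmod z \<le> cmod w"
  by (meson cmod_twist_less_iff linorder_not_less)

lemma cmod_twist_less_1: "cmod (twist z) < 1 \<longleftrightarrow> cmod z < 1"
  and cmod_twist_le_1: "cmod (twist z) \<le> 1 \<longleftrightarrow> cmod z \<le> 1"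
  using cmod_twist_less_iff[of z 1] cmod_twist_le_iff[of z 1] by (simp_all add: cmod_twist[of 1])

lemma Re_twist: "Re (twist z) = cmod z powr (twist_exp - 1) * Re z"
  and Im_twist: "Im (twist z) = cmod z powr (twist_exp - 1) * Im z"
  by (simp_all add: twist_def)

lemma sgn_Re_twist: "sgn (Re (twist z)) = sgn (Re z)"
  and sgn_Im_twist: "sgn (Im (twist z)) = sgn (Im z)"
  by (cases "z = 0"; simp add: Re_twist Im_twist sgn_mult)+

lemma twist_inverse: "twist (1 / z) = 1 / twist z"
  by (simp add: twist_def norm_divide powr_divide)

lemma isCont_twist_0: "isCont twist 0"
proof -
  have "((\<lambda>z. cmod z powr twist_exp) \<longlongrightarrow> 0 powr twist_exp) (at (0::complex))"
    using twist_exp_pos by (intro tendsto_powr') (auto intro!: tendsto_eq_intros)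
  then have "((\<lambda>z. cmod (twist z)) \<longlongrightarrow> 0) (at 0)" by (simp add: cmod_twist)
  then show ?thesis by (simp add: isCont_def tendsto_norm_zero_iff)
qed

lemma isCont_twist: "isCont twist z"
proof (cases "z = 0")
  case False
  then show ?thesis unfolding twist_def by (intro continuous_intros) auto
qed (simp add: isCont_twist_0)

lemma continuous_on_twist [continuous_intros]:
  "continuous_on A g \<Longrightarrow> continuous_on A (\<lambda>x. twist (g x))"
  using isCont_twist by (metis continuous_at_imp_continuous_on continuous_on_compose2 subset_UNIV top_greatest)

definition untwist :: "complex \<Rightarrow> complex" where
  "untwist z = of_real (cmod z powr (1 / twist_exp - 1)) * z"

lemma cmod_untwist: "cmod (untwist z) = cmod z powr (1 / twist_exp)"
proof (cases "z = 0")
  case False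
  then have "cmod z powr (1 / twist_exp - 1) * cmod z powr 1 = cmod z powr (1 / twist_exp)"
    by (subst powr_add[symmetric]) simp
  then show ?thesis using False by (simp add: untwist_def norm_mult)
qed (simp add: untwist_def)

lemma untwist_twist: "untwist (twist z) = z"
proof (cases "z = 0")
  case False
  then have "(cmod z powr twist_exp) powr (1 / twist_exp - 1) * cmod z powr (twist_exp - 1) = 1"
    using twist_exp_pos by (simp add: powr_powr powr_add[symmetric] algebra_simps)
  then have "complex_of_real ((cmod z powr twist_exp) powr (1 / twist_exp - 1) * cmod z powr (twist_exp - 1)) * z = z"
    by simp
  then show ?thesis
    unfolding untwist_def cmod_twist by (simp add: twist_def mult.assoc)
qed (simp add: untwist_def)

lemma twist_untwist: "twist (untwist z) = z"
proof (cases "z = 0")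
  case False
  then have "(cmod z powr (1 / twist_exp)) powr (twist_exp - 1) * cmod z powr (1 / twist_exp - 1) = 1"
    using twist_exp_pos by (simp add: powr_powr powr_add[symmetric] algebra_simps diff_divide_distrib)
  then have "complex_of_real ((cmod z powr (1 / twist_exp)) powr (twist_exp - 1) * cmod z powr (1 / twist_exp - 1)) * z = z"
    by simp
  then show ?thesis
    unfolding twist_def cmod_untwist by (simp add: untwist_def mult.assoc)
qed (simp add: untwist_def)

lemma isCont_untwist: "isCont untwist z"
proof (cases "z = 0")
  case True
  have "((\<lambda>z. cmod z powr (1 / twist_exp)) \<longlongrightarrow> 0 powr (1 / twist_exp)) (at (0::complex))"
    using twist_exp_pos by (intro tendsto_powr') (auto intro!: tendsto_eq_intros)
  then have "((\<lambda>z. cmod (untwist z)) \<longlongrightarrow> 0) (at 0)" by (simp add: cmod_untwist)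
  then show ?thesis using True by (simp add: isCont_def tendsto_norm_zero_iff untwist_def[of 0])
next
  case False
  then show ?thesis unfolding untwist_def by (intro continuous_intros) auto
qed

lemma homeomorphism_twist: "homeomorphism UNIV UNIV twist untwist"
  by (auto intro!: homeomorphismI simp: twist_untwist untwist_twist isCont_twist isCont_untwist
      continuous_at_imp_continuous_on)

lemma inj_twist: "twist z = twist w \<longleftrightarrow> z = w"
  by (metis untwist_twist)

lemma twist_crit_val: "twist (of_real crit_val) = of_real crit_pt"
proof -
  have "crit_val powr twist_exp = crit_pt"
    using crit_val_pos crit_val_less crit_pt_less crit_pt_pos by (simp add: twist_exp_def powr_def)
  then have "cmod (twist (of_real crit_val)) = crit_pt" using crit_val_pos by (simp add: cmod_twist)
  moreover have "twist (of_real crit_val) = of_real (crit_val powr (twist_exp - 1) * crit_val)"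
    using crit_val_pos by (simp add: twist_def)
  ultimately show ?thesis using crit_val_pos by (auto simp: norm_mult abs_mult)
qed

lemma twist_minus: "twist (- z) = - twist z"
  by (simp add: twist_def)

text \<open>The straight line from the stretch to the identity multiplies z by a factor that depends
  only on the modulus and is positive off 0, and the new modulus increases strictly with the old
  one. Equal images therefore have equal moduli, hence equal factors. This isotopy is what makes the
  stretch orientation preserving.\<close>

lemma twist_isotopy_inj:
  assumes "0 \<le> u" "u \<le> 1" "(1 - u) *\<^sub>R twist z + u *\<^sub>R z = (1 - u) *\<^sub>R twist w + u *\<^sub>R w"
  shows "z = w"
proof -
  define \<rho> where "\<rho> z = (1 - u) * cmod z powr (twist_exp - 1) + u" for z :: complex
  have eq: "(1 - u) *\<^sub>R twist z + u *\<^sub>R z = \<rho> z *\<^sub>R z" for z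
    by (simp add: \<rho>_def twist_def scaleR_conv_of_real algebra_simps)
  have pos: "\<rho> z > 0" if "z \<noteq> 0" for z
    using assms(1,2) that by (cases "u = 0") (auto simp: \<rho>_def intro!: add_nonneg_pos)
  have nrm: "\<rho> z * cmod z = (1 - u) * cmod z powr twist_exp + u * cmod z" for z
    using cmod_twist[of z] by (simp add: \<rho>_def twist_def norm_mult algebra_simps)
  have mono: "\<rho> z * cmod z < \<rho> w * cmod w" if "cmod z < cmod w" for z w
  proof -
    have "cmod z powr twist_exp < cmod w powr twist_exp"
      using that twist_exp_pos by (intro powr_less_mono2) auto
    then show ?thesis unfolding nrm using assms(1,2) that
      by (cases "u = 0") (auto intro!: add_le_less_mono mult_left_mono mult_strict_left_mono)
  qed
  have *: "\<rho> z *\<^sub>R z = \<rho> w *\<^sub>R w" using assms(3) eq by metis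
  have n: "cmod (\<rho> z *\<^sub>R z) = \<rho> z * cmod z" for z
    using pos[of z] by (cases "z = 0") auto
  have cm: "cmod z = cmod w"
    using mono[of z w] mono[of w z] n[of z] n[of w] * by (metis linorder_neqE_linordered_idom order_less_irrefl)
  then have "\<rho> z = \<rho> w" by (simp add: \<rho>_def)
  with * pos[of z] cm show ?thesis by (cases "z = 0") auto
qed

section \<open>Algebra of the cubic map\<close>

text \<open>The factor by which \<^term>\<open>rmap\<close> changes the imaginary part, up to a positive factor; its zero
  set is the nonreal part of the preimage of the real line.\<close>
definition efun :: "complex \<Rightarrow> real" where
  "efun y = 2 + 2 * (cmod y)^4 + 5 * (cmod y)^2 - 16 * (Re y)^2"

lemma denom_nz: assumes "(cmod y)^2 < 2" shows "2 - y^2 \<noteq> 0"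
proof
  assume "2 - y^2 = 0"
  then have "y^2 = 2" by simp
  then have "cmod y ^ 2 = 2" by (metis norm_numeral norm_power)
  with assms show False by simp
qed

text \<open>Extending by the conjugate denominator leaves a real denominator, so the imaginary part
  can be read off the numerator.\<close>

lemma rmap_cnj: "rmap y = y * (1 - 2 * y^2) * (2 - cnj y ^2) / of_real ((cmod (2 - y^2))^2)"
proof (cases "2 - y^2 = 0")
  case False
  have "complex_of_real ((cmod (2 - y^2))^2) = (2 - y^2) * (2 - cnj y ^2)"
    unfolding complex_norm_square by simp
  moreover have "2 - cnj y ^2 \<noteq> 0"
    using False by (metis complex_cnj_diff complex_cnj_numeral complex_cnj_power complex_cnj_zero_iff)
  ultimately show ?thesis using False
    by (simp add: rmap_def)
qed (simp add: rmap_def)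

lemma numerator_expand:
  "Im (y * (1 - 2 * y^2) * (2 - cnj y ^2)) = Im y * efun y"
  unfolding efun_def cmod_power2 power4_eq_xxxx
  by (simp add: power2_eq_square cmod_def) (simp add: algebra_simps)

lemma Im_rmap: "Im (rmap y) = Im y * efun y / (cmod (2 - y^2))^2"
  unfolding rmap_cnj[of y] numerator_expand[symmetric] by (simp only: Im_divide_of_real)

lemma sgn_Im_rmap: "(cmod y)^2 < 2 \<Longrightarrow> sgn (Im (rmap y)) = sgn (Im y) * sgn (efun y)"
  using denom_nz[of y] by (simp add: Im_rmap sgn_mult sgn_divide)

text \<open>The second factor on the right is positive everywhere, so the sign of
  \<open>1 - cmod y\<close> decides whether the numerator or the denominator of
  \<open>rmap y\<close> is larger.\<close>

lemma blaschke_identity: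
  "(cmod (2 - y^2))^2 - (cmod (y * (1 - 2 * y^2)))^2 =
   (1 - (cmod y)^2) * (4 + 3 * (cmod y)^2 + 4 * (cmod y)^4 - 4 * Re (y^2))"
proof -
  have 4: "(cmod y)^4 = ((cmod y)^2)^2" by simp
  show ?thesis
    unfolding norm_mult power_mult_distrib 4 cmod_power2
    by (simp add: power2_eq_square) (simp add: algebra_simps)
qed

lemma blaschke_factor_pos: "4 + 3 * (cmod y)^2 + 4 * (cmod y)^4 - 4 * Re (y^2) > 0"
proof -
  define s where "s = (cmod y)^2"
  have "Re (y^2) \<le> s" unfolding s_def
    by (metis complex_Re_le_cmod norm_power)
  moreover have "4 * s^2 - s + 4 > 0"
  proof -
    have "4 * s^2 - s + 4 = (2 * s - 1/4)^2 + 63/16" by (simp add: power2_eq_square algebra_simps)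
    moreover have "(2 * s - 1/4)^2 \<ge> 0" by simp
    ultimately show ?thesis by linarith
  qed
  moreover have "(cmod y)^4 = s^2" by (simp add: s_def)
  ultimately show ?thesis unfolding s_def[symmetric] by simp
qed

lemma cmod_rmap_less:
  assumes "cmod y < 1" shows "cmod (rmap y) < 1"
proof -
  have s: "(cmod y)^2 < 1" using assms by (simp add: abs_square_less_1)
  then have "(cmod (y * (1 - 2 * y^2)))^2 < (cmod (2 - y^2))^2"
    using blaschke_identity[of y] mult_pos_pos[OF _ blaschke_factor_pos[of y], of "1 - (cmod y)^2"]
    by simp
  then have "cmod (y * (1 - 2 * y^2)) < cmod (2 - y^2)"
    using power_less_imp_less_base by fastforce
  then show ?thesis
    by (simp add: rmap_def norm_divide divide_less_eq)
qed

lemma cmod_rmap_gt: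
  assumes "cmod y > 1" "2 - y^2 \<noteq> 0" shows "cmod (rmap y) > 1"
proof -
  have s: "(cmod y)^2 > 1" using assms by simp
  then have "(cmod (y * (1 - 2 * y^2)))^2 > (cmod (2 - y^2))^2"
    using blaschke_identity[of y] mult_neg_pos[OF _ blaschke_factor_pos[of y], of "1 - (cmod y)^2"]
    by simp
  then have "cmod (y * (1 - 2 * y^2)) > cmod (2 - y^2)"
    using power_less_imp_less_base by fastforce
  then show ?thesis
    using assms by (simp add: rmap_def norm_divide less_divide_eq)
qed

lemma cmod_rmap_1:
  assumes "cmod y = 1" shows "cmod (rmap y) = 1"
proof -
  have "(cmod (y * (1 - 2 * y^2)))^2 = (cmod (2 - y^2))^2"
    using blaschke_identity[of y] assms by simp
  then have "cmod (y * (1 - 2 * y^2)) = cmod (2 - y^2)"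
    by simp
  then show ?thesis
    using denom_nz[of y] assms by (simp add: rmap_def norm_divide)
qed

lemma cmod_rmap_le: "cmod y \<le> 1 \<Longrightarrow> cmod (rmap y) \<le> 1"
  using cmod_rmap_less[of y] cmod_rmap_1[of y] by linarith

lemma rmap_inverse:
  assumes "y \<noteq> 0" shows "rmap (1 / y) = 1 / rmap y"
proof -
  have "rmap (1 / y) = (1 / y) * ((y^2 - 2) / y^2) / ((2 * y^2 - 1) / y^2)"
    using assms by (simp add: rmap_def field_simps)
  also have "\<dots> = (y^2 - 2) / (y * (2 * y^2 - 1))"
    using assms by simp
  also have "\<dots> = (2 - y^2) / (y * (1 - 2 * y^2))"
  proof -
    have "y^2 - 2 = - (2 - y^2)" "y * (2 * y^2 - 1) = - (y * (1 - 2 * y^2))" by (simp_all add: algebra_simps)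
    then show ?thesis by (simp only: minus_divide_divide)
  qed
  finally show ?thesis by (simp add: rmap_def)
qed

lemma efun_inverse: "cmod y = 1 \<Longrightarrow> efun (1 / y) = efun y"
  using complex_norm_square[of y] by (simp add: efun_def norm_divide Re_divide cmod_power2[symmetric])

text \<open>With r = \<open>y * cnj y\<close> and \<open>cnj y = 2 * Re y - y\<close>, the
  difference of the two cross products is y times \<open>efun y\<close>. The formula shows that the
  image is real and lies on the same side of 0 as \<open>Re y\<close>.\<close>

lemma rmap_on_efun_zero:
  assumes "efun y = 0" "2 - y^2 \<noteq> 0"
  shows "rmap y = of_real (4 * Re y * (cmod y)^2 / ((cmod y)^2 + 2))"
proof -
  define r where "r = (cmod y)^2"
  have r: "complex_of_real r = y * cnj y" unfolding r_def by (rule complex_norm_square)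
  define X where "X = complex_of_real (Re y)"
  have x: "cnj y = 2 * X - y" by (simp add: X_def complex_eq_iff)
  have E: "efun y = 2 + 2 * r^2 + 5 * r - 16 * (Re y)^2" by (simp add: efun_def r_def)
  have "y * (1 - 2 * y^2) * (of_real r + 2) - 4 * of_real (Re y) * of_real r * (2 - y^2) = y * of_real (efun y)"
    unfolding E of_real_add of_real_diff of_real_mult of_real_power of_real_numeral r x X_def[symmetric]
    by (simp add: power2_eq_square algebra_simps)
  then have "y * (1 - 2 * y^2) * (of_real r + 2) = 4 * of_real (Re y) * of_real r * (2 - y^2)"
    using assms(1) by simp
  moreover have "complex_of_real r + 2 \<noteq> 0"
  proof -
    have "r + 2 > 0" unfolding r_def by (simp add: add_nonneg_pos)
    then have "complex_of_real (r + 2) \<noteq> 0" by (metis less_irrefl of_real_eq_0_iff)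
    then show ?thesis by simp
  qed
  ultimately show ?thesis
    using assms(2) unfolding rmap_def r_def[symmetric] of_real_divide of_real_add of_real_mult of_real_numeral
    by (simp only: frac_eq_eq not_False_eq_True)
qed

text \<open>Vieta's relations for the cubic \<open>y (1 - 2 y^2) = crit_val (2 - y^2)\<close>, which
  has the double root \<open>crit_pt\<close> and the third root
  \<open>- crit_val / crit_pt^2\<close>: the sum of the roots and the sum of their pairwise
  products.\<close>

lemma crit_val_alt: "crit_val * (2 + crit_pt^2) = 4 * crit_pt^3" "4 * crit_val = crit_pt * (2 * crit_pt^2 + 1)"
proof -
  have nz: "2 - crit_pt^2 \<noteq> 0" using crit_pt_sq_bounds by simp
  have "crit_val * (2 - crit_pt^2) = crit_pt * (1 - 2 * crit_pt^2)"
    using nz by (simp add: crit_val_def)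
  then have "(2 - crit_pt^2) * (crit_val * (2 + crit_pt^2) - 4 * crit_pt^3) = crit_pt * (2 * crit_pt^4 - 11 * crit_pt^2 + 2)"
    "(2 - crit_pt^2) * (4 * crit_val - crit_pt * (2 * crit_pt^2 + 1)) = crit_pt * (2 * crit_pt^4 - 11 * crit_pt^2 + 2)"
    by algebra+
  then show "crit_val * (2 + crit_pt^2) = 4 * crit_pt^3" "4 * crit_val = crit_pt * (2 * crit_pt^2 + 1)"
    using nz crit_pt_eq by auto
qed

lemma crit_val_sq: "crit_val^2 = crit_pt^4 * (2 * crit_pt^2 + 1) / (crit_pt^2 + 2)"
proof -
  have "4 * crit_val^2 * (2 + crit_pt^2) = 4 * crit_pt^4 * (2 * crit_pt^2 + 1)"
    using crit_val_alt by algebra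
  then have "crit_val^2 * (crit_pt^2 + 2) = crit_pt^4 * (2 * crit_pt^2 + 1)" by (simp add: algebra_simps)
  moreover have "crit_pt^2 + 2 \<noteq> 0" using crit_pt_sq_bounds(1) by linarith
  ultimately show ?thesis by (simp add: eq_divide_eq)
qed

text \<open>On the zero set of the factor, the squared modulus of the image is an increasing function of
  the modulus, with minimal value at the real points.\<close>
lemma rmap_ge_crit_val:
  assumes "efun y = 0" "cmod y \<le> 1"
  shows "\<exists>w. rmap y = of_real w \<and> crit_val \<le> \<bar>w\<bar> \<and> sgn w = sgn (Re y)"
proof -
  define r where "r = (cmod y)^2"
  define w where "w = 4 * Re y * r / (r + 2)"
  have r1: "r \<le> 1" using assms(2) by (simp add: r_def power_le_one)
  have E: "16 * (Re y)^2 = 2 + 2 * r^2 + 5 * r" using assms(1) by (simp add: efun_def r_def)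
  have "(Re y)^2 \<le> r" by (simp add: r_def cmod_power2)
  \<comment> \<open>Moduli that occur on the zero set satisfy this quadratic inequality in r; its
    smaller root is \<open>crit_pt^2\<close> and its larger root is the reciprocal, beyond the unit
    disc.\<close>
  then have q: "2 * r^2 - 11 * r + 2 \<le> 0" using E by simp
  have rc: "crit_pt^2 \<le> r"
  proof (rule ccontr)
    assume "\<not> crit_pt^2 \<le> r"
    moreover have "2 * (crit_pt^2)^2 - 11 * crit_pt^2 + 2 = 0" using crit_pt_eq by simp
    ultimately have "(r - crit_pt^2) * (2 * r + 2 * crit_pt^2 - 11) \<le> 0"
      using q by (simp add: algebra_simps power2_eq_square)
    moreover have "r - crit_pt^2 < 0" "2 * r + 2 * crit_pt^2 - 11 < 0"
      using \<open>\<not> crit_pt^2 \<le> r\<close> r1 crit_pt_sq_bounds by linarith+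
    then have "(r - crit_pt^2) * (2 * r + 2 * crit_pt^2 - 11) > 0" by (rule mult_neg_neg)
    ultimately show False by linarith
  qed
  have r0: "0 < r" using rc crit_pt_sq_bounds by linarith
  have w2: "w^2 = r^2 * ((2 * r + 1) * (r + 2)) / (r + 2)^2"
    using E by (simp add: w_def power_divide power_mult_distrib algebra_simps power2_eq_square)
  then have w2: "w^2 = r^2 * ((2 * r + 1) / (r + 2))"
    using r0 by (simp add: power2_eq_square)
  have "(crit_pt^2)^2 * ((2 * crit_pt^2 + 1) / (crit_pt^2 + 2)) \<le> r^2 * ((2 * r + 1) / (r + 2))"
  proof (rule mult_mono)
    show "(crit_pt\<^sup>2)\<^sup>2 \<le> r\<^sup>2" using rc by (intro power_mono) auto
    show "(2 * crit_pt^2 + 1) / (crit_pt^2 + 2) \<le> (2 * r + 1) / (r + 2)"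
    proof -
      have "1 / (r + 2) \<le> 1 / (crit_pt^2 + 2)" using rc r0 by (intro divide_left_mono mult_pos_pos) (auto intro: add_nonneg_pos)
      moreover have "(2 * t + 1) / (t + 2) = 2 - 3 * (1 / (t + 2))" if "t > 0" for t :: real
        using that by (simp add: field_simps)
      ultimately show ?thesis using r0 crit_pt_sq_bounds(1) by simp
    qed
  qed (use r0 crit_pt_sq_bounds in auto)
  then have "crit_val^2 \<le> w^2" unfolding w2 crit_val_sq by simp
  then have "crit_val \<le> \<bar>w\<bar>" using crit_val_pos by (simp add: abs_le_square_iff[symmetric])
  moreover have "sgn w = sgn (Re y)" using r0 by (simp add: w_def sgn_mult sgn_divide)
  moreover have "rmap y = of_real w"
    using rmap_on_efun_zero[OF assms(1) denom_nz] r1 by (simp add: w_def r_def)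
  ultimately show ?thesis by blast
qed

lemma rmap_of_real: "rmap (of_real x) = of_real (x * (1 - 2 * x^2) / (2 - x^2))"
  by (simp add: rmap_def)

lemma efun_of_real: "efun (of_real x) = 2 * x^4 - 11 * x^2 + 2"
  by (simp add: efun_def power_even_abs)

lemma efun_of_real_sign:
  assumes "\<bar>x\<bar> \<le> 1"
  shows "efun (of_real x) < 0 \<longleftrightarrow> crit_pt < \<bar>x\<bar>" "efun (of_real x) = 0 \<longleftrightarrow> crit_pt = \<bar>x\<bar>"
proof -
  have x: "x^2 \<le> 1" using assms by (simp add: abs_square_le_1)
  have e: "efun (of_real x) = (x^2 - crit_pt^2) * (2 * x^2 + 2 * crit_pt^2 - 11)"
    using crit_pt_eq unfolding efun_of_real by algebra
  have neg: "2 * x^2 + 2 * crit_pt^2 - 11 < 0" using x crit_pt_sq_bounds by linarith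
  have *: "crit_pt < \<bar>x\<bar> \<longleftrightarrow> crit_pt^2 < x^2" "crit_pt = \<bar>x\<bar> \<longleftrightarrow> crit_pt^2 = x^2"
    using crit_pt_pos abs_le_square_iff[of x crit_pt] power2_eq_iff[of crit_pt x] by auto
  show "efun (of_real x) < 0 \<longleftrightarrow> crit_pt < \<bar>x\<bar>" "efun (of_real x) = 0 \<longleftrightarrow> crit_pt = \<bar>x\<bar>"
    unfolding * e mult_less_0_iff mult_eq_0_iff using neg by linarith+
qed

text \<open>The critical point is a double root of the equation for the critical value.\<close>
lemma rmap_real_less:
  assumes "- crit_pt \<le> x" "x \<le> 1" "x \<noteq> crit_pt"
  shows "x * (1 - 2 * x^2) / (2 - x^2) < crit_val"
proof -
  have x2: "x^2 \<le> 1" using assms crit_pt_less by (simp add: abs_square_le_1)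
  have c0: "crit_pt^2 > 0" using crit_pt_pos by simp
  \<comment> \<open>The linear factor \<open>crit_pt^2 * x + crit_val\<close> belongs to the third
    root of the cubic, which lies to the left of \<open>- crit_pt\<close>; hence it is positive on
    the interval considered.\<close>
  have "crit_pt^2 * ((2 - x^2) * crit_val - x * (1 - 2 * x^2)) = 2 * (x - crit_pt)^2 * (crit_pt^2 * x + crit_val)"
  proof -
    have "crit_pt^2 * ((2 - x^2) * crit_val - x * (1 - 2 * x^2)) =
        2 * (x - crit_pt)^2 * (crit_pt^2 * x + crit_val)
        + x^2 * (4 * crit_pt^3 - crit_val * (2 + crit_pt^2)) + x * crit_pt * (4 * crit_val - crit_pt * (2 * crit_pt^2 + 1))"
      by (simp add: power2_eq_square power3_eq_cube algebra_simps)
    then show ?thesis unfolding crit_val_alt by simp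
  qed
  moreover have "crit_pt^2 * x + crit_val > 0"
  proof -
    have "4 * crit_val > 4 * crit_pt^2 * crit_pt"
      using crit_val_alt(2) crit_pt_pos crit_pt_sq_bounds mult_strict_left_mono[of "4 * crit_pt^2" "2*crit_pt^2+1" crit_pt]
      by (simp add: algebra_simps)
    moreover have "crit_pt^2 * (- crit_pt) \<le> crit_pt^2 * x" using assms(1) by (intro mult_left_mono) auto
    ultimately show ?thesis by simp
  qed
  moreover have "(x - crit_pt)^2 > 0" using assms(3) by simp
  ultimately have "crit_pt^2 * ((2 - x^2) * crit_val - x * (1 - 2 * x^2)) > 0" by simp
  then have "(2 - x^2) * crit_val - x * (1 - 2 * x^2) > 0"
    using c0 by (simp add: zero_less_mult_iff)
  then show ?thesis using x2 by (simp add: divide_less_eq algebra_simps)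
qed

lemma rmap_minus: "rmap (- y) = - rmap y"
  by (simp add: rmap_def)

lemma rmap_crit_pt: "rmap (of_real crit_pt) = of_real crit_val"
  unfolding rmap_of_real crit_val_def ..

section \<open>Fibres and critical points of \<open>rmap\<close> in the closed disc\<close>

definition cubic :: "complex \<Rightarrow> complex poly" where
  "cubic w = [: - 2 * w, 1, w, - 2 :]"

lemma degree_cubic: "degree (cubic w) = 3"
  by (simp add: cubic_def)

lemma poly_cubic: "poly (cubic w) y = y * (1 - 2 * y^2) - w * (2 - y^2)"
  by (simp add: cubic_def algebra_simps power2_eq_square)

lemma rmap_eq_iff: "2 - y^2 \<noteq> 0 \<Longrightarrow> rmap y = w \<longleftrightarrow> poly (cubic w) y = 0"
  by (auto simp: poly_cubic rmap_def field_simps)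

lemma rmap_fiber:
  "finite {y. cmod y \<le> 1 \<and> rmap y = w}" "card {y. cmod y \<le> 1 \<and> rmap y = w} \<le> 3"
proof -
  have nz: "cubic w \<noteq> 0" by (simp add: cubic_def)
  have sub: "{y. cmod y \<le> 1 \<and> rmap y = w} \<subseteq> {y. poly (cubic w) y = 0}"
  proof clarify
    fix y assume "cmod y \<le> 1"
    then have "(cmod y)^2 < 2" using power_le_one[of "cmod y" 2] by simp
    then show "poly (cubic (rmap y)) y = 0" using rmap_eq_iff[OF denom_nz] by blast
  qed
  have fin: "finite {y. poly (cubic w) y = 0}" using nz by (rule poly_roots_finite)
  show "finite {y. cmod y \<le> 1 \<and> rmap y = w}" using sub fin by (rule finite_subset)
  show "card {y. cmod y \<le> 1 \<and> rmap y = w} \<le> 3"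
    using card_mono[OF fin sub] card_poly_roots_bound[OF nz] by (simp add: degree_cubic)
qed

text \<open>A root of the cubic is no zero of the denominator, because numerator and denominator
  have no common zero. It lies in the closed disc, because \<open>rmap\<close> maps the outside of
  the disc, poles excepted, to the outside.\<close>

lemma rmap_surj:
  assumes "cmod w \<le> 1" obtains y where "cmod y \<le> 1" "rmap y = w"
proof -
  have "coeff (cubic w) 3 \<noteq> 0" by (simp add: cubic_def numeral_3_eq_3)
  then have "\<exists>i \<in> {1..degree (cubic w)}. coeff (cubic w) i \<noteq> 0" by (auto simp: degree_cubic)
  then obtain y where y: "poly (cubic w) y = 0"
    using fundamental_theorem_of_algebra[of "coeff (cubic w)" "degree (cubic w)"] unfolding poly_altdef by blast
  have nz: "2 - y^2 \<noteq> 0"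
  proof
    assume 0: "2 - y^2 = 0"
    then have y2: "y^2 = 2" by simp
    have "y * (1 - 2 * 2) - w * (2 - 2) = 0" using y unfolding poly_cubic y2 .
    then have "y = 0" by simp
    with y2 show False by simp
  qed
  then have "rmap y = w" using y rmap_eq_iff by blast
  then show ?thesis using that[of y] cmod_rmap_gt[OF _ nz] assms by force
qed

lemma deriv_rmap:
  assumes "2 - y^2 \<noteq> 0"
  shows "(rmap has_field_derivative (2 * y^4 - 11 * y^2 + 2) / (2 - y^2)^2) (at y)"
proof -
  have "((\<lambda>y. y * (1 - 2 * y^2) / (2 - y^2)) has_field_derivative
     ((1 - 6 * y^2) * (2 - y^2) - y * (1 - 2 * y^2) * (- 2 * y)) / ((2 - y^2) * (2 - y^2))) (at y)"
    by (rule derivative_eq_intros refl assms | simp add: algebra_simps power2_eq_square)+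
  moreover have "(1 - 6 * y^2) * (2 - y^2) - y * (1 - 2 * y^2) * (- 2 * y) = 2 * y^4 - 11 * y^2 + 2"
    by (simp add: algebra_simps power2_eq_square power4_eq_xxxx)
  ultimately show ?thesis unfolding rmap_def[abs_def] by (simp add: power2_eq_square)
qed

lemma holomorphic_rmap: "rmap holomorphic_on {y. (cmod y)^2 < 2}"
  unfolding rmap_def[abs_def] using denom_nz by (intro holomorphic_intros) auto

text \<open>The other two zeros of the derivative are the reciprocals of these. They have modulus
  above 1 and appear only through the chart of the other hemisphere.\<close>

lemma deriv_rmap_eq_0_iff:
  assumes "cmod y \<le> 1"
  shows "deriv rmap y = 0 \<longleftrightarrow> y = of_real crit_pt \<or> y = - of_real crit_pt"
proof -
  have "(cmod y)^2 \<le> 1" using assms by (simp add: power_le_one)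
  then have nz: "2 - y^2 \<noteq> 0" by (intro denom_nz) simp
  have "complex_of_real (2 * crit_pt^4 - 11 * crit_pt^2 + 2) = 0" unfolding crit_pt_eq by simp
  then have c: "2 * (of_real crit_pt)^4 - 11 * (of_real crit_pt)^2 + 2 = (0::complex)" by simp
  have "2 * y^4 - 11 * y^2 + 2 = (y - of_real crit_pt) * (y + of_real crit_pt) * (2 * y^2 + 2 * of_real (crit_pt^2) - 11)"
  proof -
    have "2 * y^4 - 11 * y^2 + 2 = (y - of_real crit_pt) * (y + of_real crit_pt) * (2 * y^2 + 2 * of_real (crit_pt^2) - 11)
        + (2 * (of_real crit_pt)^4 - 11 * (of_real crit_pt)^2 + 2)"
      by (simp add: power2_eq_square power4_eq_xxxx algebra_simps)
    then show ?thesis unfolding c by simp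
  qed
  moreover have "2 * y^2 + 2 * of_real (crit_pt^2) - 11 \<noteq> 0"
  proof
    assume "2 * y^2 + 2 * of_real (crit_pt^2) - 11 = 0"
    then have "y^2 = of_real (11/2 - crit_pt^2)" by (simp add: field_simps)
    then have "(cmod y)^2 = \<bar>11/2 - crit_pt^2\<bar>" by (metis norm_power norm_of_real)
    then show False using \<open>(cmod y)^2 \<le> 1\<close> crit_pt_sq_bounds by linarith
  qed
  ultimately show ?thesis
    using DERIV_imp_deriv[OF deriv_rmap[OF nz]] nz by (auto simp: eq_neg_iff_add_eq_0)
qed

section \<open>The Thurston map\<close>

text \<open>Two charts, each used only over its closed unit disc, keep poles and the point at
  infinity out of the formula. The pieces agree on the equator because \<open>twist\<close> and
  \<open>rmap\<close> commute with inversion.\<close>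

definition tmap :: "real^3 \<Rightarrow> real^3" where
  "tmap x = (if x$3 \<le> 0 then stereo_inv (rmap (twist (stereo x)))
             else flip (stereo_inv (rmap (twist (stereo (flip x))))))"

definition esph :: "real^3 \<Rightarrow> real" where
  "esph x = efun (twist (stereo (if x$3 \<le> 0 then x else flip x)))"

text \<open>Absolute height of the four critical points. On the real circle,
  \<open>\<bar>x $ 3\<bar> < eta\<close> says that the modulus of the coordinate lies between
  \<open>crit_val\<close> and its reciprocal.\<close>

definition eta :: real where
  "eta = (1 - crit_val^2) / (1 + crit_val^2)"

lemma tmap_S2 [simp]: "tmap x \<in> S2"
  by (simp add: tmap_def)

lemma tmap_lower: "cmod z \<le> 1 \<Longrightarrow> tmap (stereo_inv z) = stereo_inv (rmap (twist z))"
  using stereo_inv_nth3_le[of z] by (simp add: tmap_def del: stereo_inv_nth)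

lemma esph_lower: "cmod z \<le> 1 \<Longrightarrow> esph (stereo_inv z) = efun (twist z)"
  using stereo_inv_nth3_le[of z] by (simp add: esph_def del: stereo_inv_nth)

lemma equator_facts:
  assumes "x \<in> S2" "x$3 = 0"
  shows "cmod (stereo x) = 1" "stereo (flip x) = 1 / stereo x" "stereo x \<noteq> 0"
proof -
  have n: "x \<noteq> north_pole" "x \<noteq> south_pole" using assms by auto
  have "(cmod (stereo x))^2 = 1" using cmod_stereo[OF assms(1) n(1)] assms(2) by simp
  then show "cmod (stereo x) = 1" by (metis norm_ge_zero one_power2 power2_eq_iff_nonneg zero_le_one)
  then show "stereo x \<noteq> 0" by auto
  show "stereo (flip x) = 1 / stereo x" using stereo_flip assms n by blast
qed

lemma tmap_flip: assumes "x \<in> S2" shows "tmap (flip x) = flip (tmap x)"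
proof (cases "x$3 = 0")
  case True
  note e = equator_facts[OF assms True]
  have t: "cmod (twist (stereo x)) = 1" using e(1) by (simp add: cmod_twist)
  then have r: "rmap (twist (stereo x)) \<noteq> 0" using cmod_rmap_1 by fastforce
  show ?thesis
    using True e t r by (simp add: tmap_def twist_inverse rmap_inverse flip_stereo_inv)
next
  case False
  then show ?thesis by (auto simp: tmap_def)
qed

lemma esph_flip: assumes "x \<in> S2" shows "esph (flip x) = esph x"
proof (cases "x$3 = 0")
  case True
  note e = equator_facts[OF assms True]
  have t: "cmod (twist (stereo x)) = 1" using e(1) by (simp add: cmod_twist)
  show ?thesis
    using True e t by (simp add: esph_def twist_inverse efun_inverse)
next
  case False
  then show ?thesis by (auto simp: esph_def)
qed

text \<open>Local models at equatorial points need the chart formula on a neighbourhood of the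
  closed disc. Beyond the circle it is carried over by the half turn: the bound keeps
  \<open>rmap (twist z)\<close> finite, and modulus above 1 keeps it nonzero.\<close>

lemma tmap_stereo_inv:
  assumes "(cmod (twist z))^2 < 2"
  shows "tmap (stereo_inv z) = stereo_inv (rmap (twist z))"
proof (cases "cmod z \<le> 1")
  case True
  then show ?thesis by (rule tmap_lower)
next
  case False
  then have z: "z \<noteq> 0" and z1: "cmod (1 / z) \<le> 1" by (auto simp: norm_divide divide_le_eq)
  have "tmap (stereo_inv z) = flip (tmap (flip (stereo_inv z)))"
    by (simp add: tmap_flip)
  also have "flip (stereo_inv z) = stereo_inv (1 / z)" using flip_stereo_inv z by blast
  also have "tmap (stereo_inv (1 / z)) = stereo_inv (rmap (twist (1 / z)))"
    using z1 by (rule tmap_lower)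
  also have "rmap (twist (1 / z)) = 1 / rmap (twist z)" using z by (simp add: twist_inverse rmap_inverse)
  also have "flip (stereo_inv (1 / rmap (twist z))) = stereo_inv (rmap (twist z))"
  proof -
    have "2 - (twist z)^2 \<noteq> 0" using assms denom_nz by blast
    moreover have "1 - 2 * (twist z)^2 \<noteq> 0"
    proof
      assume "1 - 2 * (twist z)^2 = 0"
      then have "(twist z)^2 = 1/2" by (simp add: eq_divide_eq mult.commute)
      then have "(cmod (twist z))^2 = 1/2" by (metis norm_power norm_divide norm_one norm_numeral)
      moreover have "1 < cmod (twist z)" using False cmod_twist_le_1[of z] by simp
      then have "1 < (cmod (twist z))^2" by simp
      ultimately show False by simp
    qed
    ultimately have "rmap (twist z) \<noteq> 0" using z by (simp add: rmap_def)
    then show ?thesis by (simp add: flip_stereo_inv)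
  qed
  finally show ?thesis .
qed

lemma S2_wlog_lower:
  assumes "x \<in> S2" "\<And>z. cmod z \<le> 1 \<Longrightarrow> Q (stereo_inv z)" "\<And>x. x \<in> S2 \<Longrightarrow> Q x \<Longrightarrow> Q (flip x)"
  shows "Q x"
  using hemisphere_cases[OF assms(1)] assms(2,3) stereo_inv_S2 by metis

lemma continuous_on_S2_halves:
  fixes g :: "real^3 \<Rightarrow> 'b::topological_space"
  assumes "continuous_on (S2 \<inter> {x. x$3 \<le> 0}) g" "continuous_on (S2 \<inter> {x. 0 \<le> x$3}) g"
  shows "continuous_on S2 g"
proof -
  have "closed (S2 \<inter> {x. x$3 \<le> 0})" "closed (S2 \<inter> {x. 0 \<le> x$3})"
    unfolding S2_def by (auto intro!: closed_Int closed_Collect_le continuous_intros)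
  then have "continuous_on (S2 \<inter> {x. x$3 \<le> 0} \<union> S2 \<inter> {x. 0 \<le> x$3}) g"
    using assms by (intro continuous_on_closed_Un)
  moreover have "S2 \<inter> {x. x$3 \<le> 0} \<union> S2 \<inter> {x. 0 \<le> x$3} = S2" by auto
  ultimately show ?thesis by simp
qed

lemma continuous_on_stereo_lower: "continuous_on (S2 \<inter> {x. x$3 \<le> 0}) stereo"
  by (rule continuous_on_subset[OF continuous_on_stereo]) auto

lemma continuous_on_rmap_disc: "continuous_on (cball 0 1) rmap"
proof (rule continuous_on_subset[OF holomorphic_on_imp_continuous_on[OF holomorphic_rmap]])
  show "cball 0 1 \<subseteq> {y::complex. (cmod y)^2 < 2}"
  proof
    fix y :: complex assume "y \<in> cball 0 1"
    then have "(cmod y)^2 \<le> 1" by (simp add: power_le_one)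
    then show "y \<in> {y. (cmod y)^2 < 2}" by simp
  qed
qed

lemma continuous_on_tmap_lower: "continuous_on (S2 \<inter> {x. x$3 \<le> 0}) tmap"
proof -
  have "continuous_on (S2 \<inter> {x. x$3 \<le> 0}) (\<lambda>x. stereo_inv (rmap (twist (stereo x))))"
  proof (intro continuous_intros continuous_on_compose2[OF continuous_on_rmap_disc])
    show "continuous_on (S2 \<inter> {x. x$3 \<le> 0}) stereo" by (rule continuous_on_stereo_lower)
  qed (auto simp: cmod_twist_le_1 cmod_stereo_le)
  then show ?thesis
    by (rule continuous_on_eq) (auto simp: tmap_def)
qed

lemma continuous_on_esph_lower: "continuous_on (S2 \<inter> {x. x$3 \<le> 0}) esph"
proof -
  have "continuous_on (S2 \<inter> {x. x$3 \<le> 0}) (\<lambda>x. efun (twist (stereo x)))"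
    unfolding efun_def by (intro continuous_intros continuous_on_stereo_lower)
  then show ?thesis
    by (rule continuous_on_eq) (auto simp: esph_def)
qed

lemma continuous_on_flip_halves:
  fixes g :: "real^3 \<Rightarrow> 'b::topological_space" and h :: "'b \<Rightarrow> 'b"
  assumes "continuous_on (S2 \<inter> {x. x$3 \<le> 0}) g" "continuous_on UNIV h" "\<And>x. x \<in> S2 \<Longrightarrow> g (flip x) = h (g x)"
  shows "continuous_on S2 g"
proof (rule continuous_on_S2_halves[OF assms(1)])
  have "continuous_on (S2 \<inter> {x. 0 \<le> x$3}) (\<lambda>x. h (g (flip x)))"
    by (rule continuous_on_compose2[OF assms(2)], rule continuous_on_compose2[OF assms(1)])
      (auto intro!: continuous_intros)
  then show "continuous_on (S2 \<inter> {x. 0 \<le> x$3}) g"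
    by (rule continuous_on_eq) (metis IntE assms(3) flip_S2 flip_flip)
qed

lemma continuous_on_tmap: "continuous_on S2 tmap"
  by (rule continuous_on_flip_halves[of _ flip])
    (auto intro!: continuous_on_tmap_lower continuous_intros simp: tmap_flip)

lemma continuous_on_esph: "continuous_on S2 esph"
  by (rule continuous_on_flip_halves[of _ "\<lambda>x. x"])
    (auto intro!: continuous_on_esph_lower continuous_intros simp: esph_flip)

lemma tmap_nth3_neg: assumes "x \<in> S2" shows "tmap x $ 3 < 0 \<longleftrightarrow> x$3 < 0"
proof -
  have neg: "tmap x $ 3 < 0 \<longleftrightarrow> x$3 < 0" if x: "x$3 \<le> 0" "x \<in> S2" for x
  proof -
    have "x \<noteq> north_pole" using x(1) by auto
    then obtain z where z: "cmod z \<le> 1" "x = stereo_inv z"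
      using x cmod_stereo_le stereo_inv_stereo by metis
    have "cmod (rmap (twist z)) < 1 \<longleftrightarrow> cmod z < 1"
      using cmod_rmap_less[of "twist z"] cmod_rmap_1[of "twist z"] cmod_twist_less_1[of z] cmod_twist_le_1[of z] z(1)
      by linarith
    then show ?thesis unfolding z(2) tmap_lower[OF z(1)] stereo_inv_nth3_neg .
  qed
  show ?thesis
  proof (cases "x$3 \<le> 0")
    case False
    then have f: "flip x $ 3 \<le> 0" "flip x $ 3 < 0" by auto
    then have "tmap (flip x) $ 3 < 0" using neg[OF f(1)] assms by simp
    then show ?thesis using False assms by (simp add: tmap_flip)
  qed (use neg assms in blast)
qed

lemma tmap_nth3_pos: assumes "x \<in> S2" shows "tmap x $ 3 > 0 \<longleftrightarrow> x$3 > 0"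
  using tmap_nth3_neg[of "flip x"] assms by (simp add: tmap_flip)

section \<open>Surjectivity and fibres on the sphere\<close>

lemma tmap_surj: "tmap ` S2 = S2"
proof -
  have "x \<in> tmap ` S2" if "x \<in> S2" for x
    using that
  proof (rule S2_wlog_lower)
    fix z :: complex assume "cmod z \<le> 1"
    then obtain y where y: "cmod y \<le> 1" "rmap y = z" by (rule rmap_surj)
    have "cmod (untwist y) \<le> 1" using y(1) cmod_twist_le_1[of "untwist y"] by (simp add: twist_untwist)
    then have "tmap (stereo_inv (untwist y)) = stereo_inv z" by (simp add: tmap_lower twist_untwist y)
    then show "stereo_inv z \<in> tmap ` S2" by (metis imageI stereo_inv_S2)
  next
    fix x :: "real^3" assume "x \<in> S2" "x \<in> tmap ` S2"
    then obtain u where "u \<in> S2" "x = tmap u" by blast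
    then have "flip x = tmap (flip u)" "flip u \<in> S2" by (auto simp: tmap_flip)
    then show "flip x \<in> tmap ` S2" by blast
  qed
  then show ?thesis by auto
qed

text \<open>No point above the equator maps to the closed lower hemisphere, so every preimage of q
  is a root of one cubic in the lower chart.\<close>

lemma tmap_fiber_lower:
  assumes "q \<in> S2" "q $ 3 \<le> 0"
  shows "finite (S2 \<inter> tmap -` {q})" "card (S2 \<inter> tmap -` {q}) \<le> 3"
proof -
  have sub: "S2 \<inter> tmap -` {q} \<subseteq> (stereo_inv \<circ> untwist) ` {y. cmod y \<le> 1 \<and> rmap y = stereo q}"
  proof
    fix x assume x: "x \<in> S2 \<inter> tmap -` {q}"
    then have x3: "x $ 3 \<le> 0" using tmap_nth3_pos[of x] assms by auto
    have xe: "x = (stereo_inv \<circ> untwist) (twist (stereo x))"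
      using x x3 by (simp add: untwist_twist) (metis stereo_inv_stereo north_nth(3) not_one_le_zero)
    have "stereo q = rmap (twist (stereo x))"
      using x x3 by (auto simp: tmap_def)
    moreover have "cmod (twist (stereo x)) \<le> 1" using x x3 by (simp add: cmod_twist_le_1 cmod_stereo_le)
    ultimately show "x \<in> (stereo_inv \<circ> untwist) ` {y. cmod y \<le> 1 \<and> rmap y = stereo q}"
      by (subst xe) (rule imageI, simp)
  qed
  show "finite (S2 \<inter> tmap -` {q})" using sub rmap_fiber(1) by (meson finite_imageI finite_subset)
  have "card (S2 \<inter> tmap -` {q}) \<le> card ((stereo_inv \<circ> untwist) ` {y. cmod y \<le> 1 \<and> rmap y = stereo q})"
    by (rule card_mono[OF finite_imageI[OF rmap_fiber(1)] sub])
  also have "\<dots> \<le> card {y. cmod y \<le> 1 \<and> rmap y = stereo q}" by (rule card_image_le[OF rmap_fiber(1)])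
  also have "\<dots> \<le> 3" by (rule rmap_fiber(2))
  finally show "card (S2 \<inter> tmap -` {q}) \<le> 3" .
qed

lemma tmap_fiber:
  assumes "q \<in> S2"
  shows "finite (S2 \<inter> tmap -` {q})" "card (S2 \<inter> tmap -` {q}) \<le> 3"
proof -
  have "finite (S2 \<inter> tmap -` {q}) \<and> card (S2 \<inter> tmap -` {q}) \<le> 3"
  proof (cases "q $ 3 \<le> 0")
    case True
    then show ?thesis using tmap_fiber_lower assms by blast
  next
    case False
    have "flip ` (S2 \<inter> tmap -` {q}) = S2 \<inter> tmap -` {flip q}"
    proof (intro set_eqI iffI)
      fix x assume "x \<in> S2 \<inter> tmap -` {flip q}"
      then have "flip x \<in> S2 \<inter> tmap -` {q}" by (auto simp: tmap_flip)
      then show "x \<in> flip ` (S2 \<inter> tmap -` {q})" by (metis flip_flip imageI)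
    qed (auto simp: tmap_flip)
    moreover have "inj_on flip X" for X by (metis flip_flip inj_onI)
    moreover have "flip q \<in> S2" "flip q $ 3 \<le> 0" using assms False by auto
    ultimately show ?thesis using tmap_fiber_lower[of "flip q"] by (metis card_image finite_imageD)
  qed
  then show "finite (S2 \<inter> tmap -` {q})" "card (S2 \<inter> tmap -` {q}) \<le> 3" by auto
qed

section \<open>The real great circle and the zero set of \<open>esph\<close>\<close>

lemma S2_wlog_real:
  assumes "x \<in> S2" "x $ 2 = 0" "\<And>u. \<bar>u\<bar> \<le> 1 \<Longrightarrow> Q (stereo_inv (of_real u))" "\<And>x. x \<in> S2 \<Longrightarrow> Q x \<Longrightarrow> Q (flip x)"
  shows "Q x"
proof -
  have "x $ 2 = 0 \<longrightarrow> Q x" using assms(1)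
  proof (rule S2_wlog_lower)
    fix z :: complex assume "cmod z \<le> 1"
    then show "stereo_inv z $ 2 = 0 \<longrightarrow> Q (stereo_inv z)"
      using assms(3)[of "Re z"] abs_Re_le_cmod[of z] complex_is_Real_iff[of z]
      by (auto simp del: stereo_inv_nth simp: stereo_inv_nth(2) of_real_Re)
  qed (use assms(4) in auto)
  then show ?thesis using assms(2) by simp
qed

lemma twist_of_real:
  "\<exists>u'. twist (of_real u) = of_real u' \<and> sgn u' = sgn u \<and> (\<bar>u'\<bar> < crit_pt \<longleftrightarrow> \<bar>u\<bar> < crit_val) \<and>
    (\<bar>u'\<bar> > crit_pt \<longleftrightarrow> \<bar>u\<bar> > crit_val) \<and> (\<bar>u'\<bar> \<le> 1 \<longleftrightarrow> \<bar>u\<bar> \<le> 1)"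
proof -
  define u' where "u' = \<bar>u\<bar> powr (twist_exp - 1) * u"
  have t: "twist (of_real u) = of_real u'" by (simp add: twist_def u'_def)
  have "cmod (twist (of_real u)) < cmod (twist (of_real crit_val)) \<longleftrightarrow> cmod (of_real u) < cmod (of_real crit_val)"
    "cmod (twist (of_real u)) > cmod (twist (of_real crit_val)) \<longleftrightarrow> cmod (of_real u) > cmod (of_real crit_val)"
    by (rule cmod_twist_less_iff)+
  then have "\<bar>u'\<bar> < crit_pt \<longleftrightarrow> \<bar>u\<bar> < crit_val" "\<bar>u'\<bar> > crit_pt \<longleftrightarrow> \<bar>u\<bar> > crit_val"
    using crit_pt_pos crit_val_pos by (simp_all add: t twist_crit_val)
  moreover have "\<bar>u'\<bar> \<le> 1 \<longleftrightarrow> \<bar>u\<bar> \<le> 1" using cmod_twist_le_1[of "of_real u"] by (simp add: t)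
  moreover have "sgn u' = sgn u" by (cases "u = 0") (auto simp: u'_def sgn_mult)
  ultimately show ?thesis using t by blast
qed

lemma nth3_of_real:
  assumes "\<bar>u\<bar> \<le> 1"
  shows "\<bar>stereo_inv (of_real u) $ 3\<bar> < eta \<longleftrightarrow> crit_val < \<bar>u\<bar>"
    "\<bar>stereo_inv (of_real u) $ 3\<bar> = eta \<longleftrightarrow> crit_val = \<bar>u\<bar>"
    "\<bar>stereo_inv (of_real u) $ 3\<bar> > eta \<longleftrightarrow> \<bar>u\<bar> < crit_val"
proof -
  have u2: "u^2 \<le> 1" using assms by (simp add: abs_square_le_1)
  have p: "1 + u^2 > 0" "1 + crit_val^2 > 0" by (auto intro: add_pos_nonneg)
  have e: "\<bar>stereo_inv (of_real u) $ 3\<bar> = (1 - u^2) / (1 + u^2)"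
  proof -
    have "stereo_inv (of_real u) $ 3 = - ((1 - u^2) / (1 + u^2))" using p by (simp add: divide_simps)
    then show ?thesis using u2 p by simp
  qed
  have *: "(1 - u^2) / (1 + u^2) < (1 - crit_val^2) / (1 + crit_val^2) \<longleftrightarrow> crit_val^2 < u^2"
    "(1 - crit_val^2) / (1 + crit_val^2) < (1 - u^2) / (1 + u^2) \<longleftrightarrow> u^2 < crit_val^2"
  proof -
    have "(1 - t) / (1 + t) = 2 * (1 / (1 + t)) - 1" if "1 + t > 0" for t :: real
    proof -
      have "1 - t = 2 - (1 + t)" by simp
      then show ?thesis using that by (simp only: diff_divide_distrib) simp
    qed
    moreover have "1 / (1 + u^2) < 1 / (1 + crit_val^2) \<longleftrightarrow> crit_val^2 < u^2"
      "1 / (1 + crit_val^2) < 1 / (1 + u^2) \<longleftrightarrow> u^2 < crit_val^2"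
      using p by (simp_all only: inverse_eq_divide[symmetric] inverse_less_iff_less) simp_all
    ultimately show "(1 - u^2) / (1 + u^2) < (1 - crit_val^2) / (1 + crit_val^2) \<longleftrightarrow> crit_val^2 < u^2"
      "(1 - crit_val^2) / (1 + crit_val^2) < (1 - u^2) / (1 + u^2) \<longleftrightarrow> u^2 < crit_val^2"
      using p by auto
  qed
  have **: "crit_val^2 < u^2 \<longleftrightarrow> crit_val < \<bar>u\<bar>" "u^2 < crit_val^2 \<longleftrightarrow> \<bar>u\<bar> < crit_val"
    using crit_val_pos abs_le_square_iff[of u crit_val] abs_le_square_iff[of crit_val u] by auto
  show 1: "\<bar>stereo_inv (of_real u) $ 3\<bar> < eta \<longleftrightarrow> crit_val < \<bar>u\<bar>"
    "\<bar>stereo_inv (of_real u) $ 3\<bar> > eta \<longleftrightarrow> \<bar>u\<bar> < crit_val"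
    unfolding e eta_def * ** by (rule refl)+
  then show "\<bar>stereo_inv (of_real u) $ 3\<bar> = eta \<longleftrightarrow> crit_val = \<bar>u\<bar>" by linarith
qed

lemma sgn_nth1_stereo_inv: "sgn (stereo_inv z $ 1) = sgn (Re z)" and sgn_nth2_stereo_inv: "sgn (stereo_inv z $ 2) = sgn (Im z)"
  by (simp_all add: sgn_divide sgn_mult)

text \<open>The image changes sides of the real circle when the point crosses either that circle or
  the zero set of \<open>esph\<close>. All later crossing arguments rest on this product
  formula.\<close>

lemma sgn_tmap_nth2: assumes "x \<in> S2" shows "sgn (tmap x $ 2) = sgn (x $ 2) * sgn (esph x)"
  using assms
proof (rule S2_wlog_lower)
  fix z :: complex assume z: "cmod z \<le> 1"
  then have "(cmod (twist z))^2 < 2" using cmod_twist_le_1[of z] power_le_one[of "cmod (twist z)" 2] by simp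
  then show "sgn (tmap (stereo_inv z) $ 2) = sgn (stereo_inv z $ 2) * sgn (esph (stereo_inv z))"
    using z by (simp add: tmap_lower esph_lower sgn_nth2_stereo_inv sgn_Im_rmap sgn_Im_twist del: stereo_inv_nth)
qed (simp add: tmap_flip esph_flip sgn_minus)

text \<open>The loop around a bulb is folded onto the closed middle arc on its own side, by the
  lower bound for \<open>rmap\<close> on the zeros of \<open>efun\<close>.\<close>

lemma esph_zero:
  assumes "x \<in> S2" "esph x = 0"
  shows "\<bar>tmap x $ 3\<bar> \<le> eta" "sgn (tmap x $ 1) = sgn (x $ 1)"
proof -
  have "esph x = 0 \<longrightarrow> \<bar>tmap x $ 3\<bar> \<le> eta \<and> sgn (tmap x $ 1) = sgn (x $ 1)"
    using assms(1)
  proof (rule S2_wlog_lower)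
    fix z :: complex assume z: "cmod z \<le> 1"
    show "esph (stereo_inv z) = 0 \<longrightarrow> \<bar>tmap (stereo_inv z) $ 3\<bar> \<le> eta \<and> sgn (tmap (stereo_inv z) $ 1) = sgn (stereo_inv z $ 1)"
    proof
      assume "esph (stereo_inv z) = 0"
      then have "efun (twist z) = 0" using z by (simp add: esph_lower)
      moreover have t: "cmod (twist z) \<le> 1" using z by (simp add: cmod_twist_le_1)
      ultimately obtain w where w: "rmap (twist z) = of_real w" "crit_val \<le> \<bar>w\<bar>" "sgn w = sgn (Re (twist z))"
        using rmap_ge_crit_val by blast
      have w1: "\<bar>w\<bar> \<le> 1" using cmod_rmap_le[OF t] w(1) by simp
      have "\<bar>stereo_inv (of_real w) $ 3\<bar> \<le> eta" using nth3_of_real[OF w1] w(2) by linarith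
      moreover have "sgn (stereo_inv (of_real w) $ 1) = sgn (stereo_inv z $ 1)"
        unfolding sgn_nth1_stereo_inv using w(3) by (simp add: sgn_Re_twist)
      ultimately show "\<bar>tmap (stereo_inv z) $ 3\<bar> \<le> eta \<and> sgn (tmap (stereo_inv z) $ 1) = sgn (stereo_inv z $ 1)"
        using z by (simp add: tmap_lower w(1) del: stereo_inv_nth)
    qed
  qed (auto simp: tmap_flip esph_flip)
  then show "\<bar>tmap x $ 3\<bar> \<le> eta" "sgn (tmap x $ 1) = sgn (x $ 1)" using assms(2) by auto
qed

text \<open>Without real part the only negative term of \<open>efun\<close> disappears. The great
  circle \<open>x $ 1 = 0\<close> thus separates the two bulbs.\<close>

lemma esph_imaginary: assumes "x \<in> S2" "x $ 1 = 0" shows "esph x > 0"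
proof -
  have "x $ 1 = 0 \<longrightarrow> esph x > 0" using assms(1)
  proof (rule S2_wlog_lower)
    fix z :: complex assume z: "cmod z \<le> 1"
    have "efun y > 0" if "Re y = 0" for y using that by (auto simp: efun_def intro!: add_pos_nonneg)
    then show "stereo_inv z $ 1 = 0 \<longrightarrow> esph (stereo_inv z) > 0"
      using z by (simp add: esph_lower Re_twist)
  qed (auto simp: esph_flip)
  then show ?thesis using assms(2) by simp
qed

lemma esph_real:
  assumes "x \<in> S2" "x $ 2 = 0"
  shows "esph x < 0 \<longleftrightarrow> \<bar>x $ 3\<bar> < eta" "esph x = 0 \<longleftrightarrow> \<bar>x $ 3\<bar> = eta"
proof -
  have "(esph x < 0 \<longleftrightarrow> \<bar>x $ 3\<bar> < eta) \<and> (esph x = 0 \<longleftrightarrow> \<bar>x $ 3\<bar> = eta)"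
    using assms
  proof (rule S2_wlog_real)
    fix u :: real assume u: "\<bar>u\<bar> \<le> 1"
    obtain u' where u': "twist (of_real u) = of_real u'" "\<bar>u'\<bar> < crit_pt \<longleftrightarrow> \<bar>u\<bar> < crit_val" "\<bar>u'\<bar> > crit_pt \<longleftrightarrow> \<bar>u\<bar> > crit_val" "\<bar>u'\<bar> \<le> 1"
      using twist_of_real[of u] u by auto
    have "crit_pt = \<bar>u'\<bar> \<longleftrightarrow> crit_val = \<bar>u\<bar>" using u'(2,3) by linarith
    then show "(esph (stereo_inv (of_real u)) < 0 \<longleftrightarrow> \<bar>stereo_inv (of_real u) $ 3\<bar> < eta) \<and>
        (esph (stereo_inv (of_real u)) = 0 \<longleftrightarrow> \<bar>stereo_inv (of_real u) $ 3\<bar> = eta)"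
      unfolding nth3_of_real[OF u] using u u'(3) efun_of_real_sign[OF u'(4)] by (simp add: esph_lower u'(1))
  qed (auto simp: esph_flip)
  then show "esph x < 0 \<longleftrightarrow> \<bar>x $ 3\<bar> < eta" "esph x = 0 \<longleftrightarrow> \<bar>x $ 3\<bar> = eta" by auto
qed

lemma rmap_real_bounds:
  assumes "\<bar>y\<bar> \<le> 1"
  obtains w where "rmap (of_real y) = of_real w" "\<bar>w\<bar> \<le> 1"
    "\<bar>y\<bar> < crit_pt \<Longrightarrow> \<bar>w\<bar> < crit_val" "crit_pt < y \<Longrightarrow> w < crit_val" "y < - crit_pt \<Longrightarrow> - crit_val < w"
proof -
  define w where "w = y * (1 - 2 * y^2) / (2 - y^2)"
  have r: "rmap (of_real y) = of_real w" by (simp add: rmap_of_real w_def)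
  have w1: "\<bar>w\<bar> \<le> 1" using cmod_rmap_le[of "of_real y"] assms r by simp
  have *: "- w = (- y) * (1 - 2 * (- y)^2) / (2 - (- y)^2)" by (simp add: w_def)
  have less: "- crit_pt \<le> y \<Longrightarrow> y \<noteq> crit_pt \<Longrightarrow> w < crit_val" "y \<le> crit_pt \<Longrightarrow> y \<noteq> - crit_pt \<Longrightarrow> - w < crit_val"
    using rmap_real_less[of y] rmap_real_less[of "- y"] assms unfolding w_def[symmetric] *[symmetric] by auto
  show ?thesis
    by (rule that[OF r w1]) (use less crit_pt_pos in \<open>auto simp: abs_less_iff\<close>)
qed

lemma tmap_of_real:
  assumes "\<bar>u\<bar> \<le> 1"
  obtains w where "tmap (stereo_inv (of_real u)) = stereo_inv (of_real w)" "\<bar>w\<bar> \<le> 1"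
    "\<bar>u\<bar> < crit_val \<Longrightarrow> \<bar>w\<bar> < crit_val" "crit_val < u \<Longrightarrow> w < crit_val" "u < - crit_val \<Longrightarrow> - crit_val < w"
proof -
  obtain u' where u': "twist (of_real u) = of_real u'" "sgn u' = sgn u" "\<bar>u'\<bar> < crit_pt \<longleftrightarrow> \<bar>u\<bar> < crit_val" "\<bar>u'\<bar> > crit_pt \<longleftrightarrow> \<bar>u\<bar> > crit_val" "\<bar>u'\<bar> \<le> 1"
    using twist_of_real[of u] assms by auto
  obtain w where w: "rmap (of_real u') = of_real w" "\<bar>w\<bar> \<le> 1"
    "\<bar>u'\<bar> < crit_pt \<Longrightarrow> \<bar>w\<bar> < crit_val" "crit_pt < u' \<Longrightarrow> w < crit_val" "u' < - crit_pt \<Longrightarrow> - crit_val < w"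
    using rmap_real_bounds[OF u'(5)] by blast
  have "tmap (stereo_inv (of_real u)) = stereo_inv (of_real w)" using assms by (simp add: tmap_lower u'(1) w(1))
  moreover have "crit_val < u \<Longrightarrow> crit_pt < u'" "u < - crit_val \<Longrightarrow> u' < - crit_pt"
    using u'(2,4) crit_val_pos crit_pt_pos by (auto simp: sgn_if split: if_splits)
  ultimately show ?thesis using that w u' by blast
qed

lemma tmap_outer_arcs:
  assumes "x \<in> S2" "x $ 2 = 0" "eta < \<bar>x $ 3\<bar>"
  shows "eta < \<bar>tmap x $ 3\<bar>" 
proof -
  have "eta < \<bar>x $ 3\<bar> \<longrightarrow> eta < \<bar>tmap x $ 3\<bar>" using assms(1,2)
  proof (rule S2_wlog_real)
    fix u :: real assume u: "\<bar>u\<bar> \<le> 1"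
    then obtain w where w: "tmap (stereo_inv (of_real u)) = stereo_inv (of_real w)" "\<bar>w\<bar> \<le> 1"
      "\<bar>u\<bar> < crit_val \<Longrightarrow> \<bar>w\<bar> < crit_val" using tmap_of_real by blast
    then show "eta < \<bar>stereo_inv (of_real u) $ 3\<bar> \<longrightarrow> eta < \<bar>tmap (stereo_inv (of_real u)) $ 3\<bar>"
      unfolding w(1) nth3_of_real[OF u] nth3_of_real[OF w(2)] by blast
  qed (simp add: tmap_flip)
  then show ?thesis using assms(3) by blast
qed

text \<open>On real points of [-1, 1] beyond \<open>crit_pt\<close> the values of
  \<open>rmap\<close> stay below \<open>crit_val\<close>, and symmetrically on the negative side. So
  a middle arc never maps into itself, which leaves the opposite one.\<close>

lemma tmap_inner_arcs:
  assumes "x \<in> S2" "x $ 2 = 0" "\<bar>x $ 3\<bar> < eta" "\<bar>tmap x $ 3\<bar> < eta"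
  shows "sgn (tmap x $ 1) = - sgn (x $ 1)"
proof -
  have "\<bar>x $ 3\<bar> < eta \<longrightarrow> \<bar>tmap x $ 3\<bar> < eta \<longrightarrow> sgn (tmap x $ 1) = - sgn (x $ 1)" using assms(1,2)
  proof (rule S2_wlog_real)
    fix u :: real assume u: "\<bar>u\<bar> \<le> 1"
    then obtain w where w: "tmap (stereo_inv (of_real u)) = stereo_inv (of_real w)" "\<bar>w\<bar> \<le> 1"
      "crit_val < u \<Longrightarrow> w < crit_val" "u < - crit_val \<Longrightarrow> - crit_val < w" using tmap_of_real by blast
    then show "\<bar>stereo_inv (of_real u) $ 3\<bar> < eta \<longrightarrow> \<bar>tmap (stereo_inv (of_real u)) $ 3\<bar> < eta \<longrightarrow>
      sgn (tmap (stereo_inv (of_real u)) $ 1) = - sgn (stereo_inv (of_real u) $ 1)"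
      unfolding w(1) nth3_of_real[OF u] nth3_of_real[OF w(2)] sgn_nth1_stereo_inv
      using crit_val_pos by (auto simp: abs_if sgn_if split: if_splits)
  qed (simp add: tmap_flip)
  then show ?thesis using assms(3,4) by blast
qed

section \<open>The four fixed points that will be the critical points\<close>

definition crit4 :: "(real^3) set" where
  "crit4 = {x \<in> S2. x $ 2 = 0 \<and> \<bar>x $ 3\<bar> = eta}"

lemma crit4_flip: "x \<in> crit4 \<Longrightarrow> flip x \<in> crit4"
  by (simp add: crit4_def)

lemma stereo_inv_crit4: "cmod z \<le> 1 \<Longrightarrow> stereo_inv z \<in> crit4 \<longleftrightarrow> z = of_real crit_val \<or> z = - of_real crit_val"
proof -
  assume z: "cmod z \<le> 1"
  show ?thesis
  proof (cases "Im z = 0")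
    case True
    then have e: "z = of_real (Re z)" by (simp add: complex_eq_iff)
    have "stereo_inv z $ 2 = 0" using True by simp
    moreover have "\<bar>stereo_inv z $ 3\<bar> = eta \<longleftrightarrow> crit_val = \<bar>Re z\<bar>"
      using nth3_of_real(2)[of "Re z"] abs_Re_le_cmod[of z] z e by simp
    ultimately show ?thesis
      using True crit_val_pos by (auto simp: crit4_def complex_eq_iff abs_if split: if_splits)
  next
    case False
    then have "stereo_inv z $ 2 \<noteq> 0" by simp
    then show ?thesis using False by (auto simp: crit4_def)
  qed
qed

lemma tmap_crit4: assumes "x \<in> crit4" shows "tmap x = x"
proof -
  have "x \<in> crit4 \<longrightarrow> tmap x = x"
  proof (rule S2_wlog_lower)
    show "x \<in> S2" using assms by (simp add: crit4_def)
    fix z :: complex assume z: "cmod z \<le> 1"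
    show "stereo_inv z \<in> crit4 \<longrightarrow> tmap (stereo_inv z) = stereo_inv z"
      using z by (auto simp: stereo_inv_crit4 tmap_lower twist_crit_val twist_minus rmap_minus rmap_crit_pt)
  next
    fix x :: "real^3" assume "x \<in> S2" "x \<in> crit4 \<longrightarrow> tmap x = x"
    then show "flip x \<in> crit4 \<longrightarrow> tmap (flip x) = flip x" using crit4_flip[of "flip x"] by (auto simp: tmap_flip)
  qed
  then show ?thesis using assms by blast
qed

lemma finite_crit4: "finite crit4" and card_crit4: "card crit4 = 4"
proof -
  define a where "a = stereo_inv (of_real crit_val)"
  define b where "b = stereo_inv (- of_real crit_val)"
  have v1: "crit_val < 1" using crit_val_less crit_pt_less by simp
  have in4: "a \<in> crit4" "b \<in> crit4" using v1 crit_val_pos by (simp_all add: a_def b_def stereo_inv_crit4)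
  have "x \<in> {a, b, flip a, flip b}" if x: "x \<in> crit4" for x
  proof -
    have "x \<in> S2" using x by (simp add: crit4_def)
    then show ?thesis
    proof (cases rule: hemisphere_cases)
      case (lower z)
      then show ?thesis using x stereo_inv_crit4[of z] by (auto simp: a_def b_def)
    next
      case (upper z)
      then have "stereo_inv z \<in> crit4" using crit4_flip[OF x] by simp
      then show ?thesis using upper stereo_inv_crit4[of z] by (auto simp: a_def b_def)
    qed
  qed
  then have eq: "crit4 = {a, b, flip a, flip b}" using in4 crit4_flip by blast
  have a3: "a $ 3 < 0" "b $ 3 < 0" "a $ 1 > 0" "b $ 1 < 0"
    using v1 crit_val_pos unfolding a_def b_def
    by (simp_all only: stereo_inv_nth3_neg) (simp_all add: divide_neg_pos add_pos_nonneg)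
  show "finite crit4" unfolding eq by simp
  have "a \<noteq> b" "a \<noteq> flip a" "a \<noteq> flip b" "b \<noteq> flip a" "b \<noteq> flip b" "flip a \<noteq> flip b"
    using a3 by (auto simp: vec3_eq_iff)
  then show "card crit4 = 4" unfolding eq by simp
qed

section \<open>Oriented charts and local models\<close>

lemma loc_orient_pres_cong:
  assumes "\<And>z. z \<in> W \<Longrightarrow> g z = g' z" "loc_orient_pres W g"
  shows "loc_orient_pres W g'"
  unfolding loc_orient_pres_def
proof
  fix z assume "z \<in> W"
  then obtain r where r: "r > 0" "cball z r \<subseteq> W"
    "\<And>\<rho>. 0 < \<rho> \<Longrightarrow> \<rho> \<le> r \<Longrightarrow> winding_number (g \<circ> circlepath z \<rho>) (g z) = 1"
    using assms(2) unfolding loc_orient_pres_def by blast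
  have "g \<circ> circlepath z \<rho> = g' \<circ> circlepath z \<rho>" if "0 < \<rho>" "\<rho> \<le> r" for \<rho>
  proof
    fix t
    have "circlepath z \<rho> t \<in> cball z r" using that by (simp add: circlepath_def part_circlepath_def dist_norm norm_mult)
    then show "(g \<circ> circlepath z \<rho>) t = (g' \<circ> circlepath z \<rho>) t" using r(2) assms(1) by auto
  qed
  then show "\<exists>r>0. cball z r \<subseteq> W \<and> (\<forall>\<rho>. 0 < \<rho> \<and> \<rho> \<le> r \<longrightarrow> winding_number (g' \<circ> circlepath z \<rho>) (g' z) = 1)"
    using r assms(1) \<open>z \<in> W\<close> by metis
qed

text \<open>The quotient is completed at \<open>y0\<close> by the derivative, which is nonzero for
  an injective holomorphic map. Away from \<open>y0\<close> it is nonzero by injectivity itself. The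
  chart thereby becomes \<open>y - y0\<close> times a factor that can be contracted to a
  constant.\<close>

lemma difference_quotient_nonzero:
  assumes "\<kappa> holomorphic_on S" "open S" "inj_on \<kappa> S" "y0 \<in> S"
  obtains G where "continuous_on S G" "\<And>y. y \<in> S \<Longrightarrow> G y \<noteq> 0" "\<And>y. y \<in> S \<Longrightarrow> \<kappa> y - \<kappa> y0 = (y - y0) * G y"
proof -
  define G where "G y = (if y = y0 then deriv \<kappa> y0 else (\<kappa> y - \<kappa> y0) / (y - y0))" for y
  have d: "deriv \<kappa> y0 \<noteq> 0" using holomorphic_injective_imp_regular assms by blast
  have der: "(\<kappa> has_field_derivative deriv \<kappa> y0) (at y0)" using assms holomorphic_derivI by blast
  have "isCont G y" if "y \<in> S" for y
  proof (cases "y = y0")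
    case True
    have "((\<lambda>y. (\<kappa> y - \<kappa> y0) / (y - y0)) \<longlongrightarrow> deriv \<kappa> y0) (at y0)"
      using der by (simp add: has_field_derivative_iff)
    then have "(G \<longlongrightarrow> deriv \<kappa> y0) (at y0)"
      by (rule Lim_transform_eventually) (auto simp: eventually_at_filter G_def)
    then show ?thesis using True by (simp add: isCont_def G_def)
  next
    case False
    have "isCont \<kappa> y" using assms(1,2) that by (meson continuous_on_eq_continuous_at holomorphic_on_imp_continuous_on)
    then have "isCont (\<lambda>y. (\<kappa> y - \<kappa> y0) / (y - y0)) y" using False by (intro continuous_intros) auto
    moreover have "\<forall>\<^sub>F x in nhds y. x \<noteq> y0" using False by (rule t1_space_nhds)
    then have "\<forall>\<^sub>F x in nhds y. (\<kappa> x - \<kappa> y0) / (x - y0) = G x" by eventually_elim (simp add: G_def)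
    ultimately show ?thesis using isCont_cong by fast
  qed
  then have "continuous_on S G" by (simp add: continuous_at_imp_continuous_on)
  moreover have "G y \<noteq> 0" if "y \<in> S" for y
    using d assms that by (auto simp: G_def inj_on_def)
  moreover have "\<kappa> y - \<kappa> y0 = (y - y0) * G y" for y by (auto simp: G_def)
  ultimately show ?thesis using that by blast
qed

text \<open>Along the isotopy the image of a small circle never meets the image of its centre, so the
  winding number is that of the circle itself.\<close>
lemma loc_orient_pres_isotopy:
  fixes T :: "real \<Rightarrow> complex \<Rightarrow> complex"
  assumes contT: "continuous_on ({0..1} \<times> UNIV) (\<lambda>(u,z). T u z)"
    and injT: "\<And>u. u \<in> {0..1} \<Longrightarrow> inj (T u)" and T1: "\<And>z. T 1 z = z"
    and "open W" "T 0 ` W \<subseteq> S" "\<kappa> holomorphic_on S" "open S" "inj_on \<kappa> S"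
  shows "loc_orient_pres W (\<kappa> \<circ> T 0)"
  unfolding loc_orient_pres_def
proof
  fix z assume z: "z \<in> W"
  define y0 where "y0 = T 0 z"
  have y0: "y0 \<in> S" using z assms(5) by (auto simp: y0_def)
  obtain G where G: "continuous_on S G" "\<And>y. y \<in> S \<Longrightarrow> G y \<noteq> 0" "\<And>y. y \<in> S \<Longrightarrow> \<kappa> y - \<kappa> y0 = (y - y0) * G y"
    using difference_quotient_nonzero[OF assms(6,7,8) y0] by blast
  obtain e where e: "e > 0" "ball y0 e \<subseteq> S" using assms(7) y0 openE by blast
  have T0c: "continuous_on UNIV (T 0)"
  proof -
    have "continuous_on UNIV (\<lambda>z::complex. (\<lambda>(u, z). T u z) (0, z))"
      by (rule continuous_on_compose2[OF contT]) (auto intro!: continuous_intros)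
    then show ?thesis by simp
  qed
  have "open (W \<inter> T 0 -` ball y0 e)"
    using open_Int[OF assms(4) open_vimage[OF open_ball T0c]] by simp
  moreover have "z \<in> W \<inter> T 0 -` ball y0 e" using z e by (simp add: y0_def)
  ultimately obtain r where r: "r > 0" "cball z r \<subseteq> W \<inter> T 0 -` ball y0 e"
    using open_contains_cball by metis
  have "winding_number ((\<kappa> \<circ> T 0) \<circ> circlepath z \<rho>) ((\<kappa> \<circ> T 0) z) = 1" if \<rho>: "0 < \<rho>" "\<rho> \<le> r" for \<rho>
  proof -
    define c where "c = circlepath z \<rho>"
    have cc: "continuous_on UNIV c"
      unfolding c_def circlepath_def part_circlepath_def linepath_def by (intro continuous_intros)
    have cb: "c t \<in> cball z r" "c t \<noteq> z" for t
      using \<rho> by (auto simp: c_def circlepath_def part_circlepath_def dist_norm norm_mult)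
    \<comment> \<open>At u = 0 this is \<open>\<kappa> (T 0 (c t)) - \<kappa> y0\<close>, at u = 1
      it is \<open>c t - z\<close>. While T runs to the identity, the argument of G contracts to
      \<open>y0\<close>, and the exponential gradually divides by \<open>G y0\<close> without
      reaching 0.\<close>
    define F where "F = (\<lambda>(u,t). (T u (c t) - T u z) * G (y0 + (1 - u) *\<^sub>R (T 0 (c t) - y0)) * exp (- (of_real u * Ln (G y0))))"
    have mem: "y0 + (1 - u) *\<^sub>R (T 0 (c t) - y0) \<in> ball y0 e" if "u \<in> {0..1}" for u t
    proof -
      have "T 0 (c t) \<in> ball y0 e" using cb(1)[of t] r(2) by blast
      then have "norm (T 0 (c t) - y0) < e" by (simp add: dist_norm norm_minus_commute)
      moreover have "\<bar>1 - u\<bar> * norm (T 0 (c t) - y0) \<le> norm (T 0 (c t) - y0)"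
        using that by (intro mult_left_le_one_le) auto
      ultimately show ?thesis by (simp add: dist_norm)
    qed
    have loops: "homotopic_loops (- {0}) (\<lambda>t. F (0,t)) (\<lambda>t. F (1,t))"
      unfolding homotopic_loops
    proof (intro exI[of _ F] conjI ballI)
      have [continuous_intros]: "continuous_on ({0..1} \<times> {0..1}) (\<lambda>p. T (fst p) (k (snd p)))" if "continuous_on {0..1} k" for k :: "real \<Rightarrow> complex"
      proof -
        have "continuous_on ({0..1} \<times> {0..1}) (\<lambda>p::real\<times>real. k (snd p))"
          by (rule continuous_on_compose2[OF that]) (auto intro!: continuous_intros)
        then have "continuous_on ({0..1} \<times> {0..1}) (\<lambda>p::real\<times>real. (\<lambda>(u,z). T u z) (fst p, k (snd p)))"
          by (intro continuous_on_compose2[OF contT] continuous_intros) auto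
        then show ?thesis by simp
      qed
      have c1: "continuous_on {0..1} c" using cc continuous_on_subset by blast
      have c2: "continuous_on ({0..1} \<times> {0..1}) (\<lambda>p::real\<times>real. T 0 (c (snd p)))"
        by (intro continuous_on_compose2[OF T0c] continuous_on_compose2[OF cc] continuous_intros) auto
      have "continuous_on ({0..1} \<times> {0..1}) (\<lambda>p::real\<times>real. G (y0 + (1 - fst p) *\<^sub>R (T 0 (c (snd p)) - y0)))"
        by (intro continuous_on_compose2[OF G(1)] continuous_intros c2) (use mem e(2) in force)
      then show "continuous_on ({0..1} \<times> {0..1}) F"
        unfolding F_def case_prod_beta by (intro continuous_intros c1)
      show "F \<in> {0..1} \<times> {0..1} \<rightarrow> - {0}"
      proof (clarsimp simp: Pi_iff)
        fix u t :: real assume u: "F (u, t) = 0" "0 \<le> u" "u \<le> 1"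
        have "T u (c t) \<noteq> T u z" using injT[of u] u cb(2)[of t] by (auto simp: inj_def)
        moreover have "G (y0 + (1 - u) *\<^sub>R (T 0 (c t) - y0)) \<noteq> 0" using mem[of u t] u e(2) G(2) by auto
        ultimately show False using u(1) by (simp add: F_def)
      qed
      fix t :: real assume "t \<in> {0..1}"
      show "pathfinish (F \<circ> Pair t) = pathstart (F \<circ> Pair t)"
        using pathfinish_circlepath[of z \<rho>] pathstart_circlepath[of z \<rho>]
        by (simp add: F_def pathfinish_def pathstart_def c_def)
    qed auto
    have F0: "F (0, t) = (\<kappa> \<circ> T 0 \<circ> c) t - \<kappa> y0" for t
      using G(3)[of "T 0 (c t)"] mem[of 0 t] e(2) by (auto simp: F_def y0_def)
    have F1: "F (1, t) = c t - z" for t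
      using G(2)[OF y0] by (simp add: F_def T1 exp_minus)
    have "winding_number (\<kappa> \<circ> T 0 \<circ> c) (\<kappa> y0) = winding_number (\<lambda>t. F (0, t)) 0"
      unfolding F0 by (rule winding_number_offset)
    also have "\<dots> = winding_number (\<lambda>t. F (1, t)) 0" using loops by (rule winding_number_homotopic_loops)
    also have "\<dots> = winding_number c z" unfolding F1 by (rule winding_number_offset[symmetric])
    also have "\<dots> = 1" unfolding c_def using \<rho>(1) by (rule winding_number_circlepath_centre)
    finally show ?thesis by (simp add: c_def y0_def)
  qed
  then show "\<exists>r>0. cball z r \<subseteq> W \<and> (\<forall>\<rho>. 0 < \<rho> \<and> \<rho> \<le> r \<longrightarrow> winding_number ((\<kappa> \<circ> T 0) \<circ> circlepath z \<rho>) ((\<kappa> \<circ> T 0) z) = 1)"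
    using r by (intro exI[of _ r]) auto
qed

lemma loc_orient_pres_twist:
  assumes "open W" "twist ` W \<subseteq> S" "\<kappa> holomorphic_on S" "open S" "inj_on \<kappa> S"
  shows "loc_orient_pres W (\<kappa> \<circ> twist)"
proof -
  define T where "T u z = (1 - u) *\<^sub>R twist z + u *\<^sub>R z" for u z
  have [simp]: "T 0 = twist" by (auto simp: T_def)
  have "loc_orient_pres W (\<kappa> \<circ> T 0)"
  proof (rule loc_orient_pres_isotopy[where T = T and S = S and W = W and \<kappa> = \<kappa>])
    show "continuous_on ({0..1} \<times> UNIV) (\<lambda>(u,z). T u z)"
      unfolding T_def case_prod_beta by (intro continuous_intros)
    show "inj (T u)" if "u \<in> {0..1}" for u
      using that twist_isotopy_inj[of u] unfolding T_def by (intro injI) (meson atLeastAtMost_iff)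
    show "T 0 ` W \<subseteq> S" using assms(2) by simp
    show "T 1 z = z" for z by (simp add: T_def)
  qed (rule assms)+
  then show ?thesis by simp
qed

lemma loc_orient_pres_holomorphic:
  assumes "open W" "\<kappa> holomorphic_on W" "inj_on \<kappa> W"
  shows "loc_orient_pres W \<kappa>"
proof -
  have "loc_orient_pres W (\<kappa> \<circ> (\<lambda>z. z))"
  proof (rule loc_orient_pres_isotopy[where T = "\<lambda>u z. z" and S = W and W = W and \<kappa> = \<kappa>])
    show "continuous_on ({0..1} \<times> UNIV) (\<lambda>(u::real, z::complex). z)"
      unfolding case_prod_beta by (intro continuous_intros)
    show "inj (\<lambda>z::complex. z)" by (rule injI)
    show "(\<lambda>z. z) ` W \<subseteq> W" by blast
  qed (rule refl assms)+
  then show ?thesis by (simp add: comp_def)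
qed

text \<open>Because \<tau> commutes with inversion, the test in the south chart is the test in the
  north chart for the inverted sets. The parameter \<tau> is \<open>twist\<close> for source charts
  and the identity for target charts.\<close>

lemma oriented_chart_aux:
  assumes "open A"
    and \<tau>: "\<And>W S \<kappa>. open W \<Longrightarrow> \<tau> ` W \<subseteq> S \<Longrightarrow> \<kappa> holomorphic_on S \<Longrightarrow> open S \<Longrightarrow> inj_on \<kappa> S \<Longrightarrow> loc_orient_pres W (\<kappa> \<circ> \<tau>)"
    and \<tau>inv: "\<And>z. \<tau> (1 / z) = 1 / \<tau> z" "\<And>z. \<tau> z = 0 \<longleftrightarrow> z = 0"
    and "\<tau> ` A \<subseteq> B" "\<kappa> holomorphic_on B" "open B" "inj_on \<kappa> B"
    and \<phi>: "\<And>z. z \<in> A \<Longrightarrow> \<phi> (stereo_inv z) = \<kappa> (\<tau> z)"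
  shows "oriented_chart (stereo_inv ` A) \<phi>"
  unfolding oriented_chart_def
proof
  have "stereo_inv ` A - {north_pole} = stereo_inv ` A" by auto
  then have "stereo ` (stereo_inv ` A - {north_pole}) = A" by (simp add: image_image)
  moreover have "loc_orient_pres A (\<phi> \<circ> stereo_inv)"
    by (rule loc_orient_pres_cong[OF _ \<tau>[of A B \<kappa>]]) (use assms in auto)
  ultimately show "loc_orient_pres (stereo ` (stereo_inv ` A - {north_pole})) (\<phi> \<circ> stereo_inv)" by simp
  define A' where "A' = (\<lambda>z. 1 / z) -` A \<inter> - {0}"
  define B' where "B' = (\<lambda>z. 1 / z) -` B \<inter> - {0}"
  have op: "open ((\<lambda>z::complex. 1 / z) -` C \<inter> - {0})" if "open C" for C
  proof -
    have "open (- {0} \<inter> (\<lambda>z::complex. 1 / z) -` C)"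
      by (rule continuous_open_preimage[OF _ _ that]) (auto intro!: continuous_intros)
    then show ?thesis by (simp add: Int_commute)
  qed
  have south: "stereo_inv z = south_pole \<longleftrightarrow> z = 0" for z
    using S2_eq_south_iff[of "stereo_inv z"] by (auto simp: divide_eq_eq)
  have "stereoS ` (stereo_inv ` A - {south_pole}) = A'"
  proof (intro set_eqI iffI)
    fix z assume "z \<in> stereoS ` (stereo_inv ` A - {south_pole})"
    then obtain a where a: "a \<in> A" "a \<noteq> 0" "z = stereo (flip (stereo_inv a))" using south by (auto simp: stereoS_eq)
    then have "z = 1 / a" by (simp add: flip_stereo_inv)
    then show "z \<in> A'" using a by (simp add: A'_def)
  next
    fix z assume z: "z \<in> A'"
    then have "z = stereoS (stereo_inv (1 / z))" by (simp add: stereoS_eq A'_def flip_stereo_inv)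
    moreover have "stereo_inv (1 / z) \<in> stereo_inv ` A - {south_pole}" using z by (auto simp: A'_def south)
    ultimately show "z \<in> stereoS ` (stereo_inv ` A - {south_pole})" by (rule image_eqI)
  qed
  moreover have "loc_orient_pres A' (\<phi> \<circ> stereoS_inv)"
  proof (rule loc_orient_pres_cong[OF _ \<tau>[of A' B' "\<lambda>y. \<kappa> (1 / y)"]])
    fix z assume z: "z \<in> A'"
    then show "((\<lambda>y. \<kappa> (1 / y)) \<circ> \<tau>) z = (\<phi> \<circ> stereoS_inv) z"
      using \<phi>[of "1 / z"] by (auto simp: A'_def stereoS_inv_eq flip_stereo_inv \<tau>inv)
  next
    show "\<tau> ` A' \<subseteq> B'"
    proof clarify
      fix z assume "z \<in> A'"
      then have "\<tau> (1 / z) \<in> B" "z \<noteq> 0" using assms(5) by (auto simp: A'_def)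
      then show "\<tau> z \<in> B'" by (simp add: B'_def \<tau>inv)
    qed
    have "(\<kappa> \<circ> (\<lambda>y. 1 / y)) holomorphic_on B'"
      by (rule holomorphic_on_compose_gen[OF _ assms(6)]) (auto simp: B'_def intro!: holomorphic_intros)
    then show "(\<lambda>y. \<kappa> (1 / y)) holomorphic_on B'" by (simp add: comp_def)
    show "inj_on (\<lambda>y. \<kappa> (1 / y)) B'"
    proof (rule inj_onI)
      fix x y assume "x \<in> B'" "y \<in> B'" "\<kappa> (1 / x) = \<kappa> (1 / y)"
      then have "1 / x = 1 / y" using inj_onD[OF assms(8), of "1 / x" "1 / y"] unfolding B'_def by blast
      then show "x = y" by simp
    qed
  qed (use op assms in \<open>auto simp: A'_def B'_def\<close>)
  ultimately show "loc_orient_pres (stereoS ` (stereo_inv ` A - {south_pole})) (\<phi> \<circ> stereoS_inv)" by simp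
qed

lemma oriented_chart_twist:
  assumes "open A" "twist ` A \<subseteq> B" "\<kappa> holomorphic_on B" "open B" "inj_on \<kappa> B"
    "\<And>z. z \<in> A \<Longrightarrow> \<phi> (stereo_inv z) = \<kappa> (twist z)"
  shows "oriented_chart (stereo_inv ` A) \<phi>"
  by (rule oriented_chart_aux[where \<tau> = twist and \<kappa> = \<kappa>, OF assms(1) loc_orient_pres_twist])
    (use assms in \<open>auto simp: twist_inverse\<close>)

lemma oriented_chart_holomorphic:
  assumes "open A" "\<kappa> holomorphic_on A" "inj_on \<kappa> A"
    "\<And>z. z \<in> A \<Longrightarrow> \<phi> (stereo_inv z) = \<kappa> z"
  shows "oriented_chart (stereo_inv ` A) \<phi>"
proof (rule oriented_chart_aux[where \<tau> = "\<lambda>z. z" and \<kappa> = \<kappa>, OF assms(1)])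
  fix W S :: "complex set" and \<kappa> :: "complex \<Rightarrow> complex"
  assume "open W" "(\<lambda>z. z) ` W \<subseteq> S" "\<kappa> holomorphic_on S" "inj_on \<kappa> S"
  then have "loc_orient_pres W \<kappa>"
    by (intro loc_orient_pres_holomorphic) (auto intro: holomorphic_on_subset inj_on_subset)
  then show "loc_orient_pres W (\<kappa> \<circ> (\<lambda>z. z))" by (simp add: comp_def)
qed (use assms in auto)

lemma homeomorphism_stereo: "homeomorphism (stereo_inv ` A) A stereo stereo_inv"
  by (rule homeomorphismI) (auto intro!: continuous_intros continuous_on_subset[OF continuous_on_stereo])

lemma openin_stereo_inv: assumes "open A" shows "openin (top_of_set S2) (stereo_inv ` A)"
proof -
  have "stereo_inv ` A = (S2 - {north_pole}) \<inter> stereo -` A"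
    using stereo_inv_stereo by (auto intro!: image_eqI)
  moreover have "openin (top_of_set (S2 - {north_pole})) ((S2 - {north_pole}) \<inter> stereo -` A)"
    using continuous_openin_preimage_gen[OF continuous_on_stereo assms] .
  moreover have "openin (top_of_set S2) (S2 - {north_pole})" by (simp add: openin_delete)
  ultimately show ?thesis by (metis openin_trans)
qed

lemma homeomorphism_flip: "homeomorphism (flip ` A) A flip flip"
  by (rule homeomorphismI) (auto intro!: continuous_intros simp: image_image)

lemma inj_flip: "inj flip"
  by (metis flip_flip injI)

lemma openin_flip: assumes "openin (top_of_set S2) U" shows "openin (top_of_set S2) (flip ` U)"
proof -
  have "flip ` U = S2 \<inter> flip -` U"
  proof (intro set_eqI iffI)
    fix x assume "x \<in> S2 \<inter> flip -` U"
    then show "x \<in> flip ` U" by (intro image_eqI[of _ _ "flip x"]) auto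
  qed (use openin_imp_subset[OF assms] in auto)
  moreover have "openin (top_of_set S2) (S2 \<inter> flip -` U)"
    by (rule continuous_openin_preimage[OF _ _ assms]) (auto intro!: continuous_intros)
  ultimately show ?thesis by simp
qed

lemma oriented_chart_flip:
  assumes "oriented_chart U \<phi>" shows "oriented_chart (flip ` U) (\<phi> \<circ> flip)"
proof -
  have *: "flip ` U - {north_pole} = flip ` (U - {south_pole})" "flip ` U - {south_pole} = flip ` (U - {north_pole})"
    by (simp_all add: image_set_diff[OF inj_flip])
  have "stereo ` (flip ` U - {north_pole}) = stereoS ` (U - {south_pole})"
    "stereoS ` (flip ` U - {south_pole}) = stereo ` (U - {north_pole})"
    unfolding * by (auto simp: stereoS_eq image_image)
  moreover have "(\<phi> \<circ> flip) \<circ> stereo_inv = \<phi> \<circ> stereoS_inv" "(\<phi> \<circ> flip) \<circ> stereoS_inv = \<phi> \<circ> stereo_inv"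
    by (auto simp: stereoS_inv_eq)
  ultimately show ?thesis using assms by (simp add: oriented_chart_def)
qed

lemma local_model_flip:
  assumes "local_model f p k" and f: "\<And>x. x \<in> S2 \<Longrightarrow> f (flip x) = flip (f x)"
  shows "local_model f (flip p) k"
proof -
  obtain U V \<phi> \<phi>' \<psi> \<psi>' where m: "openin (top_of_set S2) U" "openin (top_of_set S2) V"
        "p \<in> U" "f ` U \<subseteq> V" "homeomorphism U (ball 0 1) \<phi> \<phi>'" "homeomorphism V (ball 0 1) \<psi> \<psi>'"
        "oriented_chart U \<phi>" "oriented_chart V \<psi>"
        "\<phi> p = 0" "\<psi> (f p) = 0" "\<forall>z\<in>ball 0 1. \<psi> (f (\<phi>' z)) = z ^ k"
    using assms(1) unfolding local_model_def by blast
  have US: "U \<subseteq> S2" using m(1) by (rule openin_imp_subset)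
  have fU: "f (flip x) = flip (f x)" if "x \<in> U" for x using f US that by blast
  show ?thesis unfolding local_model_def
  proof (intro exI conjI)
    show "homeomorphism (flip ` U) (ball 0 1) (\<phi> \<circ> flip) (flip \<circ> \<phi>')"
      by (rule homeomorphism_compose[OF homeomorphism_flip m(5)])
    show "homeomorphism (flip ` V) (ball 0 1) (\<psi> \<circ> flip) (flip \<circ> \<psi>')"
      by (rule homeomorphism_compose[OF homeomorphism_flip m(6)])
    show "f ` flip ` U \<subseteq> flip ` V" using m(4) fU by (auto simp: image_iff)
    have "\<phi>' z \<in> U" if "z \<in> ball 0 1" for z using m(5) that by (auto simp: homeomorphism_def)
    then show "\<forall>z\<in>ball 0 1. (\<psi> \<circ> flip) (f ((flip \<circ> \<phi>') z)) = z ^ k" using m(11) fU by auto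
  qed (use m fU openin_flip oriented_chart_flip in auto)
qed

section \<open>Local degree and local injectivity\<close>

lemma local_model_1_imp_inj:
  assumes "local_model f p 1"
  obtains U where "openin (top_of_set S2) U" "p \<in> U" "inj_on f U"
proof -
  obtain U V \<phi> \<phi>' \<psi> \<psi>' where m: "openin (top_of_set S2) U" "p \<in> U"
        "homeomorphism U (ball 0 1) \<phi> \<phi>'" "\<forall>z\<in>ball 0 1. \<psi> (f (\<phi>' z)) = (z::complex) ^ 1"
    using assms unfolding local_model_def by blast
  have *: "\<psi> (f x) = \<phi> x" if "x \<in> U" for x :: "real^3"
    using that m(3,4) by (metis homeomorphism_def imageI power_one_right)
  have "inj_on f U"
  proof (rule inj_onI)
    fix x y assume xy: "x \<in> U" "y \<in> U" "f x = f y"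
    then have "\<phi> x = \<phi> y" using * by metis
    then show "x = y" using m(3) xy by (metis homeomorphism_def)
  qed
  then show ?thesis using that m by blast
qed

text \<open>A point near the centre and its rotation by a k-th root of unity have the same k-th
  power. Together with the case of exponent 1, local injectivity decides criticality whatever models
  a point may admit.\<close>

lemma local_model_ge_2_imp_not_inj:
  assumes "local_model f p k" "k \<ge> 2" "openin (top_of_set S2) N" "p \<in> N"
  shows "\<not> inj_on f N"
proof -
  obtain U V \<phi> \<phi>' \<psi> \<psi>' where m: "openin (top_of_set S2) U" "p \<in> U" "f ` U \<subseteq> V"
        "homeomorphism U (ball 0 1) \<phi> \<phi>'" "homeomorphism V (ball 0 1) \<psi> \<psi>'" "\<phi> p = 0"
        "\<forall>z\<in>ball 0 1. \<psi> (f (\<phi>' z)) = (z::complex) ^ k"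
    using assms(1) unfolding local_model_def by blast
  have "openin (top_of_set U) (U \<inter> N)"
    using assms(3) m(1) by (metis Int_absorb1 openin_imp_subset openin_subtopology_Int2 subtopology_subtopology)
  then have "openin (top_of_set (ball 0 1)) (\<phi> ` (U \<inter> N))"
    using m(4) homeomorphism_imp_open_map by blast
  then have "open (\<phi> ` (U \<inter> N))" by (meson open_ball openin_open_trans)
  moreover have "0 \<in> \<phi> ` (U \<inter> N)" using m(2,6) assms(4) by force
  ultimately obtain \<delta> where \<delta>: "\<delta> > 0" "cball 0 \<delta> \<subseteq> \<phi> ` (U \<inter> N)"
    using open_contains_cball by metis
  define \<omega> where "\<omega> = exp (2 * of_real pi * \<i> * of_nat 1 / of_nat k)"
  have \<omega>: "\<omega> ^ k = 1" "\<omega> \<noteq> 1" "cmod \<omega> = 1"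
  proof -
    show "\<omega> ^ k = 1" unfolding \<omega>_def using assms(2) by (subst exp_of_nat_mult[symmetric]) (simp add: exp_two_pi_i')
    show "\<omega> \<noteq> 1" using assms(2) complex_root_unity_eq[of k 1 0] by (auto simp: \<omega>_def)
    have "cmod \<omega> ^ k = 1" using \<open>\<omega> ^ k = 1\<close> by (metis norm_one norm_power)
    then show "cmod \<omega> = 1" using assms(2) power_eq_imp_eq_base[of "cmod \<omega>" k 1] by simp
  qed
  have "complex_of_real \<delta> \<in> cball 0 \<delta>" "complex_of_real \<delta> * \<omega> \<in> cball 0 \<delta>" using \<delta> \<omega>(3) by (auto simp: norm_mult)
  then have im: "of_real \<delta> \<in> \<phi> ` (U \<inter> N)" "of_real \<delta> * \<omega> \<in> \<phi> ` (U \<inter> N)" using \<delta>(2) by (meson subsetD)+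
  obtain x where x: "of_real \<delta> = \<phi> x" "x \<in> U \<inter> N" using im(1) by (rule imageE)
  obtain y where y: "of_real \<delta> * \<omega> = \<phi> y" "y \<in> U \<inter> N" using im(2) by (rule imageE)
  have xy: "x \<in> U \<inter> N" "y \<in> U \<inter> N" "\<phi> x = of_real \<delta>" "\<phi> y = of_real \<delta> * \<omega>" using x y by simp_all
  have *: "\<psi> (f x) = \<phi> x ^ k" if "x \<in> U" for x
    using that m(4,7) by (metis homeomorphism_def imageI)
  have "\<psi> (f x) = \<psi> (f y)" using * xy \<omega>(1) by (simp add: power_mult_distrib)
  moreover have "f x \<in> V" "f y \<in> V" using xy m(3) by auto
  ultimately have "f x = f y" using m(5) by (metis homeomorphism_def)
  moreover have "x \<noteq> y" using xy \<delta> \<omega>(2) by auto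
  ultimately show ?thesis using xy by (auto simp: inj_on_def)
qed

text \<open>If k is the order of the first nonvanishing derivative, then \<open>f - f y0\<close> is
  the k-th power of \<open>(y - y0) * g\<close> with g zero free. This base is injective near
  \<open>y0\<close>, and D is cut down until its image is a round disc.\<close>

lemma holomorphic_power_normal_form:
  assumes "f holomorphic_on S" "open S" "connected S" "y0 \<in> S" "\<not> f constant_on S"
  obtains k \<psi> D \<epsilon> where "k \<ge> 1" "open D" "y0 \<in> D" "D \<subseteq> S" "\<psi> holomorphic_on D" "inj_on \<psi> D" "\<psi> y0 = 0"
    "\<epsilon> > 0" "\<psi> ` D = ball 0 \<epsilon>" "\<And>y. y \<in> D \<Longrightarrow> f y - f y0 = \<psi> y ^ k"
proof -
  have "\<exists>n>0. (deriv ^^ n) f y0 \<noteq> 0"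
  proof (rule ccontr)
    assume "\<not> ?thesis"
    then have "f y = f y0" if "y \<in> S" for y
      using holomorphic_fun_eq_const_on_connected[OF assms(1-3) _ assms(4) that] by blast
    then show False using assms(5) unfolding constant_on_def by blast
  qed
  define k where "k = (LEAST n. n > 0 \<and> (deriv ^^ n) f y0 \<noteq> 0)"
  have k: "k > 0" "(deriv ^^ k) f y0 \<noteq> 0"
    using LeastI_ex[OF \<open>\<exists>n>0. _ n\<close>] unfolding k_def by auto
  have kl: "(deriv ^^ i) f y0 = 0" if "0 < i" "i < k" for i
    using not_less_Least[of i "\<lambda>n. n > 0 \<and> (deriv ^^ n) f y0 \<noteq> 0"] that unfolding k_def by blast
  obtain g r where g: "0 < r" "g holomorphic_on ball y0 r"
     "\<And>w. w \<in> ball y0 r \<Longrightarrow> f w - f y0 = ((w - y0) * g w) ^ k" "\<And>w. w \<in> ball y0 r \<Longrightarrow> g w \<noteq> 0"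
    by (rule holomorphic_factor_order_of_zero_strong[OF assms(1,2,4) k kl]) (assumption | rule that)+
  define \<psi> where "\<psi> w = (w - y0) * g w" for w
  have hol: "\<psi> holomorphic_on ball y0 r" unfolding \<psi>_def[abs_def] by (intro holomorphic_intros g)
  have "(g has_field_derivative deriv g y0) (at y0)" using g(1,2) by (intro holomorphic_derivI) auto
  then have "(\<psi> has_field_derivative g y0) (at y0)"
    unfolding \<psi>_def[abs_def] by (auto intro!: derivative_eq_intros)
  then have "deriv \<psi> y0 \<noteq> 0" using g(1,4) by (simp add: DERIV_imp_deriv)
  have "open (ball y0 r \<inter> S)" "y0 \<in> ball y0 r \<inter> S" using assms g(1) by auto
  then obtain r' where r': "r' > 0" "ball y0 r' \<subseteq> ball y0 r \<inter> S" "inj_on \<psi> (ball y0 r')"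
    using has_complex_derivative_locally_injective[of \<psi> "ball y0 r \<inter> S" y0] hol \<open>deriv \<psi> y0 \<noteq> 0\<close>
    by (metis Int_lower1 holomorphic_on_subset)
  have hol': "\<psi> holomorphic_on ball y0 r'" using hol r'(2) by (auto intro: holomorphic_on_subset)
  have "open (\<psi> ` ball y0 r')" using open_mapping_thm3[OF hol' open_ball r'(3)] .
  moreover have "0 \<in> \<psi> ` ball y0 r'" using r'(1) by (force simp: \<psi>_def)
  ultimately obtain \<epsilon> where \<epsilon>: "\<epsilon> > 0" "ball 0 \<epsilon> \<subseteq> \<psi> ` ball y0 r'" using openE by blast
  define D where "D = ball y0 r' \<inter> \<psi> -` ball 0 \<epsilon>"
  show ?thesis
  proof (rule that[of k D \<psi> \<epsilon>])
    show "open D" unfolding D_def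
      using continuous_open_preimage[OF holomorphic_on_imp_continuous_on[OF hol'] open_ball open_ball] .
    show "\<psi> ` D = ball 0 \<epsilon>" using \<epsilon>(2) by (auto simp: D_def)
    show "\<psi> holomorphic_on D" "inj_on \<psi> D" using hol' r'(3) by (auto simp: D_def intro: holomorphic_on_subset inj_on_subset)
    show "f y - f y0 = \<psi> y ^ k" if "y \<in> D" for y using g(3)[of y] that r'(2) by (auto simp: D_def \<psi>_def)
  qed (use k \<epsilon> r' in \<open>auto simp: D_def \<psi>_def\<close>)
qed

lemma homeomorphism_holomorphic:
  assumes "\<psi> holomorphic_on D" "open D" "inj_on \<psi> D"
  shows "homeomorphism D (\<psi> ` D) \<psi> (inv_into D \<psi>)"
proof -
  obtain g where g: "homeomorphism D (\<psi> ` D) \<psi> g"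
    using invariance_of_domain_homeomorphism[OF assms(2) holomorphic_on_imp_continuous_on[OF assms(1)] _ assms(3)] by auto
  then have "inv_into D \<psi> y = g y" if "y \<in> \<psi> ` D" for y
    using that assms(3) by (metis homeomorphism_def imageE inv_into_f_f)
  then show ?thesis using g by (auto intro: homeomorphism_cong)
qed

lemma homeomorphism_scale:
  assumes "\<epsilon> > 0"
  shows "homeomorphism (ball c \<epsilon>) (ball 0 1) (\<lambda>w. (w - c) / of_real \<epsilon>) (\<lambda>u::complex. c + of_real \<epsilon> * u)"
  by (rule homeomorphismI) (use assms in \<open>auto intro!: continuous_intros simp: dist_norm norm_divide norm_mult norm_minus_commute divide_less_eq\<close>)

lemma connected_disc_sqrt2: "connected {y::complex. (cmod y)^2 < 2}" and open_disc_sqrt2: "open {y::complex. (cmod y)^2 < 2}"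
proof -
  have "(cmod y)^2 < 2 \<longleftrightarrow> cmod y < sqrt 2" for y
    by (metis norm_ge_zero real_less_lsqrt real_less_rsqrt not_less real_sqrt_le_iff real_sqrt_unique)
  then have "{y::complex. (cmod y)^2 < 2} = ball 0 (sqrt 2)"
    unfolding set_eq_iff mem_Collect_eq mem_ball dist_0_norm by blast
  then show "connected {y::complex. (cmod y)^2 < 2}" "open {y::complex. (cmod y)^2 < 2}" by auto
qed

lemma twist_disc: "cmod z \<le> 1 \<Longrightarrow> twist z \<in> {y. (cmod y)^2 < 2}"
  using cmod_twist_le_1[of z] power_le_one[of "cmod (twist z)" 2] by simp

lemma homeomorphism_untwist: "homeomorphism (untwist ` D) D twist untwist"
  using homeomorphism_twist by (auto intro!: homeomorphismI continuous_intros simp: twist_untwist untwist_twist isCont_untwist continuous_at_imp_continuous_on)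

lemma open_untwist: assumes "open D" shows "open (untwist ` D)"
proof -
  have "untwist ` D = twist -` D" by (auto simp: twist_untwist) (metis image_eqI untwist_twist)
  then show ?thesis using assms isCont_twist by (simp add: continuous_open_vimage)
qed

text \<open>The stretch is absorbed into the source chart \<open>\<psi> \<circ> twist\<close>, and
  the target chart is affine in the stereographic coordinate, so the model reduces to the normal
  form of the holomorphic map \<open>rmap\<close>. Working in the disc of radius sqrt 2 makes
  equatorial points interior.\<close>

lemma local_model_lower:
  assumes z0: "cmod z0 \<le> 1"
  shows "\<exists>k\<ge>1. local_model tmap (stereo_inv z0) k"
proof -
  define y0 where "y0 = twist z0"
  define S where "S = {y. (cmod y)^2 < 2}"
  have "rmap 0 = 0" "rmap 1 = -1" by (simp_all add: rmap_def)
  moreover have "0 \<in> S" "1 \<in> S" by (simp_all add: S_def)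
  ultimately have nc: "\<not> rmap constant_on S" unfolding constant_on_def by (metis zero_neq_neg_one)
  have y0S: "y0 \<in> S" using z0 twist_disc by (simp add: y0_def S_def)
  have hS: "rmap holomorphic_on S" "open S" "connected S"
    unfolding S_def using holomorphic_rmap connected_disc_sqrt2 open_disc_sqrt2 by blast+
  obtain k \<psi> D \<epsilon> where n: "k \<ge> 1" "open D" "y0 \<in> D" "D \<subseteq> S" "\<psi> holomorphic_on D" "inj_on \<psi> D" "\<psi> y0 = 0"
    "\<epsilon> > 0" "\<psi> ` D = ball 0 \<epsilon>" "\<And>y. y \<in> D \<Longrightarrow> rmap y - rmap y0 = \<psi> y ^ k"
    by (rule holomorphic_power_normal_form[OF hS y0S nc]) (rule that)
  define A where "A = untwist ` D"
  define U where "U = stereo_inv ` A"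
  \<comment> \<open>Rescaling by \<epsilon> in the source and by \<open>\<epsilon> ^ k\<close> in
    the target turns the normal form into exactly \<open>z ^ k\<close>.\<close>
  define V where "V = stereo_inv ` ball (rmap y0) (\<epsilon> ^ k)"
  define \<psi>' where "\<psi>' = inv_into D \<psi>"
  have hp: "homeomorphism D (ball 0 \<epsilon>) \<psi> \<psi>'"
    using homeomorphism_holomorphic[OF n(5,2,6)] unfolding n(9) \<psi>'_def .
  have hU: "homeomorphism U (ball 0 1) ((\<lambda>w. (w - 0) / of_real \<epsilon>) \<circ> (\<psi> \<circ> (twist \<circ> stereo)))
      (((stereo_inv \<circ> untwist) \<circ> \<psi>') \<circ> (\<lambda>u::complex. 0 + of_real \<epsilon> * u))"
    unfolding U_def A_def
    by (intro homeomorphism_compose[OF _ homeomorphism_scale[OF n(8)]] homeomorphism_compose[OF _ hp]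
        homeomorphism_compose[OF _ homeomorphism_untwist] homeomorphism_stereo)
  have ek: "\<epsilon> ^ k > 0" using n(8) by simp
  have hV: "homeomorphism V (ball 0 1) ((\<lambda>w. (w - rmap y0) / of_real (\<epsilon> ^ k)) \<circ> stereo)
      (stereo_inv \<circ> (\<lambda>u::complex. rmap y0 + of_real (\<epsilon> ^ k) * u))"
    unfolding V_def by (intro homeomorphism_compose[OF _ homeomorphism_scale[OF ek]] homeomorphism_stereo)
  have tm: "tmap (stereo_inv (untwist y)) = stereo_inv (rmap y)" if "y \<in> D" for y
    using tmap_stereo_inv[of "untwist y"] n(4) that by (auto simp: twist_untwist S_def)
  have p: "tmap (stereo_inv z0) = stereo_inv (rmap y0)" using tm[OF n(3)] by (simp add: y0_def untwist_twist)
  show ?thesis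
  proof (intro exI conjI)
    show "k \<ge> 1" by (rule n(1))
    show "local_model tmap (stereo_inv z0) k"
      unfolding local_model_def
    proof (intro exI conjI)
      show "openin (top_of_set S2) U" "openin (top_of_set S2) V"
        unfolding U_def V_def A_def by (intro openin_stereo_inv open_untwist n(2) open_ball)+
      show "stereo_inv z0 \<in> U" unfolding U_def A_def using n(3) by (auto simp: y0_def image_iff) (metis untwist_twist)
      show "tmap ` U \<subseteq> V"
      proof clarify
        fix x assume "x \<in> U"
        then obtain y where y: "y \<in> D" "x = stereo_inv (untwist y)" by (auto simp: U_def A_def)
        have "cmod (\<psi> y) < \<epsilon>" using n(9) y(1) by (metis dist_0_norm image_eqI mem_ball)
        then have "cmod (\<psi> y ^ k) < \<epsilon> ^ k" using n(1) by (simp add: norm_power power_strict_mono)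
        then have "rmap y \<in> ball (rmap y0) (\<epsilon> ^ k)" using n(10)[OF y(1)] norm_minus_commute[of "rmap y0" "rmap y"] by (simp add: dist_norm)
        then show "tmap x \<in> V" unfolding y(2) tm[OF y(1)] V_def by (rule imageI)
      qed
      show "homeomorphism U (ball 0 1) ((\<lambda>w. (w - 0) / of_real \<epsilon>) \<circ> (\<psi> \<circ> (twist \<circ> stereo)))
        (((stereo_inv \<circ> untwist) \<circ> \<psi>') \<circ> (\<lambda>u::complex. 0 + of_real \<epsilon> * u))" by (rule hU)
      show "homeomorphism V (ball 0 1) ((\<lambda>w. (w - rmap y0) / of_real (\<epsilon> ^ k)) \<circ> stereo)
        (stereo_inv \<circ> (\<lambda>u::complex. rmap y0 + of_real (\<epsilon> ^ k) * u))" by (rule hV)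
      show "oriented_chart U ((\<lambda>w. (w - 0) / of_real \<epsilon>) \<circ> (\<psi> \<circ> (twist \<circ> stereo)))"
        unfolding U_def
      proof (rule oriented_chart_twist[where \<kappa> = "\<lambda>w. \<psi> w / of_real \<epsilon>" and B = D])
        show "open A" unfolding A_def using n(2) by (rule open_untwist)
        show "twist ` A \<subseteq> D" by (auto simp: A_def twist_untwist)
        show "(\<lambda>w. \<psi> w / of_real \<epsilon>) holomorphic_on D" using n(5,8) by (intro holomorphic_intros) auto
        show "inj_on (\<lambda>w. \<psi> w / of_real \<epsilon>) D" using n(6,8) by (simp add: inj_on_def)
      qed (use n(2) in auto)
      show "oriented_chart V ((\<lambda>w. (w - rmap y0) / of_real (\<epsilon> ^ k)) \<circ> stereo)"
        unfolding V_def
      proof (rule oriented_chart_holomorphic[where \<kappa> = "\<lambda>w. (w - rmap y0) / of_real (\<epsilon> ^ k)"])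
        show "(\<lambda>w. (w - rmap y0) / of_real (\<epsilon> ^ k)) holomorphic_on ball (rmap y0) (\<epsilon> ^ k)"
          using n(8) by (intro holomorphic_intros) auto
        show "inj_on (\<lambda>w. (w - rmap y0) / of_real (\<epsilon> ^ k)) (ball (rmap y0) (\<epsilon> ^ k))"
          using n(8) by (simp add: inj_on_def)
      qed auto
      show "((\<lambda>w. (w - 0) / of_real \<epsilon>) \<circ> (\<psi> \<circ> (twist \<circ> stereo))) (stereo_inv z0) = 0"
        using n(7) by (simp add: y0_def)
      show "((\<lambda>w. (w - rmap y0) / of_real (\<epsilon> ^ k)) \<circ> stereo) (tmap (stereo_inv z0)) = 0"
        by (simp add: p)
      show "\<forall>u\<in>ball 0 1. ((\<lambda>w. (w - rmap y0) / of_real (\<epsilon> ^ k)) \<circ> stereo)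
           (tmap ((((stereo_inv \<circ> untwist) \<circ> \<psi>') \<circ> (\<lambda>u::complex. 0 + of_real \<epsilon> * u)) u)) = u ^ k"
      proof
        fix u :: complex assume "u \<in> ball 0 1"
        then have u: "of_real \<epsilon> * u \<in> ball 0 \<epsilon>" using n(8) by (simp add: norm_mult)
        define y where "y = \<psi>' (of_real \<epsilon> * u)"
        have y: "y \<in> D" "\<psi> y = of_real \<epsilon> * u" using hp u unfolding y_def homeomorphism_def by auto
        show "((\<lambda>w. (w - rmap y0) / of_real (\<epsilon> ^ k)) \<circ> stereo)
           (tmap ((((stereo_inv \<circ> untwist) \<circ> \<psi>') \<circ> (\<lambda>u::complex. 0 + of_real \<epsilon> * u)) u)) = u ^ k"
          using tm[OF y(1)] n(10)[OF y(1)] n(8) by (simp add: y_def[symmetric] y(2) power_mult_distrib)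
      qed
    qed
  qed
qed

lemma local_model_tmap_flip: "local_model tmap p k \<Longrightarrow> local_model tmap (flip p) k"
  by (rule local_model_flip) (simp_all add: tmap_flip)

lemma local_model_tmap: assumes "p \<in> S2" shows "\<exists>k\<ge>1. local_model tmap p k"
  using assms
proof (rule S2_wlog_lower)
  fix x :: "real^3" assume "\<exists>k\<ge>1. local_model tmap x k"
  then show "\<exists>k\<ge>1. local_model tmap (flip x) k" using local_model_tmap_flip by blast
qed (rule local_model_lower)

lemma branched_cover_tmap: "branched_cover tmap"
  unfolding branched_cover_def using continuous_on_tmap local_model_tmap by auto

text \<open>Injectivity links charts and derivative in both directions. A nonzero derivative gives
  an injective neighbourhood, which excludes exponents of at least 2; a model of exponent 1 would
  make \<open>rmap\<close> injective near a zero of its derivative.\<close>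

lemma crit_lower:
  assumes z0: "cmod z0 \<le> 1"
  shows "stereo_inv z0 \<in> crit tmap \<longleftrightarrow> stereo_inv z0 \<in> crit4"
proof
  assume "stereo_inv z0 \<in> crit tmap"
  then obtain k where k: "k \<ge> 2" "local_model tmap (stereo_inv z0) k" by (auto simp: crit_def)
  show "stereo_inv z0 \<in> crit4"
  proof (rule ccontr)
    assume "stereo_inv z0 \<notin> crit4"
    then have "z0 \<noteq> of_real crit_val" "z0 \<noteq> - of_real crit_val" using stereo_inv_crit4[OF z0] by auto
    then have "twist z0 \<noteq> of_real crit_pt" "twist z0 \<noteq> - of_real crit_pt"
      using inj_twist[of z0 "of_real crit_val"] inj_twist[of z0 "- of_real crit_val"] by (auto simp: twist_crit_val twist_minus)
    then have "deriv rmap (twist z0) \<noteq> 0" using deriv_rmap_eq_0_iff z0 cmod_twist_le_1 by blast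
    then obtain r where r: "r > 0" "ball (twist z0) r \<subseteq> {y. (cmod y)^2 < 2}" "inj_on rmap (ball (twist z0) r)"
      using has_complex_derivative_locally_injective[OF holomorphic_rmap twist_disc[OF z0] open_disc_sqrt2] by blast
    define N where "N = stereo_inv ` untwist ` ball (twist z0) r"
    have "openin (top_of_set S2) N" unfolding N_def by (intro openin_stereo_inv open_untwist open_ball)
    moreover have "stereo_inv z0 \<in> N" unfolding N_def using r(1) by (intro imageI image_eqI[of z0 untwist "twist z0"]) (auto simp: untwist_twist)
    moreover have "inj_on tmap N"
    proof (rule inj_onI)
      fix x x' assume "x \<in> N" "x' \<in> N" and e: "tmap x = tmap x'"
      then obtain y y' where y: "y \<in> ball (twist z0) r" "x = stereo_inv (untwist y)" "y' \<in> ball (twist z0) r" "x' = stereo_inv (untwist y')"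
        by (auto simp: N_def)
      have "(cmod y)^2 < 2" "(cmod y')^2 < 2" using y r(2) by blast+
      then have "tmap x = stereo_inv (rmap y)" "tmap x' = stereo_inv (rmap y')"
        using y tmap_stereo_inv[of "untwist y"] tmap_stereo_inv[of "untwist y'"] by (simp_all add: twist_untwist)
      then have "rmap y = rmap y'" using e by (simp add: stereo_inv_inj)
      then show "x = x'" using y r(3) inj_onD by metis
    qed
    ultimately show False using local_model_ge_2_imp_not_inj[OF k(2,1)] by blast
  qed
next
  assume "stereo_inv z0 \<in> crit4"
  then have "z0 = of_real crit_val \<or> z0 = - of_real crit_val" using stereo_inv_crit4[OF z0] by auto
  then have d: "deriv rmap (twist z0) = 0"
    using deriv_rmap_eq_0_iff[of "twist z0"] z0 by (auto simp: cmod_twist_le_1 twist_crit_val twist_minus)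
  obtain k where k: "k \<ge> 1" "local_model tmap (stereo_inv z0) k" using local_model_lower[OF z0] by blast
  have "k \<noteq> 1"
  proof
    assume "k = 1"
    then obtain U where U: "openin (top_of_set S2) U" "stereo_inv z0 \<in> U" "inj_on tmap U"
      using k(2) local_model_1_imp_inj by blast
    define N where "N = {y. (cmod y)^2 < 2} \<inter> (\<lambda>y. stereo_inv (untwist y)) -` U"
    have cont: "continuous_on UNIV (\<lambda>y. stereo_inv (untwist y))"
      by (intro continuous_intros continuous_at_imp_continuous_on ballI isCont_untwist)
    obtain O' where O': "open O'" "U = S2 \<inter> O'" using U(1) by (auto simp: openin_open)
    have "N = {y. (cmod y)^2 < 2} \<inter> (\<lambda>y. stereo_inv (untwist y)) -` O'" by (auto simp: N_def O')
    then have "open N" using open_disc_sqrt2 open_vimage[OF O'(1) cont] by (simp add: open_Int)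
    moreover have "twist z0 \<in> N" using U(2) twist_disc[OF z0] by (simp add: N_def untwist_twist)
    moreover have "inj_on rmap N"
    proof (rule inj_onI)
      fix y y' assume y: "y \<in> N" "y' \<in> N" "rmap y = rmap y'"
      then have "tmap (stereo_inv (untwist y)) = tmap (stereo_inv (untwist y'))"
        using tmap_stereo_inv[of "untwist y"] tmap_stereo_inv[of "untwist y'"] by (auto simp: twist_untwist N_def)
      then have "stereo_inv (untwist y) = stereo_inv (untwist y')" using U(3) y by (auto simp: N_def inj_on_def)
      then show "y = y'" by (metis stereo_inv_inj twist_untwist)
    qed
    moreover have "rmap holomorphic_on N" using holomorphic_rmap by (rule holomorphic_on_subset) (auto simp: N_def)
    ultimately show False using holomorphic_injective_imp_regular d by blast
  qed
  then show "stereo_inv z0 \<in> crit tmap" using k by (auto simp: crit_def intro!: exI[of _ k])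
qed

lemma crit_tmap: "crit tmap = crit4"
proof -
  have "p \<in> crit tmap \<longleftrightarrow> p \<in> crit4" if "p \<in> S2" for p
    using that
  proof (rule S2_wlog_lower)
    fix x :: "real^3" assume x: "x \<in> S2" "x \<in> crit tmap \<longleftrightarrow> x \<in> crit4"
    have "local_model tmap (flip x) k \<longleftrightarrow> local_model tmap x k" for k
      using local_model_tmap_flip[of x k] local_model_tmap_flip[of "flip x" k] by auto
    then have "flip x \<in> crit tmap \<longleftrightarrow> x \<in> crit tmap" by (simp add: crit_def)
    moreover have "flip x \<in> crit4 \<longleftrightarrow> x \<in> crit4" using crit4_flip[of x] crit4_flip[of "flip x"] by auto
    ultimately show "flip x \<in> crit tmap \<longleftrightarrow> flip x \<in> crit4" using x by simp
  qed (rule crit_lower)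
  then show ?thesis by (auto simp: crit_def crit4_def)
qed

lemma funpow_tmap_crit4: "x \<in> crit4 \<Longrightarrow> (tmap ^^ n) x = x"
  by (induction n) (auto simp: tmap_crit4)

lemma post_tmap: "post tmap = crit4"
proof -
  have "x \<in> post tmap" if "x \<in> crit4" for x
    unfolding post_def crit_tmap using that tmap_crit4[of x] by (intro CollectI exI[of _ 1] exI[of _ x]) auto
  then show ?thesis unfolding post_def crit_tmap using funpow_tmap_crit4 by auto
qed

section \<open>The base point and its explicit preimages\<close>

definition base :: "real^3" where
  "base = stereo_inv \<i>"

lemma base_nth [simp]: "base $ 1 = 0" "base $ 2 = 1" "base $ 3 = 0"
  by (simp_all add: base_def)

lemma base_S2 [simp]: "base \<in> S2" by (simp add: base_def)

text \<open>The nonreal solutions of the cubic equation over the imaginary unit, other than the imaginary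
  unit itself; they lie on the unit circle, which the twist fixes pointwise.\<close>
definition sheet_root :: "bool \<Rightarrow> complex" where
  "sheet_root b = Complex ((if b then 1 else - 1) * sqrt 15 / 4) (- 1 / 4)"

lemma cmod_sheet_root: "cmod (sheet_root b) = 1"
  by (simp add: sheet_root_def cmod_def power_divide)

lemma twist_unit: "cmod z = 1 \<Longrightarrow> twist z = z"
  by (simp add: twist_def)

lemma rmap_sheet_root: "rmap (sheet_root b) = \<i>"
proof -
  have "sqrt 15 * sqrt 15 = (15::real)" by simp
  then have "sheet_root b ^ 2 + \<i> / 2 * sheet_root b - 1 = 0"
    by (simp add: sheet_root_def complex_eq_iff power2_eq_square)
  moreover have "y * (1 - 2 * y^2) - \<i> * (2 - y^2) = - 2 * (y - \<i>) * (y^2 + \<i> / 2 * y - 1)" for y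
    by (simp add: algebra_simps power2_eq_square)
  ultimately have "poly (cubic \<i>) (sheet_root b) = 0"
    unfolding poly_cubic by simp
  then show ?thesis using rmap_eq_iff[OF denom_nz] cmod_sheet_root[of b] by simp
qed

lemma tmap_sheet_root: "tmap (stereo_inv (sheet_root b)) = base"
  by (simp add: tmap_lower cmod_sheet_root twist_unit rmap_sheet_root base_def)

lemma rmap_i: "rmap \<i> = \<i>"
  by (simp add: rmap_def complex_eq_iff)

lemma tmap_base: "tmap base = base"
  by (simp add: base_def tmap_lower twist_unit rmap_i)

lemma base_notin_crit4: "base \<notin> crit4"
  by (simp add: crit4_def)

lemma thurston_map_tmap: "thurston_map tmap"
proof -
  define C where "C = {card (S2 \<inter> tmap -` {q}) | q. q \<in> S2}"
  \<comment> \<open>\<open>top_degree\<close> is a supremum of natural numbers, so the fibre sizes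
    must be bounded before a single fibre yields a lower bound.\<close>
  have "C \<subseteq> {..3}" using tmap_fiber(2) by (auto simp: C_def)
  then have "bdd_above C" by (meson bdd_above.I atMost_iff subsetD)
  moreover have "card (S2 \<inter> tmap -` {base}) \<in> C" by (auto simp: C_def)
  moreover have "2 \<le> card (S2 \<inter> tmap -` {base})"
  proof -
    have "{base, stereo_inv (sheet_root True)} \<subseteq> S2 \<inter> tmap -` {base}" by (simp add: tmap_base tmap_sheet_root)
    then have "card {base, stereo_inv (sheet_root True)} \<le> card (S2 \<inter> tmap -` {base})"
      by (rule card_mono[OF tmap_fiber(1)[OF base_S2]])
    moreover have "base \<noteq> stereo_inv (sheet_root True)" by (simp add: base_def stereo_inv_inj sheet_root_def complex_eq_iff)
    ultimately show ?thesis by simp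
  qed
  ultimately have "2 \<le> top_degree tmap" unfolding top_degree_def C_def by (meson cSup_upper le_trans)
  then show ?thesis unfolding thurston_map_def using branched_cover_tmap post_tmap finite_crit4 by simp
qed

section \<open>The obstruction\<close>

text \<open>Topological form of being noncritical. It mentions no orientation, so it passes through
  arbitrary homeomorphisms, including orientation reversing ones.\<close>

definition loc_inj :: "(real^3 \<Rightarrow> real^3) \<Rightarrow> real^3 \<Rightarrow> bool" where
  "loc_inj g x \<longleftrightarrow> (\<exists>N. openin (top_of_set S2) N \<and> x \<in> N \<and> inj_on g N)"

lemma loc_inj_tmap: assumes "x \<in> S2" shows "loc_inj tmap x \<longleftrightarrow> x \<notin> crit4"
proof
  assume "loc_inj tmap x"
  then show "x \<notin> crit4"
    unfolding crit_tmap[symmetric] crit_def loc_inj_def using local_model_ge_2_imp_not_inj by blast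
next
  assume "x \<notin> crit4"
  then have "\<not> (\<exists>k\<ge>2. local_model tmap x k)" using assms unfolding crit_tmap[symmetric] crit_def by blast
  then obtain k where "k \<ge> 1" "local_model tmap x k" "\<not> k \<ge> 2" using local_model_tmap[OF assms] by blast
  then have "local_model tmap x 1" by (metis One_nat_def Suc_leI le_antisym not_less numeral_2_eq_2 not_less_eq_eq)
  then show "loc_inj tmap x" unfolding loc_inj_def using local_model_1_imp_inj by metis
qed

lemma loc_inj_semiconj:
  assumes H: "homeomorphism S2 S2 H H'" and K: "homeomorphism S2 S2 K K'"
    and f: "f ` S2 \<subseteq> S2" and conj: "\<And>x. x \<in> S2 \<Longrightarrow> H (f x) = g (K x)" and x: "x \<in> S2" "loc_inj f x"
  shows "loc_inj g (K x)"
proof -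
  obtain N where N: "openin (top_of_set S2) N" "x \<in> N" "inj_on f N" using x(2) unfolding loc_inj_def by blast
  have NS: "N \<subseteq> S2" using N(1) by (rule openin_imp_subset)
  have "openin (top_of_set S2) (K ` N)" using K N(1) homeomorphism_imp_open_map by blast
  moreover have "inj_on g (K ` N)"
  proof (rule inj_onI)
    fix a b assume "a \<in> K ` N" "b \<in> K ` N" and ab: "g a = g b"
    then obtain u v where u: "u \<in> N" "a = K u" "v \<in> N" "b = K v" by blast
    then have "H (f u) = H (f v)" using ab conj NS by (metis subsetD)
    moreover have "f u \<in> S2" "f v \<in> S2" using u NS f by auto
    ultimately have "f u = f v" using H by (metis homeomorphism_def)
    then show "a = b" using u N(3) inj_onD by metis
  qed
  ultimately show ?thesis unfolding loc_inj_def using N(2) by blast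
qed

section \<open>Rational maps in lowest terms\<close>

lemma agree_off_finite:
  fixes u v :: "complex \<Rightarrow> 'b::t2_space"
  assumes "open A" "continuous_on A u" "continuous_on A v" "finite F" "\<And>z. z \<in> A - F \<Longrightarrow> u z = v z" "z0 \<in> A"
  shows "u z0 = v z0"
proof -
  have "\<forall>\<^sub>F z in at z0. z \<in> A" using assms(1,6) by (rule eventually_at_in_open')
  moreover have "\<forall>\<^sub>F z in at z0. z \<notin> F"
    using islimpt_finite[OF assms(4), of z0] by (simp add: islimpt_iff_eventually)
  ultimately have ev: "\<forall>\<^sub>F z in at z0. u z = v z" by eventually_elim (use assms(5) in blast)
  have "(u \<longlongrightarrow> u z0) (at z0)" "(v \<longlongrightarrow> v z0) (at z0)"
    using assms(1-3,6) by (metis continuous_on_eq_continuous_at isCont_def)+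
  moreover have "(v \<longlongrightarrow> u z0) (at z0)"
    using \<open>(u \<longlongrightarrow> u z0) (at z0)\<close> ev by (rule Lim_transform_eventually)
  ultimately show ?thesis using tendsto_unique[of "at z0"] by (metis trivial_limit_at)
qed

lemma card_simple_roots:
  fixes P :: "complex poly"
  assumes "P \<noteq> 0" "\<And>z. poly P z = 0 \<Longrightarrow> poly (pderiv P) z \<noteq> 0"
  shows "card {z. poly P z = 0} = degree P"
  using assms
proof (induction "degree P" arbitrary: P)
  case 0
  then obtain c where "P = [:c:]" by (metis degree_eq_zeroE)
  then have "{z. poly P z = 0} = {}" using 0 by auto
  then show ?case using 0 by simp
next
  case (Suc n)
  have "coeff P (degree P) \<noteq> 0" using Suc.prems by simp
  then have "\<exists>i\<in>{1..degree P}. coeff P i \<noteq> 0" using Suc.hyps(2) by (intro bexI[of _ "degree P"]) auto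
  then obtain a where a: "poly P a = 0"
    using fundamental_theorem_of_algebra[of "coeff P" "degree P"] unfolding poly_altdef by blast
  then obtain Q where Q: "P = [:- a, 1:] * Q" by (auto simp: poly_eq_0_iff_dvd elim: dvdE)
  have Q0: "Q \<noteq> 0" using Q Suc.prems(1) by auto
  have deg: "degree P = Suc (degree Q)" unfolding Q using Q0 by (subst degree_mult_eq) auto
  have pd: "poly (pderiv P) z = poly Q z + (z - a) * poly (pderiv Q) z" for z
  proof -
    have "pderiv P = [:- a, 1:] * pderiv Q + Q * pderiv [:- a, 1:]" unfolding Q by (rule pderiv_mult)
    moreover have "pderiv [:- a, 1:] = 1" by (simp add: pderiv_pCons)
    ultimately have "pderiv P = [:- a, 1:] * pderiv Q + Q" by simp
    then show ?thesis by (simp only: poly_add poly_mult) (simp add: algebra_simps)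
  qed
  have "poly (pderiv Q) z \<noteq> 0" if "poly Q z = 0" for z
    using Suc.prems(2)[of z] that pd[of z] by (auto simp: Q)
  then have card: "card {z. poly Q z = 0} = degree Q" using Suc.hyps Q0 deg by auto
  have "poly Q a \<noteq> 0" using Suc.prems(2)[OF a] pd[of a] by simp
  moreover have "{z. poly P z = 0} = insert a {z. poly Q z = 0}" by (auto simp: Q)
  ultimately show ?case using card deg poly_roots_finite[OF Q0] by simp
qed

text \<open>A representation whose denominator has least degree is in lowest terms: a common linear
  factor could be cancelled, because continuity of g extends the identity to the point lost by the
  cancellation.\<close>

lemma rational_map_reduced:
  assumes "rational_map g"
  obtains p q :: "complex poly" where "q \<noteq> 0" "\<And>z. poly q z = 0 \<Longrightarrow> poly p z \<noteq> 0"
    "\<And>z. poly q z \<noteq> 0 \<Longrightarrow> g (stereo_inv z) = stereo_inv (poly p z / poly q z)"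
proof -
  have cg: "continuous_on S2 g" using assms unfolding rational_map_def by blast
  define rep where "rep = (\<lambda>(p, q). q \<noteq> 0 \<and> (\<forall>z. poly q z \<noteq> 0 \<longrightarrow> g (stereo_inv z) = stereo_inv (poly p z / poly q z)))"
  have ex: "\<exists>x. rep x" using assms unfolding rational_map_def rep_def by auto
  obtain x where x: "rep x" "\<And>y. rep y \<Longrightarrow> degree (snd x) \<le> degree (snd y)"
    using ex ex_has_least_nat[of rep _ "\<lambda>x. degree (snd x)"] by metis
  obtain p q where pq: "x = (p, q)" by (cases x)
  have "poly p z0 \<noteq> 0" if qz0: "poly q z0 = 0" for z0
  proof
    assume "poly p z0 = 0"
    then obtain p' q' where p': "p = [:- z0, 1:] * p'" and q': "q = [:- z0, 1:] * q'"
      using qz0 unfolding poly_eq_0_iff_dvd dvd_def by blast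
    have q0: "q' \<noteq> 0" using x(1) q' by (auto simp: pq rep_def)
    have "g (stereo_inv z) = stereo_inv (poly p' z / poly q' z)" if z: "poly q' z \<noteq> 0" for z
    proof (rule agree_off_finite[where A = "- {z. poly q' z = 0}" and F = "{z0}" and u = "\<lambda>z. g (stereo_inv z)" and
          v = "\<lambda>z. stereo_inv (poly p' z / poly q' z)"])
      show "open (- {z. poly q' z = 0})" using poly_roots_finite[OF q0] by (simp add: finite_imp_closed open_Compl)
      show "continuous_on (- {z. poly q' z = 0}) (\<lambda>z. g (stereo_inv z))"
        by (rule continuous_on_compose2[OF cg]) (auto intro!: continuous_intros)
      show "continuous_on (- {z. poly q' z = 0}) (\<lambda>z. stereo_inv (poly p' z / poly q' z))"
        by (auto intro!: continuous_intros)
      show "g (stereo_inv z) = stereo_inv (poly p' z / poly q' z)" if "z \<in> - {z. poly q' z = 0} - {z0}" for z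
      proof -
        have "poly q z = (z - z0) * poly q' z" "poly p z = (z - z0) * poly p' z"
          unfolding p' q' by (simp_all add: algebra_simps)
        then show ?thesis using x(1) that unfolding rep_def pq by simp
      qed
    qed (use z in auto)
    then have "rep (p', q')" using q0 by (simp add: rep_def)
    then have "degree q \<le> degree q'" using x(2) by (force simp: pq)
    moreover have "degree q = Suc (degree q')" unfolding q' using q0 by (subst degree_mult_eq) auto
    ultimately show False by simp
  qed
  then show ?thesis using x(1) that unfolding pq rep_def by auto
qed

locale reduced_rational =
  fixes g :: "real^3 \<Rightarrow> real^3" and p q :: "complex poly"
  assumes cg: "continuous_on S2 g" and q0: "q \<noteq> 0"
    and no_common: "\<And>z. poly q z = 0 \<Longrightarrow> poly p z \<noteq> 0"
    and geq: "\<And>z. poly q z \<noteq> 0 \<Longrightarrow> g (stereo_inv z) = stereo_inv (poly p z / poly q z)"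
begin

text \<open>Numerator of the derivative of \<open>p / q\<close>; off the poles its zeros are the
  points where g fails to be locally injective.\<close>

definition wronskian :: "complex poly" where
  "wronskian = pderiv p * q - p * pderiv q"

lemma open_q: "open (- {z. poly q z = 0})"
  using poly_roots_finite[OF q0] by (simp add: finite_imp_closed open_Compl)

lemma deriv_quotient:
  assumes "poly q z \<noteq> 0"
  shows "deriv (\<lambda>z. poly p z / poly q z) z = poly wronskian z / (poly q z)^2"
proof (rule DERIV_imp_deriv)
  show "((\<lambda>z. poly p z / poly q z) has_field_derivative poly wronskian z / (poly q z)^2) (at z)"
    using assms by (auto intro!: derivative_eq_intros poly_DERIV simp: wronskian_def power2_eq_square)
qed

lemma loc_inj_iff:
  assumes z: "poly q z \<noteq> 0"
  shows "loc_inj g (stereo_inv z) \<longleftrightarrow> poly wronskian z \<noteq> 0"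
proof -
  define A where "A = - {z. poly q z = 0}"
  define R where "R = (\<lambda>z. poly p z / poly q z)"
  have oA: "open A" and zA: "z \<in> A" using open_q z by (auto simp: A_def)
  have hol: "R holomorphic_on A" unfolding R_def A_def by (auto intro!: holomorphic_intros)
  have gR: "g (stereo_inv y) = stereo_inv (R y)" if "y \<in> A" for y using geq that by (simp add: A_def R_def)
  have d: "deriv R z = 0 \<longleftrightarrow> poly wronskian z = 0" unfolding R_def deriv_quotient[OF z] using z by simp
  show ?thesis
  proof
    assume "loc_inj g (stereo_inv z)"
    then obtain N where N: "openin (top_of_set S2) N" "stereo_inv z \<in> N" "inj_on g N" unfolding loc_inj_def by blast
    obtain O' where O': "open O'" "N = S2 \<inter> O'" using N(1) by (auto simp: openin_open)
    define B where "B = A \<inter> stereo_inv -` O'"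
    have "continuous_on UNIV stereo_inv" by (intro continuous_intros)
    then have "open B" unfolding B_def by (rule open_Int[OF oA open_vimage[OF O'(1)]])
    moreover have "z \<in> B" using zA N(2) by (simp add: B_def O'(2))
    moreover have "inj_on R B"
    proof (rule inj_onI)
      fix a b assume ab: "a \<in> B" "b \<in> B" "R a = R b"
      then have "g (stereo_inv a) = g (stereo_inv b)" by (simp add: gR B_def)
      then have "stereo_inv a = stereo_inv b" using N(3) ab by (auto simp: O'(2) B_def dest: inj_onD)
      then show "a = b" by (simp add: stereo_inv_inj)
    qed
    moreover have "R holomorphic_on B" using hol by (rule holomorphic_on_subset) (auto simp: B_def)
    ultimately show "poly wronskian z \<noteq> 0" using holomorphic_injective_imp_regular d by blast
  next
    assume "poly wronskian z \<noteq> 0"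
    then obtain r where r: "r > 0" "ball z r \<subseteq> A" "inj_on R (ball z r)"
      using has_complex_derivative_locally_injective[OF hol zA oA] d by blast
    have "inj_on g (stereo_inv ` ball z r)"
    proof (rule inj_onI)
      fix a b assume "a \<in> stereo_inv ` ball z r" "b \<in> stereo_inv ` ball z r" and e: "g a = g b"
      then obtain u v where u: "u \<in> ball z r" "a = stereo_inv u" "v \<in> ball z r" "b = stereo_inv v" by blast
      then have "u \<in> A" "v \<in> A" using r(2) by blast+
      then have "R u = R v" using e gR[of u] gR[of v] u(2,4) by (simp add: stereo_inv_inj)
      then show "a = b" using u r(3) inj_onD by metis
    qed
    then show "loc_inj g (stereo_inv z)"
      unfolding loc_inj_def using openin_stereo_inv[OF open_ball, of z r] r(1) by (intro exI[of _ "stereo_inv ` ball z r"]) auto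
  qed
qed

lemma pole_image: assumes "poly q z = 0" shows "g (stereo_inv z) = north_pole"
proof -
  define A where "A = - {z. poly p z = 0}"
  have p0: "p \<noteq> 0" using no_common[OF assms] by auto
  have "g (stereo_inv z) = flip (stereo_inv (poly q z / poly p z))"
  proof (rule agree_off_finite[where A = A and F = "{z. poly q z = 0}" and u = "\<lambda>z. g (stereo_inv z)" and
        v = "\<lambda>z. flip (stereo_inv (poly q z / poly p z))"])
    show "open A" unfolding A_def using poly_roots_finite[OF p0] by (simp add: finite_imp_closed open_Compl)
    show "continuous_on A (\<lambda>z. g (stereo_inv z))"
      by (rule continuous_on_compose2[OF cg]) (auto intro!: continuous_intros)
    show "continuous_on A (\<lambda>z. flip (stereo_inv (poly q z / poly p z)))"
      unfolding A_def by (auto intro!: continuous_intros)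
    show "g (stereo_inv y) = flip (stereo_inv (poly q y / poly p y))" if "y \<in> A - {z. poly q z = 0}" for y
      using that by (simp add: A_def geq flip_stereo_inv)
  qed (use poly_roots_finite[OF q0] no_common[OF assms] in \<open>auto simp: A_def\<close>)
  then show ?thesis using assms by (simp add: vec3_eq_iff)
qed

text \<open>In the coordinate \<open>1 / z\<close>, written with the reversed polynomials: if
  \<open>degree p \<le> degree q\<close>, infinity has a finite image; if
  \<open>degree p = degree q + 1\<close>, the derivative at infinity is nonzero and g is injective
  there.\<close>

lemma degree_gap:
  assumes nfix: "g north_pole = north_pole" and nli: "\<not> loc_inj g north_pole"
  shows "degree q + 2 \<le> degree p"
proof (rule ccontr)
  assume "\<not> degree q + 2 \<le> degree p"
  then consider "degree p \<le> degree q" | "degree p = Suc (degree q)" by linarith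
  then show False
  proof cases
    case 1
    define u where "u = (\<lambda>z. z ^ (degree q - degree p) * poly (reflect_poly p) z / poly (reflect_poly q) z)"
    define A where "A = - {z. poly (reflect_poly q) z = 0}"
    have rq: "reflect_poly q \<noteq> 0" using q0 by simp
    have zA: "0 \<in> A" using q0 by (simp add: A_def poly_0_coeff_0)
    have "g (flip (stereo_inv 0)) = stereo_inv (u 0)"
    proof (rule agree_off_finite[where A = A and F = "{0}" and u = "\<lambda>z. g (flip (stereo_inv z))" and
          v = "\<lambda>z. stereo_inv (u z)"])
      show "open A" unfolding A_def using poly_roots_finite[OF rq] by (simp add: finite_imp_closed open_Compl)
      show "continuous_on A (\<lambda>z. g (flip (stereo_inv z)))"
        by (rule continuous_on_compose2[OF cg]) (auto intro!: continuous_intros)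
      show "continuous_on A (\<lambda>z. stereo_inv (u z))" unfolding A_def u_def by (auto intro!: continuous_intros)
      show "g (flip (stereo_inv z)) = stereo_inv (u z)" if z: "z \<in> A - {0}" for z
      proof -
        have z0: "z \<noteq> 0" using z by simp
        have r: "poly (reflect_poly p) z = z ^ degree p * poly p (1 / z)" "poly (reflect_poly q) z = z ^ degree q * poly q (1 / z)"
          using z0 by (simp_all add: poly_reflect_poly_nz inverse_eq_divide)
        have qz: "poly q (1 / z) \<noteq> 0" using z r by (auto simp: A_def)
        have "z ^ (degree q - degree p) * z ^ degree p = z ^ degree q" using 1 by (simp flip: power_add)
        then have "u z = poly p (1 / z) / poly q (1 / z)"
          unfolding u_def r using z0 by (simp add: mult.assoc[symmetric])
        then show ?thesis using z0 geq[OF qz] by (simp add: flip_stereo_inv)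
      qed
    qed (use zA in auto)
    moreover have "flip (stereo_inv 0) = north_pole" by (simp add: vec3_eq_iff)
    ultimately show False using nfix by (metis stereo_inv_ne_north)
  next
    case 2
    then have p0: "p \<noteq> 0" by auto
    define S where "S = (\<lambda>z. z * poly (reflect_poly q) z / poly (reflect_poly p) z)"
    define A where "A = - ({z. poly (reflect_poly q) z = 0} \<union> {z. poly (reflect_poly p) z = 0})"
    have rq: "reflect_poly q \<noteq> 0" "reflect_poly p \<noteq> 0" using q0 p0 by auto
    have zA: "0 \<in> A" using q0 p0 by (simp add: A_def poly_0_coeff_0)
    have oA: "open A" unfolding A_def
      using poly_roots_finite[OF rq(1)] poly_roots_finite[OF rq(2)] by (intro open_Compl finite_imp_closed finite_UnI)
    have hol: "S holomorphic_on A" unfolding S_def A_def by (auto intro!: holomorphic_intros)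
    have "(S has_field_derivative poly (reflect_poly q) 0 / poly (reflect_poly p) 0) (at 0)"
      unfolding S_def using zA by (auto intro!: derivative_eq_intros poly_DERIV simp: A_def)
    then have "deriv S 0 \<noteq> 0" using zA by (simp add: DERIV_imp_deriv A_def)
    then obtain r where r: "r > 0" "ball 0 r \<subseteq> A" "inj_on S (ball 0 r)"
      using has_complex_derivative_locally_injective[OF hol zA oA] by blast
    have gS: "g (flip (stereo_inv z)) = flip (stereo_inv (S z))" if z: "z \<in> A" for z
    proof (cases "z = 0")
      case True
      have "flip (stereo_inv 0) = north_pole" by (simp add: vec3_eq_iff)
      then show ?thesis using True nfix by (simp add: S_def)
    next
      case z0: False
      have rr: "poly (reflect_poly p) z = z ^ degree p * poly p (1 / z)" "poly (reflect_poly q) z = z ^ degree q * poly q (1 / z)"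
        using z0 by (simp_all add: poly_reflect_poly_nz inverse_eq_divide)
      have qz: "poly q (1 / z) \<noteq> 0" "poly p (1 / z) \<noteq> 0" using z rr by (auto simp: A_def)
      have "S z = 1 / (poly p (1 / z) / poly q (1 / z))"
        unfolding S_def rr using z0 qz 2 by simp
      then show ?thesis using z0 geq[OF qz(1)] qz by (simp add: flip_stereo_inv)
    qed
    have "inj_on g (flip ` stereo_inv ` ball 0 r)"
    proof (rule inj_onI)
      fix a b assume "a \<in> flip ` stereo_inv ` ball 0 r" "b \<in> flip ` stereo_inv ` ball 0 r" and e: "g a = g b"
      then obtain u v where u: "u \<in> ball 0 r" "a = flip (stereo_inv u)" "v \<in> ball 0 r" "b = flip (stereo_inv v)" by blast
      then have "flip (stereo_inv (S u)) = flip (stereo_inv (S v))" using e gS r(2) by (metis subsetD)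
      then have "S u = S v" by (metis flip_flip stereo_stereo_inv)
      then show "a = b" using u r(3) inj_onD by metis
    qed
    moreover have "openin (top_of_set S2) (flip ` stereo_inv ` ball 0 r)" by (intro openin_flip openin_stereo_inv open_ball)
    moreover have "north_pole \<in> flip ` stereo_inv ` ball 0 r"
      using r(1) by (intro image_eqI[of _ flip "stereo_inv 0"] imageI) (auto simp: vec3_eq_iff)
    ultimately show False using nli unfolding loc_inj_def by blast
  qed
qed

text \<open>For a generic value w all roots of \<open>p - w q\<close> are simple and lie in one
  fibre of g, and their number is the larger of the two degrees. A topological bound on fibres thus
  bounds the algebraic degree.\<close>

lemma degree_bound:
  assumes fib: "\<And>y. y \<in> S2 \<Longrightarrow> finite (S2 \<inter> g -` {y}) \<and> card (S2 \<inter> g -` {y}) \<le> d"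
    and "finite B" and reg: "\<And>x. x \<in> S2 \<Longrightarrow> g x \<notin> B \<Longrightarrow> loc_inj g x"
  shows "degree p \<le> d" "degree q \<le> d"
proof -
  \<comment> \<open>Avoiding 0 and the quotient of the leading coefficients keeps the degree of
    \<open>p - w q\<close> from dropping; avoiding B keeps its roots simple.\<close>
  have "finite (stereo_inv -` B \<union> {0, lead_coeff p / lead_coeff q})"
    using assms(2) by (intro finite_UnI finite_vimageI) (auto simp: inj_def stereo_inv_inj)
  then obtain w where w: "w \<notin> stereo_inv -` B" "w \<noteq> 0" "w \<noteq> lead_coeff p / lead_coeff q"
    using ex_new_if_finite[OF infinite_UNIV_char_0] by blast
  define P where "P = p - smult w q"
  have deg: "degree P = max (degree p) (degree q)"
  proof -
    have s: "degree (smult w q) = degree q" using w(2) by simp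
    consider "degree p < degree q" | "degree q < degree p" | "degree p = degree q" by linarith
    then show ?thesis
    proof cases
      case 1
      then have "degree (p - smult w q) = degree (smult w q)"
        using degree_add_eq_right[of p "- smult w q"] s by (simp del: degree_smult_eq)
      then show ?thesis using 1 s by (simp add: P_def)
    next
      case 2
      then have "degree (p - smult w q) = degree p"
        using degree_add_eq_left[of "- smult w q" p] s by (simp del: degree_smult_eq)
      then show ?thesis using 2 by (simp add: P_def)
    next
      case 3
      have "coeff P (degree p) = lead_coeff p - w * lead_coeff q" using 3 by (simp add: P_def)
      moreover have "\<dots> \<noteq> 0" using w(3) q0 by (simp add: field_simps)
      ultimately have "degree p \<le> degree P" by (intro le_degree) simp
      moreover have "degree P \<le> degree p" unfolding P_def using degree_diff_le[of p "degree p" "smult w q"] 3 s by simp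
      ultimately show ?thesis using 3 by simp
    qed
  qed
  have root: "poly q z \<noteq> 0 \<and> g (stereo_inv z) = stereo_inv w" if "poly P z = 0" for z
  proof -
    have e: "poly p z = w * poly q z" using that by (simp add: P_def)
    then have "poly q z \<noteq> 0" using no_common[of z] by auto
    then show ?thesis using geq[of z] e by simp
  qed
  have "P \<noteq> 0"
  proof
    assume "P = 0"
    then have sub: "stereo_inv ` (- {z. poly q z = 0}) \<subseteq> S2 \<inter> g -` {stereo_inv w}" using root by auto
    have "finite (stereo_inv ` (- {z. poly q z = 0}))" using finite_subset[OF sub] fib[of "stereo_inv w"] by simp
    then have "finite (- {z. poly q z = 0})" by (rule finite_imageD) (auto simp: inj_on_def stereo_inv_inj)
    then show False using poly_roots_finite[OF q0] infinite_UNIV_char_0[where 'a = complex] by (metis finite_Un Compl_partition2)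
  qed
  moreover have "poly (pderiv P) z \<noteq> 0" if z: "poly P z = 0" for z
  proof
    assume "poly (pderiv P) z = 0"
    then have "poly (pderiv p) z = w * poly (pderiv q) z" by (simp add: P_def pderiv_diff pderiv_smult)
    moreover have "poly p z = w * poly q z" using z by (simp add: P_def)
    ultimately have "poly wronskian z = 0" by (simp add: wronskian_def)
    moreover have "loc_inj g (stereo_inv z)" using reg[of "stereo_inv z"] root[OF z] w(1) by simp
    ultimately show False using loc_inj_iff root[OF z] by blast
  qed
  ultimately have "card {z. poly P z = 0} = max (degree p) (degree q)" using card_simple_roots deg by metis
  moreover have "card {z. poly P z = 0} \<le> d"
  proof -
    have "card {z. poly P z = 0} = card (stereo_inv ` {z. poly P z = 0})"
      by (rule card_image[symmetric]) (auto simp: inj_on_def stereo_inv_inj)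
    also have "\<dots> \<le> card (S2 \<inter> g -` {stereo_inv w})" using fib[of "stereo_inv w"] root by (intro card_mono) auto
    also have "\<dots> \<le> d" using fib[of "stereo_inv w"] by simp
    finally show ?thesis .
  qed
  ultimately show "degree p \<le> d" "degree q \<le> d" by auto
qed

text \<open>With four superattracting fixed points, the polynomial whose roots are the finite fixed points
  has too many common roots with the difference of its derivative and the denominator.\<close>
lemma no_four_critical_fixed_points:
  assumes deg: "degree p \<le> 3" "degree q \<le> 3"
    and F: "F \<subseteq> S2" "card F = 4" "\<And>x. x \<in> F \<Longrightarrow> g x = x \<and> \<not> loc_inj g x"
  shows False
proof -
  define Z where "Z = {z. stereo_inv z \<in> F}"
  have finF: "finite F" using F(2) card.infinite by force
  have FZ: "F - {north_pole} = stereo_inv ` Z"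
    unfolding Z_def using F(1) stereo_inv_stereo by (auto simp: image_iff) (metis subsetD)
  have cardZ: "card Z = card (F - {north_pole})"
    unfolding FZ by (rule card_image[symmetric]) (auto simp: inj_on_def stereo_inv_inj)
  \<comment> \<open>The zeros of \<open>G = z q - p\<close> off the poles are the finite fixed
    points, and E is the derivative of G minus q. At a fixed point E is a multiple of the Wronskian,
    so it vanishes if the point is also critical.\<close>
  define E where "E = [:0, 1:] * pderiv q - pderiv p"
  define G where "G = [:0, 1:] * q - p"
  have Z: "poly q z \<noteq> 0" "poly G z = 0" "poly E z = 0" if "z \<in> Z" for z
  proof -
    have fixz: "g (stereo_inv z) = stereo_inv z" "\<not> loc_inj g (stereo_inv z)" using that F(3) by (auto simp: Z_def)
    show qz: "poly q z \<noteq> 0" using pole_image fixz(1) by (metis stereo_inv_ne_north)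
    have pz: "poly p z = z * poly q z" using geq[OF qz] fixz(1) qz by (simp add: stereo_inv_inj field_simps)
    then show "poly G z = 0" by (simp add: G_def)
    have "poly wronskian z = 0" using loc_inj_iff[OF qz] fixz(2) by blast
    moreover have "poly q z * poly E z = - poly wronskian z" by (simp add: wronskian_def E_def pz algebra_simps)
    ultimately have "poly q z * poly E z = 0" by simp
    then show "poly E z = 0" using qz by simp
  qed
  have roots0: "P = 0" if "degree P < card Z" "\<And>z. z \<in> Z \<Longrightarrow> poly P z = 0" for P :: "complex poly"
  proof (rule ccontr)
    assume "P \<noteq> 0"
    then have "card Z \<le> card {z. poly P z = 0}" using that(2) poly_roots_finite by (intro card_mono) auto
    also have "\<dots> \<le> degree P" using card_poly_roots_bound[OF \<open>P \<noteq> 0\<close>] .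
    finally show False using that(1) by simp
  qed
  have cE: "coeff E n = of_nat n * coeff q n - of_nat (Suc n) * coeff p (Suc n)" for n
    unfolding E_def by (cases n) (simp_all add: coeff_pderiv)
  have cG: "coeff G (Suc n) = coeff q n - coeff p (Suc n)" for n
    unfolding G_def by simp
  show False
  proof (cases "north_pole \<in> F")
    case False
    then have c4: "card Z = 4" using cardZ F(2) by simp
    have "degree E \<le> 3"
      by (rule degree_le) (use deg in \<open>auto simp: cE coeff_eq_0\<close>)
    then have "E = 0" using roots0[of E] Z(3) c4 by simp
    \<comment> \<open>Since p has degree at most 3, this coefficient of E is three times that of q;
      its vanishing lowers the degree of G from 4 to 3, below the number of its roots.\<close>
    then have "coeff q 3 = 0" using cE[of 3] deg(1) by (simp add: coeff_eq_0)
    then have "degree G \<le> 3"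
    proof (intro degree_le allI impI)
      fix i :: nat assume "coeff q 3 = 0" "3 < i"
      then obtain n where n: "i = Suc n" "n \<ge> 3" by (metis Suc_le_D Suc_le_mono less_eq_Suc_le)
      show "coeff G i = 0" unfolding n(1) cG using n(2) deg \<open>coeff q 3 = 0\<close>
        by (cases "n = 3") (auto simp: coeff_eq_0)
    qed
    then have "G = 0" using roots0[of G] Z(2) c4 by simp
    then have p: "p = [:0, 1:] * q" by (simp add: G_def)
    have "E = - q" unfolding E_def p by (simp add: pderiv_mult pderiv_pCons)
    then show False using \<open>E = 0\<close> q0 by simp
  next
    case True
    then have c3: "card Z = 3" using cardZ F(2) finF by simp
    have gap: "degree q + 2 \<le> degree p" using degree_gap F(3) True by blast
    have "degree E \<le> 2"
      by (rule degree_le) (use deg gap in \<open>auto simp: cE coeff_eq_0\<close>)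
    then have "E = 0" using roots0[of E] Z(3) c3 by simp
    \<comment> \<open>The gap of two between the degrees leaves no term of q at degree m, so the
      coefficient of E there is \<open>- (m + 1)\<close> times the leading coefficient of p.\<close>
    obtain m where m: "degree p = Suc m" using gap by (cases "degree p") auto
    have "coeff q m = 0" using gap m by (simp add: coeff_eq_0)
    then have "coeff p (Suc m) = 0" using cE[of m] \<open>E = 0\<close> by (simp del: of_nat_Suc)
    then show False using m gap by (metis leading_coeff_0_iff degree_0 nat.distinct(1))
  qed
qed

end

text \<open>The isotopy is relative to the postcritical set, so H and K agree there, and each fixed
  critical point a of \<open>tmap\<close> becomes a fixed critical point \<open>H a\<close> of g.
  The bound 3 on fibres is carried over as well, so the algebraic statement about four such points
  applies.\<close>

lemma obstructed_tmap: "obstructed tmap"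
  unfolding obstructed_def
proof (intro conjI notI thurston_map_tmap)
  assume "\<exists>g. rational_map g \<and> thurston_equiv tmap g"
  then obtain g H H' K K' where g: "rational_map g" and H: "homeomorphism S2 S2 H H'" and K: "homeomorphism S2 S2 K K'"
    and iso: "isotopic_rel crit4 H K" and conj: "\<And>x. x \<in> S2 \<Longrightarrow> H (tmap x) = g (K x)"
    unfolding thurston_equiv_def post_tmap by blast
  have HK: "K x = H x" if "x \<in> crit4" for x
    using iso that homotopic_with_imp_property unfolding isotopic_rel_def by blast
  obtain p q where pq: "q \<noteq> 0" "\<And>z. poly q z = 0 \<Longrightarrow> poly p z \<noteq> 0"
    "\<And>z. poly q z \<noteq> 0 \<Longrightarrow> g (stereo_inv z) = stereo_inv (poly p z / poly q z)"
    using rational_map_reduced[OF g] by metis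
  interpret reduced_rational g p q
    by unfold_locales (use pq g in \<open>auto simp: rational_map_def\<close>)
  have sub: "crit4 \<subseteq> S2" by (auto simp: crit4_def)
  have Hinv: "H x \<in> S2" "H' (H x) = x" "K x \<in> S2" "K' (K x) = x" "H' x \<in> S2" "H (H' x) = x" "K' x \<in> S2" "K (K' x) = x" if "x \<in> S2" for x
    using H K that unfolding homeomorphism_def by auto
  have conj': "H' (g x) = tmap (K' x)" if "x \<in> S2" for x
    using conj[of "K' x"] Hinv(2)[of "tmap (K' x)"] Hinv(7,8)[OF that] by simp
  have gS: "g ` S2 \<subseteq> S2" using g unfolding rational_map_def by blast
  have li: "loc_inj g (K x) \<longleftrightarrow> x \<notin> crit4" if "x \<in> S2" for x
  proof
    assume "loc_inj g (K x)"
    then have "loc_inj tmap (K' (K x))"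
      by (intro loc_inj_semiconj[where f = g and g = tmap and x = "K x", OF homeomorphism_symD[OF H] homeomorphism_symD[OF K] gS]
          conj' Hinv(3)[OF that])
    then show "x \<notin> crit4" using that Hinv loc_inj_tmap by simp
  next
    assume "x \<notin> crit4"
    then have "loc_inj tmap x" using that loc_inj_tmap by blast
    moreover have "tmap ` S2 \<subseteq> S2" by auto
    ultimately show "loc_inj g (K x)" by (intro loc_inj_semiconj[where f = tmap and g = g and x = x, OF H K] conj that)
  qed
  have fib: "finite (S2 \<inter> g -` {y}) \<and> card (S2 \<inter> g -` {y}) \<le> 3" if y: "y \<in> S2" for y
  proof -
    have "S2 \<inter> g -` {y} \<subseteq> K ` (S2 \<inter> tmap -` {H' y})"
    proof
      fix x assume x: "x \<in> S2 \<inter> g -` {y}"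
      then have "tmap (K' x) = H' y" using conj'[of x] by auto
      then show "x \<in> K ` (S2 \<inter> tmap -` {H' y})" using x Hinv by (intro image_eqI[of _ _ "K' x"]) auto
    qed
    moreover have f: "finite (S2 \<inter> tmap -` {H' y})" "card (S2 \<inter> tmap -` {H' y}) \<le> 3" using tmap_fiber Hinv y by auto
    ultimately show ?thesis
      by (meson card_image_le card_mono finite_imageI finite_subset le_trans)
  qed
  \<comment> \<open>Critical points of g are the points \<open>K a\<close> with a in
    \<open>crit4\<close>, and \<open>K a\<close> has the value \<open>H a\<close>; so the critical
    values lie in the image of \<open>crit4\<close> under H.\<close>
  have reg: "loc_inj g x" if x: "x \<in> S2" "g x \<notin> H ` crit4" for x
  proof -
    have "K' x \<notin> crit4"
    proof
      assume c: "K' x \<in> crit4"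
      then have "g (K (K' x)) = H (K' x)" using conj[of "K' x"] Hinv x tmap_crit4 by simp
      then show False using c x Hinv by auto
    qed
    then show ?thesis using li[of "K' x"] Hinv x by simp
  qed
  have fin: "finite (H ` crit4)" using finite_crit4 by (rule finite_imageI)
  have "degree p \<le> 3"
    by (rule degree_bound(1)[where d = 3 and B = "H ` crit4"], erule fib, rule fin, erule reg, assumption)
  moreover have "degree q \<le> 3"
    by (rule degree_bound(2)[where d = 3 and B = "H ` crit4"], erule fib, rule fin, erule reg, assumption)
  moreover have "H ` crit4 \<subseteq> S2" using Hinv(1) sub by (meson image_subsetI subsetD)
  moreover have "card (H ` crit4) = 4"
  proof -
    have "inj_on H crit4" by (rule inj_on_inverseI[of _ H']) (use Hinv(2) sub in \<open>meson subsetD\<close>)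
    then show ?thesis by (simp add: card_image card_crit4)
  qed
  moreover have "g x = x \<and> \<not> loc_inj g x" if x: "x \<in> H ` crit4" for x
  proof -
    obtain a where a: "a \<in> crit4" "x = H a" using x by blast
    then have "x = K a" "a \<in> S2" using HK sub by auto
    then show ?thesis using conj[of a] li[of a] a tmap_crit4[OF a(1)] by simp
  qed
  ultimately show False by (rule no_four_critical_fixed_points)
qed

section \<open>Lifting paths\<close>

lemma local_model_1_homeomorphism:
  assumes "local_model f p 1"
  obtains U V g where "openin (top_of_set S2) U" "openin (top_of_set S2) V" "p \<in> U" "homeomorphism U V f g"
proof -
  obtain U V \<phi> \<phi>' \<psi> \<psi>' where m: "openin (top_of_set S2) U" "openin (top_of_set S2) V" "p \<in> U" "f ` U \<subseteq> V"
        "homeomorphism U (ball 0 1) \<phi> \<phi>'" "homeomorphism V (ball 0 1) \<psi> \<psi>'"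
        "\<forall>z\<in>ball 0 1. \<psi> (f (\<phi>' z)) = (z::complex) ^ 1"
    using assms unfolding local_model_def by blast
  have h: "homeomorphism U V (\<psi>' \<circ> \<phi>) (\<phi>' \<circ> \<psi>)"
    by (rule homeomorphism_compose[OF m(5) homeomorphism_symD[OF m(6)]])
  have "f x = (\<psi>' \<circ> \<phi>) x" if x: "x \<in> U" for x
  proof -
    have "\<phi> x \<in> ball 0 1" "\<phi>' (\<phi> x) = x" using m(5) x by (auto simp: homeomorphism_def)
    then have "\<psi> (f x) = \<phi> x" using m(7) by (metis power_one_right)
    moreover have "\<psi>' (\<psi> (f x)) = f x" using m(4,6) x by (auto simp: homeomorphism_def)
    ultimately show ?thesis by simp
  qed
  then have "homeomorphism U V f (\<phi>' \<circ> \<psi>)" by (intro homeomorphism_cong[OF h]) auto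
  then show ?thesis using that m by blast
qed

lemma finite_separated:
  fixes F :: "'a::metric_space set"
  assumes "finite F"
  shows "\<exists>e>0. \<forall>x\<in>F. \<forall>y\<in>F. x \<noteq> y \<longrightarrow> 2 * e \<le> dist x y"
  using assms
proof (induction rule: finite_induct)
  case (insert a F)
  then obtain e where e: "e > 0" "\<forall>x\<in>F. \<forall>y\<in>F. x \<noteq> y \<longrightarrow> 2 * e \<le> dist x y" by blast
  obtain d where d: "d > 0" "\<forall>x\<in>F. x \<noteq> a \<longrightarrow> d \<le> dist a x"
    using finite_set_avoid[OF insert(1), of a] by blast
  show ?case
    using d e by (intro exI[of _ "min e (d / 2)"]) (auto simp: dist_commute min_def field_simps; force)
qed (auto intro: exI[of _ 1])

text \<open>Off the critical points \<open>tmap\<close> is a local homeomorphism, fibres are finite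
  and the sphere is compact. The whole preimage of \<open>crit4\<close> is removed, since regular
  points also map into \<open>crit4\<close>.\<close>

lemma covering_space_tmap: "covering_space (S2 - tmap -` crit4) tmap (S2 - crit4)"
  unfolding covering_space_def
proof (intro conjI ballI)
  show "continuous_on (S2 - tmap -` crit4) tmap"
    using continuous_on_tmap by (rule continuous_on_subset) auto
  show "tmap ` (S2 - tmap -` crit4) = S2 - crit4"
    using tmap_surj by auto
  fix q assume q: "q \<in> S2 - crit4"
  define F where "F = S2 \<inter> tmap -` {q}"
  have finF: "finite F" using tmap_fiber(1) q by (simp add: F_def)
  have "\<exists>U V g. openin (top_of_set S2) U \<and> openin (top_of_set S2) V \<and> x \<in> U \<and> homeomorphism U V tmap g" if "x \<in> F" for x
  proof -
    have x: "x \<in> S2" "x \<notin> crit4" using that q tmap_crit4[of x] by (auto simp: F_def)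
    obtain k where k: "k \<ge> 1" "local_model tmap x k" using local_model_tmap[OF x(1)] by blast
    have "\<not> k \<ge> 2" using x k(2) unfolding crit_tmap[symmetric] crit_def by blast
    then have "k = 1" using k(1) by simp
    then show ?thesis using k(2) local_model_1_homeomorphism by metis
  qed
  then obtain U V g where UV: "\<And>x. x \<in> F \<Longrightarrow> openin (top_of_set S2) (U x)" "\<And>x. x \<in> F \<Longrightarrow> openin (top_of_set S2) (V x)"
    "\<And>x. x \<in> F \<Longrightarrow> x \<in> U x" "\<And>x. x \<in> F \<Longrightarrow> homeomorphism (U x) (V x) tmap (g x)" by metis
  obtain e where e: "e > 0" "\<And>x y. x \<in> F \<Longrightarrow> y \<in> F \<Longrightarrow> x \<noteq> y \<Longrightarrow> 2 * e \<le> dist x y"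
    using finite_separated[OF finF] by blast
  define U' where "U' x = U x \<inter> ball x e" for x
  have U': "openin (top_of_set S2) (U' x)" if "x \<in> F" for x
  proof -
    have "openin (top_of_set S2) (S2 \<inter> ball x e)" by auto
    moreover have "U' x = U x \<inter> (S2 \<inter> ball x e)" using openin_imp_subset[OF UV(1)[OF that]] by (auto simp: U'_def)
    ultimately show ?thesis using UV(1)[OF that] by auto
  qed
  have imU': "openin (top_of_set S2) (tmap ` U' x)" if "x \<in> F" for x
  proof -
    have "openin (top_of_set (U x)) (U' x)" unfolding U'_def by auto
    then have "openin (top_of_set (V x)) (tmap ` U' x)" using homeomorphism_imp_open_map[OF UV(4)[OF that]] by blast
    then show ?thesis using UV(2)[OF that] openin_trans by blast
  qed
  \<comment> \<open>Discarding the compact image of the complement of the neighbourhoods ensures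
    that every preimage of a point of T lies in one of them; the intersection ensures that each of
    them contains one.\<close>
  define T where "T = (S2 - crit4) \<inter> (S2 - tmap ` (S2 - (\<Union>x\<in>F. U' x))) \<inter> (\<Inter>x\<in>F. tmap ` U' x)"
  have xU': "x \<in> U' x" if "x \<in> F" for x using UV(3)[OF that] e(1) by (simp add: U'_def)
  have op1: "openin (top_of_set S2) (S2 - crit4)"
    using finite_crit4 by (intro openin_diff) (auto intro: finite_imp_closedin simp: crit4_def)
  have op2: "openin (top_of_set S2) (S2 - tmap ` (S2 - (\<Union>x\<in>F. U' x)))"
  proof -
    have "openin (top_of_set S2) (\<Union>x\<in>F. U' x)" using U' by blast
    then have "closedin (top_of_set S2) (S2 - (\<Union>x\<in>F. U' x))" by (simp add: closedin_diff)
    then have "compact (S2 - (\<Union>x\<in>F. U' x))" by (rule closedin_compact[rotated]) (simp add: S2_def)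
    then have "compact (tmap ` (S2 - (\<Union>x\<in>F. U' x)))"
      by (rule compact_continuous_image[rotated]) (rule continuous_on_subset[OF continuous_on_tmap], auto)
    then have "closed (tmap ` (S2 - (\<Union>x\<in>F. U' x)))" by (rule compact_imp_closed)
    then have "open (- tmap ` (S2 - (\<Union>x\<in>F. U' x)))" by (rule open_Compl)
    then have "openin (top_of_set S2) (S2 \<inter> - tmap ` (S2 - (\<Union>x\<in>F. U' x)))" by (rule openin_open_Int)
    then show ?thesis by (simp only: Diff_eq[of S2 "tmap ` _"])
  qed
  have opT: "openin (top_of_set S2) T"
  proof (cases "F = {}")
    case False
    then have "openin (top_of_set S2) (\<Inter>x\<in>F. tmap ` U' x)" using finF imU' by (intro openin_INT2) auto
    then show ?thesis unfolding T_def using op1 op2 by blast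
  qed (use op1 op2 in \<open>auto simp: T_def\<close>)
  have qT: "q \<in> T" using q xU' by (auto simp: T_def F_def)
  have TS: "T \<subseteq> S2 - crit4" by (auto simp: T_def)
  define v where "v = (\<lambda>x. U' x \<inter> tmap -` T) ` F"
  have "openin (top_of_set (S2 - crit4)) T" using opT TS openin_subset_trans by blast
  moreover have "\<Union> v = (S2 - tmap -` crit4) \<inter> tmap -` T"
  proof (intro set_eqI iffI)
    fix y assume "y \<in> \<Union> v"
    then obtain x where "x \<in> F" "y \<in> U' x" "tmap y \<in> T" by (auto simp: v_def)
    then show "y \<in> (S2 - tmap -` crit4) \<inter> tmap -` T" using TS openin_imp_subset[OF U'] by blast
  next
    fix y assume y: "y \<in> (S2 - tmap -` crit4) \<inter> tmap -` T"
    then have "y \<in> (\<Union>x\<in>F. U' x)" by (auto simp: T_def)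
    then show "y \<in> \<Union> v" using y by (auto simp: v_def)
  qed
  moreover have "\<forall>u\<in>v. openin (top_of_set (S2 - tmap -` crit4)) u"
  proof
    fix u assume "u \<in> v"
    then obtain x where x: "x \<in> F" "u = U' x \<inter> tmap -` T" by (auto simp: v_def)
    have "openin (top_of_set S2) (S2 \<inter> tmap -` T)"
      by (rule continuous_openin_preimage[OF continuous_on_tmap _ opT]) auto
    then have "openin (top_of_set S2) (U' x \<inter> (S2 \<inter> tmap -` T))" using U'[OF x(1)] by blast
    moreover have "U' x \<inter> (S2 \<inter> tmap -` T) = u" using x openin_imp_subset[OF U'[OF x(1)]] by blast
    moreover have "u \<subseteq> S2 - tmap -` crit4" using x openin_imp_subset[OF U'[OF x(1)]] TS by blast
    ultimately show "openin (top_of_set (S2 - tmap -` crit4)) u"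
      by (metis Diff_subset openin_subset_trans)
  qed
  moreover have "pairwise disjnt v"
  proof (rule pairwiseI)
    fix a b assume "a \<in> v" "b \<in> v" "a \<noteq> b"
    then obtain x y where xy: "x \<in> F" "y \<in> F" "x \<noteq> y" "a \<subseteq> ball x e" "b \<subseteq> ball y e" by (auto simp: v_def U'_def)
    have "ball x e \<inter> ball y e = {}" using e(2)[OF xy(1-3)] by (intro disjoint_ballI) simp
    then show "disjnt a b" using xy by (auto simp: disjnt_def)
  qed
  moreover have "\<forall>u\<in>v. \<exists>h. homeomorphism u T tmap h"
  proof
    fix u assume "u \<in> v"
    then obtain x where x: "x \<in> F" "u = U' x \<inter> tmap -` T" by (auto simp: v_def)
    have "T \<subseteq> tmap ` U' x" using x(1) unfolding T_def by blast
    then have "tmap ` u = T" unfolding x(2) by blast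
    moreover have "u \<subseteq> U x" unfolding x(2) U'_def by blast
    moreover have "T \<subseteq> V x"
      using \<open>T \<subseteq> tmap ` U' x\<close> homeomorphism_image1[OF UV(4)[OF x(1)]] unfolding U'_def by blast
    ultimately have "homeomorphism u T tmap (g x)"
      by (intro homeomorphism_of_subsets[OF UV(4)[OF x(1)]])
    then show "\<exists>h. homeomorphism u T tmap h" by blast
  qed
  ultimately show "\<exists>T. q \<in> T \<and> openin (top_of_set (S2 - crit4)) T \<and>
      (\<exists>v. \<Union> v = (S2 - tmap -` crit4) \<inter> tmap -` T \<and> (\<forall>u\<in>v. openin (top_of_set (S2 - tmap -` crit4)) u) \<and>
        pairwise disjnt v \<and> (\<forall>u\<in>v. \<exists>h. homeomorphism u T tmap h))"
    using qT by blast
qed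

lemma funpow_tmap_S2: "p \<in> S2 \<Longrightarrow> (tmap ^^ n) p \<in> S2"
  by (induction n) auto

lemma continuous_on_funpow_tmap: "continuous_on S2 (tmap ^^ n)"
proof (induction n)
  case (Suc n)
  then have "continuous_on S2 (\<lambda>x. tmap ((tmap ^^ n) x))"
    by (rule continuous_on_compose2[OF continuous_on_tmap]) (auto simp: funpow_tmap_S2)
  then show ?case by (simp add: comp_def)
qed (simp add: id_def)

text \<open>The points of \<open>crit4\<close> are fixed, so they belong to their own preimage. A
  lift through the covering therefore avoids \<open>crit4\<close> again and can itself be
  lifted.\<close>

lemma path_lift_tmap:
  assumes "path \<gamma>" "path_image \<gamma> \<subseteq> S2 - crit4" "p \<in> S2" "(tmap ^^ n) p = pathstart \<gamma>"
  obtains \<delta> where "path \<delta>" "path_image \<delta> \<subseteq> S2 - crit4" "pathstart \<delta> = p" "\<And>s. s \<in> {0..1} \<Longrightarrow> (tmap ^^ n) (\<delta> s) = \<gamma> s"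
  using assms
proof (induction n arbitrary: \<gamma> thesis)
  case 0
  show ?case by (rule 0(1)[of \<gamma>]) (use 0 in auto)
next
  case (Suc n)
  define p' where "p' = (tmap ^^ n) p"
  have p': "tmap p' = pathstart \<gamma>" "p' \<in> S2" using Suc.prems funpow_tmap_S2 by (auto simp: p'_def)
  have "pathstart \<gamma> \<notin> crit4" using Suc.prems(3) pathstart_in_path_image by blast
  then have "p' \<in> S2 - tmap -` crit4" using p' by auto
  then obtain \<epsilon> where \<epsilon>: "path \<epsilon>" "path_image \<epsilon> \<subseteq> S2 - tmap -` crit4" "pathstart \<epsilon> = p'" "\<And>s. s \<in> {0..1} \<Longrightarrow> tmap (\<epsilon> s) = \<gamma> s"
    using covering_space_lift_path_strong[OF covering_space_tmap, of p' \<gamma>] Suc.prems(2,3) p'(1) by metis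
  have sub: "S2 - tmap -` crit4 \<subseteq> S2 - crit4" using tmap_crit4 by auto
  obtain \<delta> where \<delta>: "path \<delta>" "path_image \<delta> \<subseteq> S2 - crit4" "pathstart \<delta> = p" "\<And>s. s \<in> {0..1} \<Longrightarrow> (tmap ^^ n) (\<delta> s) = \<epsilon> s"
    using Suc.IH[of \<epsilon>] \<epsilon>(1-3) sub Suc.prems(4) p'_def by (metis subset_trans)
  show ?case by (rule Suc.prems(1)[OF \<delta>(1-3)]) (use \<delta>(4) \<epsilon>(4) in simp)
qed

section \<open>Itineraries\<close>

text \<open>The four arcs of the great circle \<open>x$2 = 0\<close> between the critical points, and the three
  components of the complement of the zero set of \<^const>\<open>esph\<close>.\<close>
datatype arc = Mid bool | Pole bool
datatype sheet = Outer | Bulb bool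

definition sg :: "bool \<Rightarrow> real" where "sg b = (if b then 1 else - 1)"

text \<open>Read off from the picture of the sheets. From outside, a crossing of
  \<open>Mid b\<close> lifts to a passage through the loop into bulb b; the real circle is not
  crossed and the recursion stops. Inside a bulb the only real arc is its middle one, so every other
  crossing continues there as that middle arc. Crossings of a polar arc lift outside to the same
  arc.\<close>

fun act :: "arc \<Rightarrow> sheet list \<Rightarrow> sheet list" where
  "act _ [] = []"
| "act (Mid b) (Outer # w) = Bulb b # w"
| "act (Mid b) (Bulb b' # w) = (if b' = b then Outer # w else Bulb b' # act (Mid b') w)"
| "act (Pole b) (Outer # w) = Outer # act (Pole b) w"
| "act (Pole b) (Bulb b' # w) = Bulb b' # act (Mid b') w"

lemma act_act [simp]: "act X (act X w) = w"
  by (induction X w rule: act.induct) auto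

lemma length_act [simp]: "length (act X w) = length w"
  by (induction X w rule: act.induct) auto

definition sheet :: "real^3 \<Rightarrow> sheet" where
  "sheet x = (if esph x > 0 then Outer else Bulb (x $ 1 > 0))"

text \<open>The sheet of the last iterate stands first: it is the letter nearest the root of the
  tree, and the automaton reads it first.\<close>

fun code :: "nat \<Rightarrow> real^3 \<Rightarrow> sheet list" where
  "code 0 x = []"
| "code (Suc n) x = sheet ((tmap ^^ n) x) # code n x"

lemma length_code [simp]: "length (code n x) = n"
  by (induction n) auto

definition arcset :: "arc \<Rightarrow> (real^3) set" where
  "arcset X = (case X of Mid b \<Rightarrow> {x. x $ 2 = 0 \<and> \<bar>x $ 3\<bar> < eta \<and> sg b * x $ 1 > 0}
                       | Pole b \<Rightarrow> {x. x $ 2 = 0 \<and> eta < \<bar>x $ 3\<bar> \<and> sg b * x $ 3 > 0})"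

text \<open>The two open hemispheres joined across a single arc. For a path inside such a set, only
  the sides of its two ends matter for the itineraries of its lifts.\<close>

definition adom :: "arc \<Rightarrow> (real^3) set" where
  "adom X = {x \<in> S2. x $ 2 \<noteq> 0 \<or> x \<in> arcset X}"

lemma eta_pos: "0 < eta" and eta_less_1: "eta < 1"
proof -
  have v: "0 < crit_val^2" "crit_val^2 < 1" 
    using crit_val_pos crit_val_less crit_pt_less by (auto simp: abs_square_less_1)
  then have p: "0 < 1 + crit_val^2" by linarith
  show "0 < eta" unfolding eta_def using v p by (intro divide_pos_pos) auto
  show "eta < 1" unfolding eta_def pos_divide_less_eq[OF p] using v(1) by simp
qed

lemma arc_exists:
  assumes "x \<in> S2" "x $ 2 = 0" "x \<notin> crit4" shows "\<exists>X. x \<in> arcset X"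
proof (cases "\<bar>x $ 3\<bar> < eta")
  case True
  have "x $ 1 \<noteq> 0"
  proof
    assume "x $ 1 = 0"
    then have "(x $ 3)^2 = 1" using assms by (simp add: S2_iff)
    then show False using True eta_less_1 by (simp add: abs_square_eq_1)
  qed
  then have "x \<in> arcset (Mid (x $ 1 > 0))" using True assms by (auto simp: arcset_def sg_def)
  then show ?thesis ..
next
  case False
  then have "eta < \<bar>x $ 3\<bar>" using assms by (auto simp: crit4_def)
  then have "x \<in> arcset (Pole (x $ 3 > 0))" using eta_pos assms by (auto simp: arcset_def sg_def)
  then show ?thesis ..
qed

lemma arc_unique: "x \<in> arcset X \<Longrightarrow> x \<in> arcset Y \<Longrightarrow> X = Y"
  by (cases X; cases Y) (auto simp: arcset_def sg_def split: if_splits)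

lemma adom_disjoint_crit4: "adom X \<inter> crit4 = {}"
  by (cases X) (auto simp: adom_def arcset_def crit4_def)

lemma sg_sgn: "sg b * y > 0 \<Longrightarrow> sgn z = sgn y \<Longrightarrow> sg b * z > 0"
  by (cases b) (auto simp: sg_def sgn_if split: if_splits)

section \<open>How lifts meet the arcs and the bulbs\<close>

lemma same_sign_off_zero:
  fixes k :: "real \<Rightarrow> real"
  assumes "a \<le> b" "continuous_on {a..b} k" "\<And>s. s \<in> {a..b} \<Longrightarrow> k s \<noteq> 0"
  shows "sgn (k a) = sgn (k b)"
proof (rule ccontr)
  assume ne: "sgn (k a) \<noteq> sgn (k b)"
  have "k a \<noteq> 0" "k b \<noteq> 0" using assms by auto
  then consider "k a \<le> 0" "0 \<le> k b" | "k b \<le> 0" "0 \<le> k a" using ne by (auto simp: sgn_if split: if_splits)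
  then show False
  proof cases
    case 1
    then show False using IVT'[of k a 0 b] assms by fastforce
  next
    case 2
    then show False using IVT2'[of k b 0 a] assms by fastforce
  qed
qed

text \<open>Lying in the bulb is open and closed along the path: on its frontier either
  \<open>x $ 1 = 0\<close>, where \<open>esph\<close> is positive, or \<open>esph\<close> vanishes
  on the side of c, which is excluded.\<close>

lemma bulb_const:
  fixes a b :: real
  assumes "a \<le> b" "continuous_on {a..b} \<delta>" "\<And>s. s \<in> {a..b} \<Longrightarrow> \<delta> s \<in> S2"
    and avoid: "\<And>s. s \<in> {a..b} \<Longrightarrow> esph (\<delta> s) = 0 \<Longrightarrow> \<not> sg c * \<delta> s $ 1 > 0"
  shows "(\<forall>s\<in>{a..b}. esph (\<delta> s) < 0 \<and> sg c * \<delta> s $ 1 > 0) \<or> (\<forall>s\<in>{a..b}. \<not> (esph (\<delta> s) < 0 \<and> sg c * \<delta> s $ 1 > 0))"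
proof -
  define J where "J = {s \<in> {a..b}. esph (\<delta> s) < 0 \<and> sg c * \<delta> s $ 1 > 0}"
  have ce: "continuous_on {a..b} (\<lambda>s. esph (\<delta> s))"
    by (rule continuous_on_compose2[OF continuous_on_esph assms(2)]) (use assms(3) in auto)
  have c1: "continuous_on {a..b} (\<lambda>s. sg c * \<delta> s $ 1)" using assms(2) by (intro continuous_intros)
  have J1: "J = ({a..b} \<inter> (\<lambda>s. esph (\<delta> s)) -` {..<0}) \<inter> ({a..b} \<inter> (\<lambda>s. sg c * \<delta> s $ 1) -` {0<..})"
    by (auto simp: J_def)
  have J2: "J = ({a..b} \<inter> (\<lambda>s. esph (\<delta> s)) -` {..0}) \<inter> ({a..b} \<inter> (\<lambda>s. sg c * \<delta> s $ 1) -` {0..})"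
  proof (intro set_eqI iffI)
    fix s assume s: "s \<in> ({a..b} \<inter> (\<lambda>s. esph (\<delta> s)) -` {..0}) \<inter> ({a..b} \<inter> (\<lambda>s. sg c * \<delta> s $ 1) -` {0..})"
    have "sg c * \<delta> s $ 1 \<noteq> 0"
    proof
      assume "sg c * \<delta> s $ 1 = 0"
      then have "\<delta> s $ 1 = 0" by (auto simp: sg_def split: if_splits)
      then show False using esph_imaginary[of "\<delta> s"] assms(3)[of s] s by auto
    qed
    moreover have "sg c * \<delta> s $ 1 \<ge> 0" using s by auto
    ultimately have "sg c * \<delta> s $ 1 > 0" by linarith
    moreover have "esph (\<delta> s) \<noteq> 0" using avoid[of s] calculation s by auto
    ultimately show "s \<in> J" using s by (auto simp: J_def)
  qed (auto simp: J_def)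
  have "openin (top_of_set {a..b}) J" unfolding J1
    by (intro openin_Int continuous_openin_preimage_gen ce c1) auto
  moreover have "closedin (top_of_set {a..b}) J" unfolding J2
    by (intro closedin_Int continuous_closedin_preimage ce c1) auto
  ultimately have "J = {} \<or> J = {a..b}" using connected_clopen[of "{a..b}"] connected_Icc by blast
  then show ?thesis by (auto simp: J_def)
qed

text \<open>Inside each sheet the preimage of \<open>adom X\<close> meets at most one arc of the
  real circle. This is why one step of lifting replaces X by a single arc Y.\<close>

lemma image_in_arc:
  assumes "x \<in> S2" "tmap x \<in> adom X"
  shows "esph x = 0 \<Longrightarrow> \<exists>b. X = Mid b \<and> sg b * x $ 1 > 0"
    and "x $ 2 = 0 \<Longrightarrow> esph x > 0 \<Longrightarrow> (\<exists>b. X = Pole b) \<and> x \<in> arcset X"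
    and "x $ 2 = 0 \<Longrightarrow> \<not> esph x > 0 \<Longrightarrow> x \<in> arcset (Mid (x $ 1 > 0)) \<and> esph x < 0 \<and> X \<noteq> Mid (x $ 1 > 0)"
proof -
  have z2: "x $ 2 = 0 \<or> esph x = 0 \<Longrightarrow> tmap x $ 2 = 0 \<and> tmap x \<in> arcset X"
    using sgn_tmap_nth2[OF assms(1)] assms(2) by (auto simp: adom_def sgn_eq_0_iff)
  show "\<exists>b. X = Mid b \<and> sg b * x $ 1 > 0" if e: "esph x = 0"
  proof -
    have t: "tmap x \<in> arcset X" "\<bar>tmap x $ 3\<bar> \<le> eta" "sgn (x $ 1) = sgn (tmap x $ 1)"
      using z2 e esph_zero[OF assms(1) e] by auto
    obtain b where b: "X = Mid b" using t(1,2) by (cases X) (auto simp: arcset_def)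
    then have "sg b * tmap x $ 1 > 0" using t(1) by (simp add: arcset_def)
    then show ?thesis using sg_sgn t(3) b by blast
  qed
  have ne: "\<bar>x $ 3\<bar> \<noteq> eta" if "x $ 2 = 0"
  proof
    assume "\<bar>x $ 3\<bar> = eta"
    then have "x \<in> crit4" using that assms(1) by (simp add: crit4_def)
    then show False using tmap_crit4[of x] assms(2) adom_disjoint_crit4 by auto
  qed
  show "(\<exists>b. X = Pole b) \<and> x \<in> arcset X" if x2: "x $ 2 = 0" and e: "esph x > 0"
  proof -
    have x3: "eta < \<bar>x $ 3\<bar>" using esph_real[OF assms(1) x2] e by auto
    have t3: "eta < \<bar>tmap x $ 3\<bar>" using tmap_outer_arcs[OF assms(1) x2 x3] .
    obtain b where b: "X = Pole b" using z2 x2 t3 by (cases X) (auto simp: arcset_def)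
    then have "sg b * tmap x $ 3 > 0" using z2 x2 by (simp add: arcset_def)
    moreover have "sgn (x $ 3) = sgn (tmap x $ 3)"
      using tmap_nth3_neg[OF assms(1)] tmap_nth3_pos[OF assms(1)] by (auto simp: sgn_if)
    ultimately have "sg b * x $ 3 > 0" using sg_sgn by blast
    then show ?thesis using b x2 x3 by (simp add: arcset_def)
  qed
  show "x \<in> arcset (Mid (x $ 1 > 0)) \<and> esph x < 0 \<and> X \<noteq> Mid (x $ 1 > 0)" if x2: "x $ 2 = 0" and e: "\<not> esph x > 0"
  proof -
    have e0: "esph x < 0" "\<bar>x $ 3\<bar> < eta" using e ne[OF x2] esph_real[OF assms(1) x2] by linarith+
    have x1: "x $ 1 \<noteq> 0" using esph_imaginary[OF assms(1)] e by auto
    have arc: "x \<in> arcset (Mid (x $ 1 > 0))" using x2 e0 x1 by (auto simp: arcset_def sg_def)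
    have "X \<noteq> Mid (x $ 1 > 0)"
    proof
      assume X: "X = Mid (x $ 1 > 0)"
      then have t: "\<bar>tmap x $ 3\<bar> < eta" "sg (x $ 1 > 0) * tmap x $ 1 > 0" using z2 x2 by (auto simp: arcset_def)
      have "sgn (tmap x $ 1) = - sgn (x $ 1)" using tmap_inner_arcs[OF assms(1) x2 e0(2) t(1)] .
      then show False using t(2) x1 by (auto simp: sg_def sgn_if split: if_splits)
    qed
    then show ?thesis using arc e0 by blast
  qed
qed

lemma sheet_Bulb_iff:
  assumes "x \<in> S2" "esph x \<noteq> 0" shows "sheet x = Bulb c \<longleftrightarrow> esph x < 0 \<and> sg c * x $ 1 > 0"
proof (cases "esph x > 0")
  case False
  then have "esph x < 0" "x $ 1 \<noteq> 0" using assms esph_imaginary[OF assms(1)] by auto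
  then show ?thesis using False by (auto simp: sheet_def sg_def)
qed (auto simp: sheet_def)

text \<open>The lift of a path through the arc \<^term>\<open>Mid d\<close> stays off the great circle, unless it starts in
  the bulb other than \<^term>\<open>Bulb d\<close>, where it remains.\<close>
lemma lift_step:
  fixes a b :: real
  assumes ab: "a \<le> b" and cont: "continuous_on {a..b} \<delta>" and S2: "\<And>s. s \<in> {a..b} \<Longrightarrow> \<delta> s \<in> S2"
    and dom: "\<And>s. s \<in> {a..b} \<Longrightarrow> tmap (\<delta> s) \<in> adom X"
    and ends: "tmap (\<delta> a) $ 2 \<noteq> 0" "tmap (\<delta> b) $ 2 \<noteq> 0"
  obtains Y where "\<And>s. s \<in> {a..b} \<Longrightarrow> \<delta> s \<in> adom Y" "\<delta> a $ 2 \<noteq> 0" "\<delta> b $ 2 \<noteq> 0"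
    "\<And>w. (if sgn (tmap (\<delta> a) $ 2) = sgn (tmap (\<delta> b) $ 2) then sheet (\<delta> a) # w else act X (sheet (\<delta> a) # w)) =
      sheet (\<delta> b) # (if sgn (\<delta> a $ 2) = sgn (\<delta> b $ 2) then w else act Y w)"
proof -
  have ends_ab: "a \<in> {a..b}" "b \<in> {a..b}" using ab by auto
  have sgnm: "sgn (tmap (\<delta> s) $ 2) = sgn (\<delta> s $ 2) * sgn (esph (\<delta> s))" if "s \<in> {a..b}" for s
    using sgn_tmap_nth2 S2 that by blast
  have ne: "\<delta> a $ 2 \<noteq> 0" "\<delta> b $ 2 \<noteq> 0" "esph (\<delta> a) \<noteq> 0" "esph (\<delta> b) \<noteq> 0"
    using ends sgnm[OF ends_ab(1)] sgnm[OF ends_ab(2)] by (auto simp: sgn_eq_0_iff)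
  have c2: "continuous_on {a..b} (\<lambda>s. \<delta> s $ 2)" using cont by (intro continuous_intros)
  have zero: "\<exists>c. X = Mid c \<and> sg c * \<delta> s $ 1 > 0" if "s \<in> {a..b}" "esph (\<delta> s) = 0" for s
    using image_in_arc(1)[OF S2 dom] that by blast
  have bulb: "(\<forall>s\<in>{a..b}. esph (\<delta> s) < 0 \<and> sg c * \<delta> s $ 1 > 0) \<or> (\<forall>s\<in>{a..b}. \<not> (esph (\<delta> s) < 0 \<and> sg c * \<delta> s $ 1 > 0))"
    if "X \<noteq> Mid c" for c
  proof (rule bulb_const[OF ab cont S2])
    fix s assume s: "s \<in> {a..b}" "esph (\<delta> s) = 0"
    obtain c' where c': "X = Mid c'" "sg c' * \<delta> s $ 1 > 0" using zero[OF s] by blast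
    then have "c' \<noteq> c" using that by blast
    then show "\<not> 0 < sg c * \<delta> s $ 1" using c'(2) by (auto simp: sg_def split: if_splits)
  qed
  note result = that[OF _ ne(1,2)]
  show ?thesis
  proof (cases "\<exists>c. X \<noteq> Mid c \<and> sheet (\<delta> a) = Bulb c")
    case True
    then obtain c where c: "X \<noteq> Mid c" "sheet (\<delta> a) = Bulb c" by blast
    then have all: "esph (\<delta> s) < 0 \<and> sg c * \<delta> s $ 1 > 0" if "s \<in> {a..b}" for s
      using bulb[OF c(1)] sheet_Bulb_iff[OF S2[OF ends_ab(1)] ne(3)] ends_ab(1) that by blast
    have sh: "sheet (\<delta> b) = Bulb c"
      using all[OF ends_ab(2)] sheet_Bulb_iff[OF S2[OF ends_ab(2)] ne(4)] by blast
    have same: "sgn (tmap (\<delta> a) $ 2) = sgn (tmap (\<delta> b) $ 2) \<longleftrightarrow> sgn (\<delta> a $ 2) = sgn (\<delta> b $ 2)"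
      using sgnm[OF ends_ab(1)] sgnm[OF ends_ab(2)] all[OF ends_ab(1)] all[OF ends_ab(2)] by (auto simp: sgn_minus)
    have actX: "act X (Bulb c # w) = Bulb c # act (Mid c) w" for w using c(1) by (cases X) auto
    show ?thesis
    proof (rule result[of "Mid c"])
      fix s assume s: "s \<in> {a..b}"
      have "\<delta> s \<in> arcset (Mid c)" if "\<delta> s $ 2 = 0"
      proof -
        have "\<delta> s \<in> arcset (Mid (\<delta> s $ 1 > 0))" using image_in_arc(3)[OF S2 dom] s that all[OF s] by force
        moreover have "(\<delta> s $ 1 > 0) = c" using all[OF s] by (auto simp: sg_def split: if_splits)
        ultimately show ?thesis by simp
      qed
      then show "\<delta> s \<in> adom (Mid c)" using S2[OF s] by (auto simp: adom_def)
    qed (simp add: c(2) sh same actX)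
  next
    case False
    show ?thesis
    proof (cases X)
      case (Mid d)
      \<comment> \<open>The opposite bulb is excluded, so the lift moves between the outside and
        bulb d only. It meets no real arc, and a change of side of the image amounts to a change of
        sheet.\<close>
      have nb: "\<not> (esph (\<delta> s) < 0 \<and> sg (\<not> d) * \<delta> s $ 1 > 0)" if "s \<in> {a..b}" for s
        using bulb[of "\<not> d"] False Mid sheet_Bulb_iff[OF S2[OF ends_ab(1)] ne(3), of "\<not> d"] ends_ab(1) that by force
      have off: "\<delta> s $ 2 \<noteq> 0" if s: "s \<in> {a..b}" for s
      proof
        assume 0: "\<delta> s $ 2 = 0"
        have "\<not> esph (\<delta> s) > 0" using image_in_arc(2)[OF S2 dom 0] s Mid by blast
        then have "\<delta> s \<in> arcset (Mid (\<delta> s $ 1 > 0))" "esph (\<delta> s) < 0" "X \<noteq> Mid (\<delta> s $ 1 > 0)"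
          using image_in_arc(3)[OF S2 dom 0] s by blast+
        then have "sg (\<not> d) * \<delta> s $ 1 > 0" using Mid by (cases d) (auto simp: arcset_def sg_def)
        then show False using nb[OF s] \<open>esph (\<delta> s) < 0\<close> by blast
      qed
      have same: "sgn (\<delta> a $ 2) = sgn (\<delta> b $ 2)" by (rule same_sign_off_zero[OF ab c2 off])
      have sh: "sheet (\<delta> s) = (if esph (\<delta> s) > 0 then Outer else Bulb d)" if "s \<in> {a..b}" "esph (\<delta> s) \<noteq> 0" for s
        using nb[OF that(1)] sheet_Bulb_iff[OF S2[OF that(1)] that(2), of "\<not> d"] by (cases "sheet (\<delta> s)") (auto simp: sheet_def split: if_splits)
      have "sgn (tmap (\<delta> a) $ 2) = sgn (tmap (\<delta> b) $ 2) \<longleftrightarrow> sgn (esph (\<delta> a)) = sgn (esph (\<delta> b))"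
        using sgnm[OF ends_ab(1)] sgnm[OF ends_ab(2)] same ne by (auto simp: sgn_eq_0_iff)
      also have "\<dots> \<longleftrightarrow> (esph (\<delta> a) > 0 \<longleftrightarrow> esph (\<delta> b) > 0)" using ne by (auto simp: sgn_if)
      finally have iff: "sgn (tmap (\<delta> a) $ 2) = sgn (tmap (\<delta> b) $ 2) \<longleftrightarrow> (esph (\<delta> a) > 0 \<longleftrightarrow> esph (\<delta> b) > 0)" .
      show ?thesis
      proof (rule result[of X])
        show "\<delta> s \<in> adom X" if "s \<in> {a..b}" for s using S2[OF that] off[OF that] by (simp add: adom_def)
      qed (auto simp: same iff sh[OF ends_ab(1) ne(3)] sh[OF ends_ab(2) ne(4)] Mid)
    next
      case (Pole d)
      have nz: "esph (\<delta> s) \<noteq> 0" if "s \<in> {a..b}" for s using zero[OF that] Pole by blast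
      have shO: "sheet (\<delta> a) = Outer" using False Pole by (cases "sheet (\<delta> a)") auto
      have pos: "esph (\<delta> s) > 0" if s: "s \<in> {a..b}" for s
      proof (rule ccontr)
        assume "\<not> esph (\<delta> s) > 0"
        then have "sheet (\<delta> s) = Bulb (\<delta> s $ 1 > 0)" by (simp add: sheet_def)
        then have "esph (\<delta> s) < 0 \<and> sg (\<delta> s $ 1 > 0) * \<delta> s $ 1 > 0" using sheet_Bulb_iff[OF S2[OF s] nz[OF s]] by blast
        then have "esph (\<delta> a) < 0" using bulb[of "\<delta> s $ 1 > 0"] s ends_ab(1) Pole by blast
        then show False using shO by (simp add: sheet_def split: if_splits)
      qed
      show ?thesis
      proof (rule result[of X])
        fix s assume s: "s \<in> {a..b}"
        show "\<delta> s \<in> adom X" using image_in_arc(2)[OF S2 dom _ pos[OF s]] s S2[OF s] by (auto simp: adom_def)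
      qed (use pos ends_ab sgnm[OF ends_ab(1)] sgnm[OF ends_ab(2)] in \<open>simp add: sheet_def Pole\<close>)
    qed
  qed
qed

text \<open>Induction on the level: \<open>lift_step\<close> peels off the first letter, replaces
  the path by its lift through one copy of \<open>tmap\<close>, and supplies the arc for the
  remaining word, in step with the recursion of \<open>act\<close>.\<close>

lemma lift_code:
  fixes a b :: real
  assumes "a \<le> b" "continuous_on {a..b} \<delta>" "\<And>s. s \<in> {a..b} \<Longrightarrow> \<delta> s \<in> S2"
    and "\<And>s. s \<in> {a..b} \<Longrightarrow> (tmap ^^ n) (\<delta> s) \<in> adom X"
    and "(tmap ^^ n) (\<delta> a) $ 2 \<noteq> 0" "(tmap ^^ n) (\<delta> b) $ 2 \<noteq> 0"
  shows "code n (\<delta> b) = (if sgn ((tmap ^^ n) (\<delta> a) $ 2) = sgn ((tmap ^^ n) (\<delta> b) $ 2) then code n (\<delta> a) else act X (code n (\<delta> a)))"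
  using assms(4-6)
proof (induction n arbitrary: X)
  case (Suc n)
  define \<epsilon> where "\<epsilon> s = (tmap ^^ n) (\<delta> s)" for s
  have ce: "continuous_on {a..b} \<epsilon>" unfolding \<epsilon>_def
    by (rule continuous_on_compose2[OF continuous_on_funpow_tmap assms(2)]) (use assms(3) in auto)
  obtain Y where Y: "\<And>s. s \<in> {a..b} \<Longrightarrow> \<epsilon> s \<in> adom Y" "\<epsilon> a $ 2 \<noteq> 0" "\<epsilon> b $ 2 \<noteq> 0"
    "\<And>w. (if sgn (tmap (\<epsilon> a) $ 2) = sgn (tmap (\<epsilon> b) $ 2) then sheet (\<epsilon> a) # w else act X (sheet (\<epsilon> a) # w)) =
      sheet (\<epsilon> b) # (if sgn (\<epsilon> a $ 2) = sgn (\<epsilon> b $ 2) then w else act Y w)"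
    by (rule lift_step[OF assms(1) ce, of X]) (use Suc.prems assms(3) funpow_tmap_S2 in \<open>auto simp: \<epsilon>_def\<close>)
  have "code n (\<delta> b) = (if sgn (\<epsilon> a $ 2) = sgn (\<epsilon> b $ 2) then code n (\<delta> a) else act Y (code n (\<delta> a)))"
    using Suc.IH[of Y] Y(1-3) by (simp add: \<epsilon>_def)
  then have "code (Suc n) (\<delta> b) = sheet (\<epsilon> b) # (if sgn (\<epsilon> a $ 2) = sgn (\<epsilon> b $ 2) then code n (\<delta> a) else act Y (code n (\<delta> a)))"
    by (simp only: code.simps \<epsilon>_def)
  then show ?case using Y(4)[of "code n (\<delta> a)"] by (simp only: code.simps \<epsilon>_def funpow.simps comp_apply)
qed simp

section \<open>A free monoid in the iterated monodromy group\<close>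

text \<open>Behaves like a binary adding machine with digits \<open>Outer\<close> and
  \<open>Bulb b\<close>: \<open>Outer # w\<close> goes to \<open>Bulb b # act (Mid b) w\<close>, and
  a second application gives \<open>Outer # odometer b w\<close>. Words that start with the other
  bulb are fixed.\<close>

definition odometer :: "bool \<Rightarrow> sheet list \<Rightarrow> sheet list" where
  "odometer b = act (Pole True) \<circ> act (Mid b)"

text \<open>The head of the list acts first, so a common head can be cancelled by surjectivity of
  one odometer.\<close>

fun fpos :: "bool list \<Rightarrow> sheet list \<Rightarrow> sheet list" where
  "fpos [] = id"
| "fpos (b # bs) = fpos bs \<circ> odometer b"

text \<open>The first letter of the sequence and the section at \<^const>\<open>Outer\<close> of a positive word: from the
  state \<^term>\<open>Some b\<close> only the letter \<^term>\<open>b\<close> leads back, and it leaves the letter \<^term>\<open>b\<close>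
  in the section.\<close>
fun run :: "bool option \<Rightarrow> bool list \<Rightarrow> bool option \<times> bool list" where
  "run s [] = (s, [])"
| "run None (b # bs) = run (Some b) bs"
| "run (Some b) (c # bs) = (if c = b then map_prod id ((#) b) (run None bs) else run (Some b) bs)"

definition result :: "bool option \<times> bool list \<Rightarrow> sheet list \<Rightarrow> sheet list" where
  "result r w = (case r of (None, e) \<Rightarrow> Outer # fpos e w | (Some b, e) \<Rightarrow> Bulb b # act (Mid b) (fpos e w))"

lemma fpos_result:
  "fpos u (result (s, []) w) = result (run s u) w"
proof (induction s u arbitrary: w rule: run.induct)
  case (2 b bs)
  then show ?case by (simp add: result_def odometer_def)
next
  case (3 b c bs)
  show ?case
  proof (cases "c = b")
    case True
    have "result (map_prod id ((#) b) r) w = result r (odometer b w)" for r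
      by (cases r; cases "fst r") (auto simp: result_def)
    moreover have "fpos (c # bs) (result (Some b, []) w) = fpos bs (result (None, []) (odometer b w))"
      using True by (simp add: result_def odometer_def)
    ultimately show ?thesis using 3(1)[OF True] True by simp
  next
    case False
    then have "odometer c (result (Some b, []) w) = result (Some b, []) w"
      by (simp add: result_def odometer_def)
    then show ?thesis using 3(2)[OF False] False by simp
  qed
qed simp

text \<open>Each letter of the section costs two letters of the word, one to leave
  \<open>Outer\<close> and one to return. Starting inside a bulb the first departure is already paid
  for, hence the extra 1.\<close>

lemma length_run: "2 * length (snd (run s u)) \<le> length u + (if s = None then 0 else 1)"
  by (induction s u rule: run.induct) auto

text \<open>The letter b with which a word leaves \<open>Outer\<close> stays visible: as the head of
  the section if the orbit returns, and in the final state otherwise.\<close>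

lemma run_Some: "snd (run (Some b) u) = [] \<and> fst (run (Some b) u) = Some b \<or> snd (run (Some b) u) \<noteq> [] \<and> hd (snd (run (Some b) u)) = b"
  by (induction u) auto

lemma odometer_surj: "surj (odometer b)"
  by (rule surjI[of _ "act (Mid b) \<circ> act (Pole True)"]) (simp add: odometer_def)

lemma result_inj:
  assumes "result (s, e) = result (s', e')" shows "s = s' \<and> fpos e = fpos e'"
proof
  have *: "result (s, e) w = result (s', e') w" for w using assms by simp
  show s: "s = s'" using *[of "[]"] by (auto simp: result_def split: option.splits)
  show "fpos e = fpos e'"
  proof
    fix w
    have "act (Mid b) (fpos e w) = act (Mid b) (fpos e' w) \<Longrightarrow> fpos e w = fpos e' w" for b by (metis act_act)
    then show "fpos e w = fpos e' w" using *[of w] s by (cases s) (auto simp: result_def)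
  qed
qed

text \<open>Equal maps agree on words that start with \<open>Outer\<close>, so their final states
  and the maps of their sections agree. The sections are at most half as long, hence equal by
  induction. State and section determine the first letter, which is then cancelled.\<close>

lemma fpos_inj: "fpos u = fpos v \<Longrightarrow> u = v"
proof (induction "length u + length v" arbitrary: u v rule: less_induct)
  case less
  have res: "result (run None u) = result (run None v)"
  proof
    fix w
    show "result (run None u) w = result (run None v) w"
      using fpos_result[of u None w] fpos_result[of v None w] less.prems by simp
  qed
  obtain s e where u: "run None u = (s, e)" by fastforce
  obtain s' e' where v: "run None v = (s', e')" by fastforce
  have s: "s = s'" and "fpos e = fpos e'" using result_inj[of s e s' e'] res unfolding u v by simp_all
  have ee: "e = e'" if "u \<noteq> [] \<or> v \<noteq> []"
  proof (rule less.hyps)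
    show "length e + length e' < length u + length v"
      using length_run[of None u] length_run[of None v] u v that by (cases u; cases v) auto
  qed fact
  show ?case
  proof (cases u)
    case Nil
    show ?thesis
    proof (cases v)
      case (Cons c v')
      then show ?thesis using ee run_Some[of c v'] Nil u v s by auto
    qed (use Nil in simp)
  next
    case (Cons b u')
    show ?thesis
    proof (cases v)
      case Nil
      then show ?thesis using ee run_Some[of b u'] Cons u v s by auto
    next
      case v': (Cons c v')
      have bc: "b = c"
        using ee run_Some[of b u'] run_Some[of c v'] Cons v' u v s by auto
      have "fpos u' = fpos v'"
      proof
        fix w
        obtain w' where "w = odometer b w'" using odometer_surj[of b] by (metis surjD)
        then show "fpos u' w = fpos v' w" using fun_cong[OF less.prems, of w'] by (simp add: Cons v' bc)
      qed
      then show ?thesis using less.hyps[of u' v'] Cons v' bc by simp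
    qed
  qed
qed

section \<open>Growth of the iterated monodromy group\<close>

lemma sheet_base: "sheet base = Outer"
  by (simp add: sheet_def base_def esph_lower twist_unit efun_def)

lemma sheet_root_sheet: "sheet (stereo_inv (sheet_root b)) = Bulb b"
proof -
  have "esph (stereo_inv (sheet_root b)) = - 6"
    by (simp add: esph_lower twist_unit efun_def cmod_sheet_root) (simp add: sheet_root_def power_divide)
  moreover have "stereo_inv (sheet_root b) $ 1 > 0 \<longleftrightarrow> b"
    by (simp add: cmod_sheet_root) (simp add: sheet_root_def)
  ultimately show ?thesis by (simp add: sheet_def)
qed

text \<open>Along the chord the second coordinate keeps its sign, so the chord avoids 0 and can be
  projected radially to the sphere.\<close>

lemma hemisphere_path:
  assumes "u \<in> S2" "v \<in> S2" "u $ 2 * v $ 2 > 0"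
  shows "\<exists>\<gamma>. path \<gamma> \<and> path_image \<gamma> \<subseteq> {x \<in> S2. x $ 2 \<noteq> 0} \<and> pathstart \<gamma> = u \<and> pathfinish \<gamma> = v"
proof -
  define k where "k s = (1 - s) *\<^sub>R u + s *\<^sub>R v" for s :: real
  have k2: "k s $ 2 \<noteq> 0" if s: "s \<in> {0..1}" for s
  proof
    assume "k s $ 2 = 0"
    then have "u $ 2 * ((1 - s) * u $ 2 + s * v $ 2) = 0" by (simp add: k_def)
    then have e: "(1 - s) * (u $ 2)^2 + s * (u $ 2 * v $ 2) = 0" by (simp add: algebra_simps power2_eq_square)
    have u2: "(u $ 2)^2 > 0" using assms(3) by auto
    have "(1 - s) * (u $ 2)^2 \<ge> 0" "s * (u $ 2 * v $ 2) \<ge> 0" using s assms(3) by auto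
    then have "(1 - s) * (u $ 2)^2 = 0" "s * (u $ 2 * v $ 2) = 0" using e by linarith+
    then show False using u2 assms(3) by auto
  qed
  have k0: "k s \<noteq> 0" if "s \<in> {0..1}" for s using k2[OF that] by auto
  have n: "norm u = 1" "norm v = 1" using assms by (auto simp: S2_def)
  show ?thesis
  proof (intro exI[of _ "\<lambda>s. (1 / norm (k s)) *\<^sub>R k s"] conjI)
    show "path (\<lambda>s. (1 / norm (k s)) *\<^sub>R k s)"
      unfolding path_def using k0 by (intro continuous_intros) (auto simp: k_def intro!: continuous_intros)
    show "path_image (\<lambda>s. (1 / norm (k s)) *\<^sub>R k s) \<subseteq> {x \<in> S2. x $ 2 \<noteq> 0}"
      using k0 k2 by (auto simp: path_image_def S2_def)
  qed (auto simp: pathstart_def pathfinish_def k_def n)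
qed

definition arc_mid :: "arc \<Rightarrow> real^3" where
  "arc_mid X = (case X of Mid b \<Rightarrow> vector [sg b, 0, 0] | Pole b \<Rightarrow> vector [0, 0, sg b])"

text \<open>Great semicircle from \<open>base\<close> to its antipode that crosses the real circle
  once, in the middle of the arc.\<close>

definition arc_path :: "arc \<Rightarrow> real \<Rightarrow> real^3" where
  "arc_path X s = cos (pi * s) *\<^sub>R base + sin (pi * s) *\<^sub>R arc_mid X"

lemma arc_path:
  shows "path (arc_path X)" "path_image (arc_path X) \<subseteq> adom X" "pathstart (arc_path X) = base" "pathfinish (arc_path X) = - base"
proof -
  show "path (arc_path X)" unfolding path_def arc_path_def by (intro continuous_intros)
  show "pathstart (arc_path X) = base" "pathfinish (arc_path X) = - base"
    by (simp_all add: pathstart_def pathfinish_def arc_path_def)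
  have sq: "sg b * sg b = 1" for b by (simp add: sg_def)
  show "path_image (arc_path X) \<subseteq> adom X"
  proof
    fix x assume "x \<in> path_image (arc_path X)"
    then obtain s where s: "s \<in> {0..1}" "x = arc_path X s" by (auto simp: path_image_def)
    have comp: "x $ 2 = cos (pi * s)" "x $ 1 = (case X of Mid b \<Rightarrow> sin (pi * s) * sg b | Pole b \<Rightarrow> 0)"
      "x $ 3 = (case X of Mid b \<Rightarrow> 0 | Pole b \<Rightarrow> sin (pi * s) * sg b)"
      by (auto simp: s(2) arc_path_def arc_mid_def split: arc.splits)
    have "x \<in> S2"
      using sin_cos_squared_add[of "pi * s"] sq by (cases X) (auto simp: S2_iff comp power_mult_distrib power2_eq_square[of "sg _"])
    moreover have "x \<in> arcset X" if "x $ 2 = 0"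
    proof -
      have "sin (pi * s) \<ge> 0" using s(1) by (intro sin_ge_zero) (auto simp: mult_left_le)
      moreover have "(sin (pi * s))^2 = 1" using that sin_cos_squared_add[of "pi * s"] by (simp add: comp)
      ultimately have "sin (pi * s) = 1" by (simp add: power2_eq_1_iff)
      then show ?thesis using that comp eta_pos eta_less_1 sq by (cases X) (auto simp: arcset_def sg_def)
    qed
    ultimately show "x \<in> adom X" by (auto simp: adom_def)
  qed
qed

lemma path_in_adom:
  assumes "u \<in> S2" "u $ 2 \<noteq> 0"
  obtains \<gamma> where "path \<gamma>" "path_image \<gamma> \<subseteq> adom X" "pathstart \<gamma> = base" "pathfinish \<gamma> = u"
proof (cases "u $ 2 > 0")
  case True
  then show ?thesis using hemisphere_path[of base u] assms that by (fastforce simp: adom_def)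
next
  case False
  have "- base \<in> S2" by (simp add: S2_iff)
  then obtain \<gamma> where g: "path \<gamma>" "path_image \<gamma> \<subseteq> {x \<in> S2. x $ 2 \<noteq> 0}" "pathstart \<gamma> = - base" "pathfinish \<gamma> = u"
    using hemisphere_path[of "- base" u] assms False by auto
  show ?thesis
  proof (rule that[of "arc_path X +++ \<gamma>"])
    show "path_image (arc_path X +++ \<gamma>) \<subseteq> adom X"
      using g(2) arc_path(2)[of X] by (intro subset_path_image_join) (auto simp: adom_def)
  qed (use g arc_path[of X] in auto)
qed

section \<open>Itineraries as coordinates on the levels of the tree\<close>

text \<open>A path from \<open>base\<close> to u that crosses at most the arc
  \<open>Pole True\<close> is lifted from each of the three explicit preimages of
  \<open>base\<close>. On words of length one \<open>act (Pole True)\<close> is the identity, so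
  each lift ends in the sheet where it began.\<close>

lemma sheet_preimage_exists:
  assumes "u \<in> S2" "u $ 2 \<noteq> 0"
  shows "\<exists>x\<in>S2. tmap x = u \<and> sheet x = \<sigma>"
proof -
  obtain r where r: "r \<in> S2" "tmap r = base" "sheet r = \<sigma>"
  proof (cases \<sigma>)
    case Outer
    then show ?thesis using that[of base] by (simp add: tmap_base sheet_base)
  next
    case (Bulb b)
    then show ?thesis using that[of "stereo_inv (sheet_root b)"] by (simp add: tmap_sheet_root sheet_root_sheet)
  qed
  obtain \<gamma> where g: "path \<gamma>" "path_image \<gamma> \<subseteq> adom (Pole True)" "pathstart \<gamma> = base" "pathfinish \<gamma> = u"
    using path_in_adom assms by blast
  have "path_image \<gamma> \<subseteq> S2 - crit4" using g(2) adom_disjoint_crit4 by (auto simp: adom_def)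
  then obtain \<delta> where d: "path \<delta>" "path_image \<delta> \<subseteq> S2 - crit4" "pathstart \<delta> = r" "\<And>s. s \<in> {0..1} \<Longrightarrow> (tmap ^^ 1) (\<delta> s) = \<gamma> s"
    using path_lift_tmap[of \<gamma> r 1] g(1,3) r by auto
  have dS: "\<delta> s \<in> S2" if "s \<in> {0..1}" for s using d(2) that unfolding path_image_def by blast
  have e: "(tmap ^^ 1) (\<delta> 0) = base" "(tmap ^^ 1) (\<delta> 1) = u"
    using d(4)[of 0] d(4)[of 1] g(3,4) by (auto simp: pathstart_def pathfinish_def)
  have "code 1 (\<delta> 1) = (if sgn ((tmap ^^ 1) (\<delta> 0) $ 2) = sgn ((tmap ^^ 1) (\<delta> 1) $ 2) then code 1 (\<delta> 0) else act (Pole True) (code 1 (\<delta> 0)))"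
  proof (rule lift_code)
    show "continuous_on {0..1} \<delta>" using d(1) by (simp add: path_def)
    show "(tmap ^^ 1) (\<delta> s) \<in> adom (Pole True)" if "s \<in> {0..1}" for s
      using d(4)[OF that] g(2) that by (auto simp: path_image_def)
  qed (use dS e assms in auto)
  moreover have "act (Pole True) [\<sigma>] = [\<sigma>]" by (cases \<sigma>) auto
  ultimately have "sheet (\<delta> 1) = \<sigma>" using r(3) d(3) by (auto simp: pathstart_def split: if_splits)
  then show ?thesis using e(2) dS[of 1] by auto
qed

text \<open>Each of the three sheets contributes a preimage and a fibre has at most three points, so
  no sheet can contribute two.\<close>

lemma sheet_preimage_unique:
  assumes "u \<in> S2" "u $ 2 \<noteq> 0" "x \<in> S2" "y \<in> S2" "tmap x = u" "tmap y = u" "sheet x = sheet y"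
  shows "x = y"
proof -
  obtain r where r: "\<And>\<sigma>. r \<sigma> \<in> S2 \<and> tmap (r \<sigma>) = u \<and> sheet (r \<sigma>) = \<sigma>"
    using sheet_preimage_exists[OF assms(1,2)] by metis
  define Z where "Z = r ` {Outer, Bulb True, Bulb False}"
  have "inj_on r {Outer, Bulb True, Bulb False}" using r by (metis inj_onI)
  then have "card Z = 3" unfolding Z_def by (subst card_image) auto
  moreover have "Z \<subseteq> S2 \<inter> tmap -` {u}" using r by (auto simp: Z_def)
  ultimately have "Z = S2 \<inter> tmap -` {u}" using card_seteq[OF tmap_fiber(1)] tmap_fiber(2) assms(1) by metis
  then have "x \<in> Z" "y \<in> Z" using assms by auto
  then show ?thesis using r assms(7) unfolding Z_def by (metis imageE)
qed

lemma tmap_nth2_nz: "x \<in> S2 \<Longrightarrow> tmap x $ 2 \<noteq> 0 \<Longrightarrow> x $ 2 \<noteq> 0"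
  using sgn_tmap_nth2[of x] by (auto simp: sgn_eq_0_iff)

lemma code_inj:
  assumes "p \<in> S2" "q \<in> S2" "(tmap ^^ n) p = (tmap ^^ n) q" "(tmap ^^ n) p $ 2 \<noteq> 0" "code n p = code n q"
  shows "p = q"
  using assms(3-5)
proof (induction n)
  case (Suc n)
  have "(tmap ^^ n) p = (tmap ^^ n) q"
    by (rule sheet_preimage_unique[of "(tmap ^^ Suc n) p"]) (use Suc.prems assms(1,2) funpow_tmap_S2 in auto)
  moreover have "(tmap ^^ n) p $ 2 \<noteq> 0"
    using tmap_nth2_nz[of "(tmap ^^ n) p"] Suc.prems(2) funpow_tmap_S2 assms(1) by simp
  ultimately show ?case using Suc by simp
qed simp

lemma code_surj:
  assumes "u \<in> S2" "u $ 2 \<noteq> 0" "length w = n"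
  shows "\<exists>p\<in>S2. (tmap ^^ n) p = u \<and> code n p = w"
  using assms
proof (induction n arbitrary: u w)
  case (Suc n)
  obtain \<sigma> w' where w: "w = \<sigma> # w'" "length w' = n" using Suc.prems(3) by (cases w) auto
  obtain x where x: "x \<in> S2" "tmap x = u" "sheet x = \<sigma>" using sheet_preimage_exists Suc.prems by blast
  then obtain p where "p \<in> S2" "(tmap ^^ n) p = x" "code n p = w'"
    using Suc.IH[of x w'] tmap_nth2_nz Suc.prems(2) w(2) by blast
  then show ?case using x w by (intro bexI[of _ p]) auto
qed auto

section \<open>Transport of itineraries along paths\<close>

text \<open>\<open>transport \<gamma> t F\<close>: lifting the restriction of \<open>\<gamma>\<close> to \<open>[0,t]\<close> acts on itineraries by \<open>F\<close>.\<close>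
definition transport :: "(real \<Rightarrow> real^3) \<Rightarrow> real \<Rightarrow> (sheet list \<Rightarrow> sheet list) \<Rightarrow> bool" where
  "transport \<gamma> t F \<longleftrightarrow> (\<forall>n \<delta>. continuous_on {0..t} \<delta> \<longrightarrow> \<delta> ` {0..t} \<subseteq> S2 \<longrightarrow>
     (\<forall>s\<in>{0..t}. (tmap ^^ n) (\<delta> s) = \<gamma> s) \<longrightarrow> code n (\<delta> t) = F (code n (\<delta> 0)))"

lemma transport_extend:
  assumes "transport \<gamma> a F" "0 \<le> a" "a \<le> b" "\<gamma> a $ 2 \<noteq> 0" "\<gamma> b $ 2 \<noteq> 0" "\<gamma> ` {a..b} \<subseteq> adom X"
  shows "transport \<gamma> b (if sgn (\<gamma> a $ 2) = sgn (\<gamma> b $ 2) then F else act X \<circ> F)"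
  unfolding transport_def
proof (intro allI impI)
  fix n \<delta> assume d: "continuous_on {0..b} \<delta>" "\<delta> ` {0..b} \<subseteq> S2" "\<forall>s\<in>{0..b}. (tmap ^^ n) (\<delta> s) = \<gamma> s"
  have "continuous_on {0..a} \<delta>" using d(1) assms(2,3) by (auto intro: continuous_on_subset)
  moreover have "\<delta> ` {0..a} \<subseteq> S2" using d(2) assms(2,3) by auto
  ultimately have 1: "code n (\<delta> a) = F (code n (\<delta> 0))" using assms(1,3) d(3) unfolding transport_def by auto
  have ab: "(tmap ^^ n) (\<delta> a) = \<gamma> a" "(tmap ^^ n) (\<delta> b) = \<gamma> b" using d(3) assms(2,3) by auto
  have "code n (\<delta> b) = (if sgn ((tmap ^^ n) (\<delta> a) $ 2) = sgn ((tmap ^^ n) (\<delta> b) $ 2) then code n (\<delta> a) else act X (code n (\<delta> a)))"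
  proof (rule lift_code[OF assms(3)])
    show "continuous_on {a..b} \<delta>" using d(1) assms(2) by (auto intro: continuous_on_subset)
  qed (use d assms ab in auto)
  then show "code n (\<delta> b) = (if sgn (\<gamma> a $ 2) = sgn (\<gamma> b $ 2) then F else act X \<circ> F) (code n (\<delta> 0))"
    using 1 ab by auto
qed

lemma transport_join:
  assumes "transport \<gamma>1 1 F" "transport \<gamma>2 1 G" "pathfinish \<gamma>1 = pathstart \<gamma>2"
  shows "transport (\<gamma>1 +++ \<gamma>2) 1 (G \<circ> F)"
  unfolding transport_def
proof (intro allI impI)
  fix n \<delta> assume d: "continuous_on {0..1} \<delta>" "\<delta> ` {0..1} \<subseteq> S2" "\<forall>s\<in>{0..1}. (tmap ^^ n) (\<delta> s) = (\<gamma>1 +++ \<gamma>2) s"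
  have "code n ((\<lambda>s. \<delta> (s / 2)) 1) = F (code n ((\<lambda>s. \<delta> (s / 2)) 0))"
  proof (rule assms(1)[unfolded transport_def, rule_format])
    show "continuous_on {0..1} (\<lambda>s. \<delta> (s / 2))" by (rule continuous_on_compose2[OF d(1)]) (auto intro!: continuous_intros)
    show "(\<lambda>s. \<delta> (s / 2)) ` {0..1} \<subseteq> S2" using d(2) by auto
    show "(tmap ^^ n) (\<delta> (s / 2)) = \<gamma>1 s" if "s \<in> {0..1}" for s using d(3)[rule_format, of "s / 2"] that by (auto simp: joinpaths_def)
  qed
  moreover have "code n ((\<lambda>s. \<delta> ((s + 1) / 2)) 1) = G (code n ((\<lambda>s. \<delta> ((s + 1) / 2)) 0))"
  proof (rule assms(2)[unfolded transport_def, rule_format])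
    show "continuous_on {0..1} (\<lambda>s. \<delta> ((s + 1) / 2))" by (rule continuous_on_compose2[OF d(1)]) (auto intro!: continuous_intros)
    show "(\<lambda>s. \<delta> ((s + 1) / 2)) ` {0..1} \<subseteq> S2" using d(2) by auto
    show "(tmap ^^ n) (\<delta> ((s + 1) / 2)) = \<gamma>2 s" if s: "s \<in> {0..1}" for s
    proof -
      have "2 * ((s + 1) / 2) - 1 = s" by (simp add: field_simps)
      then have "(\<gamma>1 +++ \<gamma>2) ((s + 1) / 2) = \<gamma>2 s"
        using assms(3) s by (cases "s = 0") (simp_all add: joinpaths_def pathstart_def pathfinish_def)
      then show ?thesis using d(3)[rule_format, of "(s + 1) / 2"] s by simp
    qed
  qed
  ultimately show "code n (\<delta> 1) = (G \<circ> F) (code n (\<delta> 0))" by simp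
qed

fun actw :: "arc list \<Rightarrow> sheet list \<Rightarrow> sheet list" where
  "actw [] = id"
| "actw (X # Xs) = act X \<circ> actw Xs"

lemma length_actw [simp]: "length (actw Xs w) = length w"
  by (induction Xs) auto

lemma openin_adom: "openin (top_of_set S2) (adom X)"
proof -
  have "adom X = S2 \<inter> ({x. x $ 2 \<noteq> 0} \<union> (case X of Mid b \<Rightarrow> {x. \<bar>x $ 3\<bar> < eta \<and> sg b * x $ 1 > 0} | Pole b \<Rightarrow> {x. eta < \<bar>x $ 3\<bar> \<and> sg b * x $ 3 > 0}))"
    by (cases X) (auto simp: adom_def arcset_def)
  moreover have "open ({x::real^3. x $ 2 \<noteq> 0} \<union> (case X of Mid b \<Rightarrow> {x. \<bar>x $ 3\<bar> < eta \<and> sg b * x $ 1 > 0} | Pole b \<Rightarrow> {x. eta < \<bar>x $ 3\<bar> \<and> sg b * x $ 3 > 0}))"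
    by (cases X) (auto intro!: open_Un open_Collect_neq open_Collect_conj open_Collect_less continuous_intros)
  ultimately show ?thesis by (simp only: openin_open_Int)
qed

lemma adom_cover: assumes "x \<in> S2 - crit4" shows "\<exists>X. x \<in> adom X"
  using arc_exists[of x] assms by (auto simp: adom_def)

text \<open>The sets \<open>adom X\<close> form an open cover of the sphere without
  \<open>crit4\<close>; N comes from a Lebesgue number of the induced cover of [0, 1].\<close>

lemma path_subdivision:
  assumes "path \<gamma>" "path_image \<gamma> \<subseteq> S2 - crit4"
  shows "\<exists>N>0. \<forall>i<N. \<exists>X. \<gamma> ` {real i / real N..real (Suc i) / real N} \<subseteq> adom X"
proof -
  have cg: "continuous_on {0..1} \<gamma>" using assms(1) by (simp add: path_def)
  have gi: "\<gamma> ` {0..1} \<subseteq> S2 - crit4" using assms(2) by (simp add: path_image_def)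
  have "\<exists>O'. open O' \<and> {0..1} \<inter> \<gamma> -` adom X = {0..1} \<inter> O'" for X
  proof -
    have "openin (top_of_set {0..1}) ({0..1} \<inter> \<gamma> -` adom X)"
      by (rule continuous_openin_preimage[OF cg _ openin_adom]) (use gi in auto)
    then show ?thesis by (auto simp: openin_open)
  qed
  then obtain O' where O': "\<And>X. open (O' X)" "\<And>X. {0..1} \<inter> \<gamma> -` adom X = {0..1} \<inter> O' X" by metis
  have "{0..1} \<subseteq> \<Union> (range O')"
  proof
    fix s :: real assume s: "s \<in> {0..1}"
    then obtain X where "\<gamma> s \<in> adom X" using adom_cover[of "\<gamma> s"] gi by blast
    then have "s \<in> {0..1} \<inter> O' X" using s O'(2)[of X] by blast
    then show "s \<in> \<Union> (range O')" by blast
  qed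
  then obtain e where e: "e > 0" "\<And>x. x \<in> {0..1} \<Longrightarrow> \<exists>G\<in>range O'. ball x e \<subseteq> G"
    using Heine_Borel_lemma[of "{0..1::real}" "range O'"] O'(1) by (metis compact_Icc imageE)
  obtain N where N: "N > 0" "1 / real N < e" using e(1) by (metis nat_approx_posE of_nat_Suc zero_less_Suc)
  have "\<exists>X. \<gamma> ` {real i / real N..real (Suc i) / real N} \<subseteq> adom X" if i: "i < N" for i
  proof -
    have bounds: "0 \<le> real i / real N" "real (Suc i) / real N \<le> 1" using i N by (auto simp: divide_le_eq)
    have step: "real (Suc i) / real N = real i / real N + 1 / real N" by (simp add: add_divide_distrib)
    have x01: "real i / real N \<in> {0..1}" using bounds(1) i N by (simp add: divide_le_eq)
    then obtain X where X: "ball (real i / real N) e \<subseteq> O' X" using e(2) by blast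
    have "\<gamma> s \<in> adom X" if s: "s \<in> {real i / real N..real (Suc i) / real N}" for s
    proof -
      have "s \<in> ball (real i / real N) e" using s N(2) step by (auto simp: dist_real_def)
      moreover have "s \<in> {0..1}" using s bounds by (meson atLeastAtMost_iff order_trans)
      ultimately show ?thesis using X O'(2)[of X] by blast
    qed
    then show ?thesis by blast
  qed
  then show ?thesis using N(1) by blast
qed

text \<open>A division point may lie on the real circle, where no side is defined. Both adjacent
  pieces then lie in the same \<open>adom X\<close>, since arcs are disjoint, and they are merged.
  The parity of the number of crossings records the current side, so a loop yields an even
  word.\<close>

lemma transport_exists:
  assumes "path \<gamma>" "path_image \<gamma> \<subseteq> S2 - crit4" "pathstart \<gamma> = base" "pathfinish \<gamma> = base"
  shows "\<exists>Xs. even (length Xs) \<and> transport \<gamma> 1 (actw Xs)"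
proof -
  obtain N where N: "N > 0" "\<And>i. i < N \<Longrightarrow> \<exists>X. \<gamma> ` {real i / real N..real (Suc i) / real N} \<subseteq> adom X"
    using path_subdivision[OF assms(1,2)] by blast
  define good where "good a \<longleftrightarrow> 0 \<le> a \<and> \<gamma> a $ 2 \<noteq> 0 \<and> (\<exists>Xs. (even (length Xs) \<longleftrightarrow> \<gamma> a $ 2 > 0) \<and> transport \<gamma> a (actw Xs))" for a
  have good_extend: "good b" if ab: "good a" "a \<le> b" "\<gamma> b $ 2 \<noteq> 0" "\<gamma> ` {a..b} \<subseteq> adom X" for a b X
  proof -
    obtain Xs where Xs: "even (length Xs) \<longleftrightarrow> \<gamma> a $ 2 > 0" "transport \<gamma> a (actw Xs)" using ab(1) by (auto simp: good_def)
    have a: "0 \<le> a" "\<gamma> a $ 2 \<noteq> 0" using ab(1) by (auto simp: good_def)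
    note te = transport_extend[OF Xs(2) a(1) ab(2) a(2) ab(3,4)]
    show ?thesis
    proof (cases "sgn (\<gamma> a $ 2) = sgn (\<gamma> b $ 2)")
      case True
      then have "transport \<gamma> b (actw Xs)" "\<gamma> b $ 2 > 0 \<longleftrightarrow> \<gamma> a $ 2 > 0" using te by (auto simp: sgn_if split: if_splits)
      then show ?thesis using Xs ab a by (auto simp: good_def)
    next
      case False
      then have "transport \<gamma> b (actw (X # Xs))" "\<gamma> b $ 2 > 0 \<longleftrightarrow> \<not> \<gamma> a $ 2 > 0" using te a ab(3) by (auto simp: sgn_if split: if_splits)
      moreover have "even (length (X # Xs)) \<longleftrightarrow> \<not> \<gamma> a $ 2 > 0" using Xs(1) by simp
      ultimately show ?thesis using ab a unfolding good_def by (meson order_trans)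
    qed
  qed
  have g0: "\<gamma> 0 = base" "\<gamma> 1 = base" using assms(3,4) by (auto simp: pathstart_def pathfinish_def)
  \<comment> \<open>Invariant: a is a time at which the path is off the real circle and the
    transport is known, and since then the path has stayed in a single
    \<open>adom X\<close>.\<close>
  have "\<exists>a X. a \<le> real i / real N \<and> good a \<and> \<gamma> ` {a..real i / real N} \<subseteq> adom X" if "i \<le> N" for i
    using that
  proof (induction i)
    case 0
    have "good 0" unfolding good_def by (auto simp: g0 transport_def intro!: exI[of _ "[]"])
    then show ?case by (intro exI[of _ 0]) (auto simp: g0 adom_def)
  next
    case (Suc i)
    then obtain a X where a: "a \<le> real i / real N" "good a" "\<gamma> ` {a..real i / real N} \<subseteq> adom X" by auto
    obtain X' where X': "\<gamma> ` {real i / real N..real (Suc i) / real N} \<subseteq> adom X'" using N(2)[of i] Suc.prems by auto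
    have le: "real i / real N \<le> real (Suc i) / real N" by (simp add: divide_right_mono)
    show ?case
    proof (cases "\<gamma> (real i / real N) $ 2 = 0")
      case False
      then have "good (real i / real N)" using good_extend a by blast
      then show ?thesis using X' le by blast
    next
      case True
      have "\<gamma> (real i / real N) \<in> adom X" "\<gamma> (real i / real N) \<in> adom X'" using a X' le by auto
      then have "X = X'" using True arc_unique by (auto simp: adom_def)
      moreover have "{a..real (Suc i) / real N} = {a..real i / real N} \<union> {real i / real N..real (Suc i) / real N}"
        using a(1) le by auto
      ultimately have "\<gamma> ` {a..real (Suc i) / real N} \<subseteq> adom X" using a(3) X' by (simp only: image_Un) blast
      then show ?thesis using a le by (meson order_trans)
    qed
  qed
  from this[of N] obtain a X where "a \<le> 1" "good a" "\<gamma> ` {a..1} \<subseteq> adom X" using N(1) by auto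
  then have "good 1" using good_extend[of a 1 X] g0 by simp
  then show ?thesis by (auto simp: good_def g0)
qed

section \<open>From maps of words to permutations of the tree\<close>

abbreviation tree :: "(nat \<times> (real^3)) set" where
  "tree \<equiv> preimage_tree tmap base"

text \<open>Transfers a length preserving map of words to the tree along the bijection
  \<open>code n\<close> from level n to words of length n. Off the tree it is the identity, in
  agreement with \<open>monodromy\<close>.\<close>

definition realize :: "(sheet list \<Rightarrow> sheet list) \<Rightarrow> nat \<times> (real^3) \<Rightarrow> nat \<times> (real^3)" where
  "realize F = (\<lambda>(n, p). if (n, p) \<in> tree
     then (n, THE q. q \<in> S2 \<and> (tmap ^^ n) q = base \<and> code n q = F (code n p)) else (n, p))"

lemma fiber_point_unique:
  assumes "length w = n"
  shows "\<exists>!q. q \<in> S2 \<and> (tmap ^^ n) q = base \<and> code n q = w"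
proof -
  obtain p where p: "p \<in> S2" "(tmap ^^ n) p = base" "code n p = w"
    using code_surj[of base w n] assms by auto
  show ?thesis
  proof (rule ex1I[of _ p])
    fix q assume q: "q \<in> S2 \<and> (tmap ^^ n) q = base \<and> code n q = w"
    show "q = p" by (rule code_inj[of q p n]) (use p q in simp_all)
  qed (use p in blast)
qed

lemma realize_tree:
  assumes "(n, p) \<in> tree" "length (F (code n p)) = n"
  shows "\<exists>q. realize F (n, p) = (n, q) \<and> (n, q) \<in> tree \<and> code n q = F (code n p) \<and>
    (\<forall>q'. (n, q') \<in> tree \<longrightarrow> code n q' = F (code n p) \<longrightarrow> q' = q)"
proof -
  note ex1 = fiber_point_unique[OF assms(2)]
  define q where "q = (THE q. q \<in> S2 \<and> (tmap ^^ n) q = base \<and> code n q = F (code n p))"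
  have "q \<in> S2 \<and> (tmap ^^ n) q = base \<and> code n q = F (code n p)" unfolding q_def by (rule theI'[OF ex1])
  moreover have "realize F (n, p) = (n, q)" using assms(1) by (simp add: realize_def q_def)
  ultimately show ?thesis using ex1 unfolding preimage_tree_def by (intro exI[of _ q]) blast
qed

lemma realize_comp:
  assumes "\<And>w. length (F w) = length w" "\<And>w. length (G w) = length w"
  shows "realize (F \<circ> G) = realize F \<circ> realize G"
proof
  fix x :: "nat \<times> (real^3)"
  obtain n p where x: "x = (n, p)" by (cases x)
  show "realize (F \<circ> G) x = (realize F \<circ> realize G) x"
  proof (cases "x \<in> tree")
    case False
    then show ?thesis by (simp add: realize_def x)
  next
    case True
    then have np: "(n, p) \<in> tree" using x by simp
    obtain q where q: "realize G (n, p) = (n, q)" "(n, q) \<in> tree" "code n q = G (code n p)"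
      using realize_tree[OF np, of G] assms(2)[of "code n p"] by auto
    obtain r where r: "realize F (n, q) = (n, r)" "(n, r) \<in> tree" "code n r = F (code n q)"
      using realize_tree[OF q(2), of F] assms(1)[of "code n q"] by auto
    obtain r' where r': "realize (F \<circ> G) (n, p) = (n, r')"
      "\<And>q'. (n, q') \<in> tree \<Longrightarrow> code n q' = (F \<circ> G) (code n p) \<Longrightarrow> q' = r'"
      using realize_tree[OF np, of "F \<circ> G"] assms(1)[of "G (code n p)"] assms(2)[of "code n p"] by auto
    have "r = r'" using r'(2)[OF r(2)] r(3) q(3) by simp
    then show ?thesis using q r r' x by simp
  qed
qed

lemma realize_id: "realize id = id"
proof
  fix x :: "nat \<times> (real^3)"
  obtain n p where x: "x = (n, p)" by (cases x)
  show "realize id x = id x"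
  proof (cases "x \<in> tree")
    case True
    then have np: "(n, p) \<in> tree" using x by simp
    obtain q where q: "realize id (n, p) = (n, q)" "\<And>q'. (n, q') \<in> tree \<Longrightarrow> code n q' = id (code n p) \<Longrightarrow> q' = q"
      using realize_tree[OF np, of id] by auto
    then show ?thesis using np x by simp
  qed (simp add: realize_def x)
qed

lemma realize_inj:
  assumes "\<And>w. length (F w) = length w" "\<And>w. length (G w) = length w" "realize F = realize G"
  shows "F = G"
proof
  fix w
  obtain p where p: "p \<in> S2" "(tmap ^^ length w) p = base" "code (length w) p = w"
    using fiber_point_unique[of w "length w"] by auto
  then have np: "(length w, p) \<in> tree" by (simp add: preimage_tree_def)
  obtain q where q: "realize F (length w, p) = (length w, q)" "code (length w) q = F w"
    using realize_tree[OF np, of F] assms(1)[of w] p(3) by auto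
  obtain r where r: "realize G (length w, p) = (length w, r)" "code (length w) r = G w"
    using realize_tree[OF np, of G] assms(2)[of w] p(3) by auto
  show "F w = G w" using q r assms(3) by simp
qed

text \<open>Transport prescribes the itinerary of the endpoint of every lift from p, and an
  itinerary determines a point of the level. The endpoint is thus the same for all lifts, which
  justifies the definite description in \<open>lift_end\<close>.\<close>

lemma monodromy_realize:
  assumes "\<gamma> \<in> loops tmap base" "transport \<gamma> 1 F" "\<And>w. length (F w) = length w"
  shows "monodromy tmap base \<gamma> = realize F"
proof
  fix x :: "nat \<times> (real^3)"
  obtain n p where x: "x = (n, p)" by (cases x)
  have g: "path \<gamma>" "path_image \<gamma> \<subseteq> S2 - crit4" "pathstart \<gamma> = base" "pathfinish \<gamma> = base"
    using assms(1) by (auto simp: loops_def post_tmap)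
  show "monodromy tmap base \<gamma> x = realize F x"
  proof (cases "x \<in> tree")
    case False
    then show ?thesis by (simp add: monodromy_def realize_def x)
  next
    case True
    then have np: "(n, p) \<in> tree" "p \<in> S2" "(tmap ^^ n) p = base" using x by (auto simp: preimage_tree_def)
    obtain q where q: "realize F (n, p) = (n, q)"
      "\<And>q'. (n, q') \<in> tree \<Longrightarrow> code n q' = F (code n p) \<Longrightarrow> q' = q"
      using realize_tree[OF np(1), of F] assms(3)[of "code n p"] by auto
    have end_q: "pathfinish \<delta> = q" if d: "path \<delta>" "path_image \<delta> \<subseteq> S2" "pathstart \<delta> = p" "\<forall>s\<in>{0..1}. (tmap ^^ n) (\<delta> s) = \<gamma> s" for \<delta>
    proof (rule q(2))
      have "code n (\<delta> 1) = F (code n (\<delta> 0))"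
        using assms(2) d unfolding transport_def by (auto simp: path_def path_image_def)
      then show "code n (pathfinish \<delta>) = F (code n p)" using d(3) by (simp add: pathstart_def pathfinish_def)
      have "pathfinish \<delta> \<in> S2" using d(2) pathfinish_in_path_image by blast
      moreover have "(tmap ^^ n) (pathfinish \<delta>) = base" using d(4) g(4) by (simp add: pathfinish_def)
      ultimately show "(n, pathfinish \<delta>) \<in> tree" by (simp add: preimage_tree_def)
    qed
    obtain \<delta> where d: "path \<delta>" "path_image \<delta> \<subseteq> S2 - crit4" "pathstart \<delta> = p" "\<And>s. s \<in> {0..1} \<Longrightarrow> (tmap ^^ n) (\<delta> s) = \<gamma> s"
      using path_lift_tmap[of \<gamma> p n] g np by auto
    have "lift_end tmap n \<gamma> p = q" unfolding lift_end_def
    proof (rule the_equality)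
      have "path_image \<delta> \<subseteq> S2" using d(2) by blast
      then show "\<exists>\<delta>. path \<delta> \<and> path_image \<delta> \<subseteq> S2 \<and> pathstart \<delta> = p \<and> pathfinish \<delta> = q \<and> (\<forall>s\<in>{0..1}. (tmap ^^ n) (\<delta> s) = \<gamma> s)"
        using d end_q[of \<delta>] by blast
    qed (use end_q in blast)
    then show ?thesis using np(1) q(1) x by (simp add: monodromy_def)
  qed
qed

lemma transport_arc_path: "transport (arc_path X) 1 (act X)" "transport (reversepath (arc_path X)) 1 (act X)"
proof -
  have 0: "transport \<gamma> 0 id" for \<gamma> by (simp add: transport_def)
  have e: "arc_path X 0 = base" "arc_path X 1 = - base" by (simp_all add: arc_path_def)
  have im: "arc_path X ` {0..1} \<subseteq> adom X" using arc_path(2)[of X] by (simp add: path_image_def)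
  show "transport (arc_path X) 1 (act X)"
    using transport_extend[OF 0, of 1 "arc_path X" X] im by (simp add: e sgn_minus)
  have im': "reversepath (arc_path X) ` {0..1} \<subseteq> adom X"
    using arc_path(2)[of X] path_image_reversepath[of "arc_path X"] by (simp add: path_image_def)
  show "transport (reversepath (arc_path X)) 1 (act X)"
    using transport_extend[OF 0, of 1 "reversepath (arc_path X)" X] im' by (simp add: reversepath_def e sgn_minus)
qed

text \<open>A single crossing leads from \<open>base\<close> to its antipode; two crossings, out
  through Y and back through X, close up to a loop.\<close>

definition gens :: "(nat \<times> (real^3) \<Rightarrow> nat \<times> (real^3)) set" where
  "gens = (\<lambda>(X, Y). realize (act X \<circ> act Y)) ` UNIV"

definition realized :: "(sheet list \<Rightarrow> sheet list) \<Rightarrow> bool" where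
  "realized F \<longleftrightarrow> (\<exists>\<gamma>\<in>loops tmap base. transport \<gamma> 1 F)"

lemma realized_id: "realized id"
  unfolding realized_def
proof (rule bexI)
  show "transport (\<lambda>_. base) 1 id"
    unfolding transport_def
  proof (intro allI impI)
    fix n and \<delta> :: "real \<Rightarrow> real^3"
    assume d: "continuous_on {0..1} \<delta>" "\<delta> ` {0..1} \<subseteq> S2" "\<forall>s\<in>{0..1}. (tmap ^^ n) (\<delta> s) = base"
    have "code n (\<delta> 1) = (if sgn ((tmap ^^ n) (\<delta> 0) $ 2) = sgn ((tmap ^^ n) (\<delta> 1) $ 2) then code n (\<delta> 0) else act (Pole True) (code n (\<delta> 0)))"
    proof (rule lift_code[where a = 0 and b = 1 and \<delta> = \<delta> and n = n and X = "Pole True"])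
      show "\<delta> s \<in> S2" if "s \<in> {0..1}" for s using d(2) that by blast
      show "(tmap ^^ n) (\<delta> s) \<in> adom (Pole True)" if "s \<in> {0..1}" for s using d(3) that by (simp add: adom_def)
    qed (use d in simp_all)
    then show "code n (\<delta> 1) = id (code n (\<delta> 0))" using d(3) by simp
  qed
  show "(\<lambda>_. base) \<in> loops tmap base"
    using base_notin_crit4 by (auto simp: loops_def post_tmap path_def path_image_def pathstart_def pathfinish_def)
qed

lemma realized_comp: assumes "realized F" "realized G" shows "realized (G \<circ> F)"
proof -
  obtain \<gamma>1 \<gamma>2 where g: "\<gamma>1 \<in> loops tmap base" "transport \<gamma>1 1 F" "\<gamma>2 \<in> loops tmap base" "transport \<gamma>2 1 G"
    using assms unfolding realized_def by blast
  then have "\<gamma>1 +++ \<gamma>2 \<in> loops tmap base"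
    by (auto simp: loops_def path_image_join)
  moreover have "transport (\<gamma>1 +++ \<gamma>2) 1 (G \<circ> F)" using transport_join g by (auto simp: loops_def)
  ultimately show ?thesis unfolding realized_def by blast
qed

lemma realized_act_act: "realized (act X \<circ> act Y)"
  unfolding realized_def
proof (rule bexI)
  show "transport (arc_path Y +++ reversepath (arc_path X)) 1 (act X \<circ> act Y)"
    by (rule transport_join) (use transport_arc_path arc_path in auto)
  have "adom Z \<subseteq> S2 - crit4" for Z using adom_disjoint_crit4[of Z] by (auto simp: adom_def)
  then have "path_image (arc_path Z) \<subseteq> S2 - crit4" for Z using arc_path(2) by blast
  then show "arc_path Y +++ reversepath (arc_path X) \<in> loops tmap base"
    using arc_path[of X] arc_path[of Y] by (simp add: loops_def post_tmap path_image_join)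
qed

lemma realized_actw: "even (length Xs) \<Longrightarrow> realized (actw Xs)"
proof (induction "length Xs" arbitrary: Xs rule: less_induct)
  case less
  show ?case
  proof (cases Xs)
    case (Cons X Xs')
    then obtain Y Ys where Ys: "Xs' = Y # Ys" using less.prems by (cases Xs') auto
    have "realized (actw Ys)" using less Cons Ys by simp
    then have "realized ((act X \<circ> act Y) \<circ> actw Ys)" using realized_comp realized_act_act by blast
    then show ?thesis using Cons Ys by (simp add: comp_assoc)
  qed (simp add: realized_id)
qed

text \<open>Subdividing a loop gives one inclusion; concatenating semicircles that go out and back
  gives the other.\<close>

lemma IMG_eq: "IMG tmap base = realize ` actw ` {Xs. even (length Xs)}"
proof (intro set_eqI iffI)
  fix m assume "m \<in> IMG tmap base"
  then obtain \<gamma> where g: "\<gamma> \<in> loops tmap base" "m = monodromy tmap base \<gamma>" by (auto simp: IMG_def)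
  then obtain Xs where Xs: "even (length Xs)" "transport \<gamma> 1 (actw Xs)"
    using transport_exists[of \<gamma>] by (auto simp: loops_def post_tmap)
  then show "m \<in> realize ` actw ` {Xs. even (length Xs)}"
    using g monodromy_realize[of \<gamma> "actw Xs"] by auto
next
  fix m assume "m \<in> realize ` actw ` {Xs. even (length Xs)}"
  then obtain Xs where Xs: "even (length Xs)" "m = realize (actw Xs)" by blast
  obtain \<gamma> where "\<gamma> \<in> loops tmap base" "transport \<gamma> 1 (actw Xs)"
    using realized_actw[OF Xs(1)] by (auto simp: realized_def)
  then show "m \<in> IMG tmap base"
    using Xs(2) monodromy_realize[of \<gamma> "actw Xs"] unfolding IMG_def by (metis imageI length_actw)
qed

lemma actw_append: "actw (Xs @ Ys) = actw Xs \<circ> actw Ys"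
  by (induction Xs) (auto simp: comp_assoc)

lemma realize_actw_append: "realize (actw (Xs @ Ys)) = realize (actw Xs) \<circ> realize (actw Ys)"
  unfolding actw_append by (rule realize_comp) auto

lemma gens_eq: "gens = (\<lambda>(X, Y). realize (actw [X, Y])) ` UNIV"
  by (simp add: gens_def)

lemma UNIV_arc: "UNIV = {Mid True, Mid False, Pole True, Pole False}"
proof -
  have "X \<in> {Mid True, Mid False, Pole True, Pole False}" for X by (cases X) auto
  then show ?thesis by blast
qed

lemma fin_sym_gen_set_gens: "fin_sym_gen_set (IMG tmap base) gens"
  unfolding fin_sym_gen_set_def
proof (intro conjI ballI)
  have "finite (UNIV :: (arc \<times> arc) set)"
    unfolding UNIV_Times_UNIV[symmetric] UNIV_arc by (intro finite_cartesian_product) auto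
  then show "finite gens" unfolding gens_def by (rule finite_imageI)
  show "gens \<subseteq> IMG tmap base"
  proof
    fix s assume "s \<in> gens"
    then obtain X Y where "s = realize (actw [X, Y])" unfolding gens_eq by auto
    then show "s \<in> IMG tmap base" unfolding IMG_eq by (intro image_eqI[of s realize "actw [X, Y]"] imageI) auto
  qed
  show "inv s \<in> gens" if "s \<in> gens" for s
  proof -
    obtain X Y where s: "s = realize (act X \<circ> act Y)" using \<open>s \<in> gens\<close> unfolding gens_def by auto
    have *: "realize (act X \<circ> act Y) \<circ> realize (act Y \<circ> act X) = id" for X Y
    proof -
      have "(act X \<circ> act Y) \<circ> (act Y \<circ> act X) = id" by (rule ext) simp
      then show ?thesis using realize_comp[of "act X \<circ> act Y" "act Y \<circ> act X"] realize_id by simp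
    qed
    have "inv s = realize (act Y \<circ> act X)" unfolding s by (rule inv_unique_comp) (rule *)+
    then show ?thesis by (auto simp: gens_def)
  qed
  have "realize (actw Xs) \<in> (\<Union>n. word_ball gens n)" if "even (length Xs)" for Xs
  proof -
    have "\<exists>ws. set ws \<subseteq> gens \<and> realize (actw Xs) = foldr (\<circ>) ws id" using that
    proof (induction "length Xs" arbitrary: Xs rule: less_induct)
      case less
      show ?case
      proof (cases Xs)
        case Nil
        then show ?thesis by (intro exI[of _ "[]"]) (simp add: realize_id)
      next
        case (Cons X Xs')
        then obtain Y Ys where Ys: "Xs' = Y # Ys" using less.prems by (cases Xs') auto
        obtain ws where ws: "set ws \<subseteq> gens" "realize (actw Ys) = foldr (\<circ>) ws id" using less Cons Ys by force
        have "realize (actw Xs) = realize (actw [X, Y]) \<circ> realize (actw Ys)"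
          using realize_actw_append[of "[X, Y]" Ys] Cons Ys by simp
        then show ?thesis using ws by (intro exI[of _ "realize (actw [X, Y]) # ws"]) (auto simp: gens_eq)
      qed
    qed
    then show ?thesis by (auto simp: word_ball_def)
  qed
  moreover have "foldr (\<circ>) ws id \<in> IMG tmap base" if "set ws \<subseteq> gens" for ws
    using that
  proof (induction ws)
    case Nil
    have "realize (actw []) = foldr (\<circ>) [] id" by (simp add: realize_id)
    then show ?case unfolding IMG_eq by (intro image_eqI[of _ realize "actw []"] imageI) auto
  next
    case (Cons s ws)
    then obtain X Y where s: "s = realize (actw [X, Y])" unfolding gens_eq by auto
    obtain Xs where Xs: "even (length Xs)" "foldr (\<circ>) ws id = realize (actw Xs)"
    proof -
      have "set ws \<subseteq> gens" using Cons.prems by simp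
      from Cons.IH[OF this] have "foldr (\<circ>) ws id \<in> realize ` actw ` {Xs. even (length Xs)}" by (simp only: IMG_eq)
      then show ?thesis using that by (elim imageE) simp
    qed
    have "foldr (\<circ>) (s # ws) id = realize (actw [X, Y]) \<circ> realize (actw Xs)"
      by (simp only: foldr.simps comp_apply s Xs(2))
    also have "\<dots> = realize (actw ([X, Y] @ Xs))" by (rule realize_actw_append[symmetric])
    finally have e: "foldr (\<circ>) (s # ws) id = realize (actw ([X, Y] @ Xs))" .
    show ?case unfolding IMG_eq e by (intro imageI CollectI) (simp add: Xs(1))
  qed
  ultimately show "IMG tmap base = (\<Union>n. word_ball gens n)"
    unfolding IMG_eq by (auto simp: word_ball_def)
qed

section \<open>Word balls and the growth estimate\<close>

lemma word_ball_mono: "m \<le> n \<Longrightarrow> word_ball S m \<subseteq> word_ball S n"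
  by (force simp: word_ball_def)

lemma finite_word_ball: assumes "finite S" shows "finite (word_ball S n)"
proof -
  have "word_ball S n = (\<lambda>ws. foldr (\<circ>) ws id) ` {ws. set ws \<subseteq> S \<and> length ws \<le> n}" by (auto simp: word_ball_def)
  then show ?thesis using finite_lists_length_le[OF assms, of n] by simp
qed

lemma foldr_comp_append: "foldr (\<circ>) (us @ vs) id = foldr (\<circ>) us id \<circ> foldr (\<circ>) vs id"
  by (induction us) (auto simp: comp_assoc)

lemma word_ball_comp:
  assumes "f \<in> word_ball S m" "g \<in> word_ball S n" shows "f \<circ> g \<in> word_ball S (m + n)"
proof -
  obtain us vs where "set us \<subseteq> S" "length us \<le> m" "f = foldr (\<circ>) us id" "set vs \<subseteq> S" "length vs \<le> n" "g = foldr (\<circ>) vs id"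
    using assms by (auto simp: word_ball_def)
  then show ?thesis unfolding word_ball_def
    by (intro CollectI exI[of _ "us @ vs"]) (simp add: foldr_comp_append del: foldr_append)
qed

lemma length_odometer [simp]: "length (odometer b w) = length w"
  by (simp add: odometer_def)

lemma length_fpos [simp]: "length (fpos u w) = length w"
  by (induction u arbitrary: w) auto

text \<open>For a given generating set both odometers lie in a ball of some radius M. The
  \<open>2 ^ m\<close> positive words of length m are distinct group elements by freeness, and they
  all lie in the ball of radius \<open>M * m\<close>.\<close>

lemma exponential_growth_IMG: "exponential_growth (IMG tmap base)"
  unfolding exponential_growth_def
proof (intro conjI allI impI)
  show "\<exists>S. fin_sym_gen_set (IMG tmap base) S" using fin_sym_gen_set_gens by blast
  fix S assume S: "fin_sym_gen_set (IMG tmap base) S"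
  have "realize (odometer b) \<in> IMG tmap base" for b
  proof -
    have "odometer b = actw [Pole True, Mid b]" by (simp add: odometer_def)
    then show ?thesis unfolding IMG_eq by (intro image_eqI[of _ realize "odometer b"] image_eqI[of _ actw "[Pole True, Mid b]"]) auto
  qed
  then have "\<exists>n. realize (odometer b) \<in> word_ball S n" for b using S unfolding fin_sym_gen_set_def by blast
  then obtain L where L: "\<And>b. realize (odometer b) \<in> word_ball S (L b)" by metis
  \<comment> \<open>The successor keeps M positive, since M is divided by below.\<close>
  define M where "M = Suc (max (L True) (L False))"
  have xM: "realize (odometer b) \<in> word_ball S M" for b
  proof -
    have "L b \<le> M" by (cases b) (simp_all add: M_def)
    then show ?thesis using L[of b] word_ball_mono by blast
  qed
  have pos: "realize (fpos u) \<in> word_ball S (M * length u)" for u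
  proof (induction u)
    case Nil
    show ?case unfolding word_ball_def by (intro CollectI exI[of _ "[]"]) (simp add: realize_id id_def[symmetric])
  next
    case (Cons b u)
    have e: "realize (fpos (b # u)) = realize (fpos u) \<circ> realize (odometer b)"
      by (simp only: fpos.simps) (simp add: realize_comp)
    have l: "M * length (b # u) = M * length u + M" by simp
    show ?case unfolding e l by (rule word_ball_comp[OF Cons xM])
  qed
  have fin: "finite (word_ball S n)" for n using S finite_word_ball unfolding fin_sym_gen_set_def by blast
  have big: "2 ^ m \<le> card (word_ball S (M * m))" for m
  proof -
    have "inj (\<lambda>u. realize (fpos u))"
    proof (rule injI)
      fix u v assume "realize (fpos u) = realize (fpos v)"
      then have "fpos u = fpos v" by (intro realize_inj) auto
      then show "u = v" by (rule fpos_inj)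
    qed
    then have "card ((\<lambda>u. realize (fpos u)) ` {u. set u \<subseteq> UNIV \<and> length u = m}) = card {u::bool list. set u \<subseteq> UNIV \<and> length u = m}"
      by (intro card_image) (auto intro: inj_on_subset)
    also have "\<dots> = 2 ^ m" by (subst card_lists_length_eq) auto
    finally have "2 ^ m = card ((\<lambda>u. realize (fpos u)) ` {u. set u \<subseteq> UNIV \<and> length u = m})" by simp
    also have "\<dots> \<le> card (word_ball S (M * m))" using pos by (intro card_mono[OF fin]) auto
    finally show ?thesis .
  qed
  show "\<exists>c \<alpha>. c > 0 \<and> \<alpha> > 0 \<and> (\<forall>n. c * exp (\<alpha> * real n) \<le> real (card (word_ball S n)))"
  \<comment> \<open>Rounding n down to a multiple of M costs at most a factor 2, which the constant
    1/2 pays for.\<close>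
  proof (rule exI[of _ "1/2"], rule exI[of _ "ln 2 / real M"], intro conjI allI)
    show "ln 2 / real M > 0" by (simp add: M_def)
    fix n :: nat
    have M0: "M > 0" by (simp add: M_def)
    have "real n < real M * (real (n div M) + 1)"
    proof -
      have "n < M * (n div M + 1)" using M0 by (metis dividend_less_times_div Suc_eq_plus1 mult_Suc_right add.commute)
      then show ?thesis by (metis of_nat_1 of_nat_add of_nat_less_iff of_nat_mult)
    qed
    then have "real n / real M \<le> real (n div M) + 1" using M0 by (simp add: divide_le_eq mult.commute)
    then have "ln 2 * (real n / real M) \<le> ln 2 * (real (n div M) + 1)" by (intro mult_left_mono) auto
    then have "exp (ln 2 / real M * real n) \<le> exp (ln 2 * (real (n div M) + 1))" by simp
    also have "\<dots> = 2 * 2 ^ (n div M)" by (simp add: distrib_left exp_add exp_of_nat2_mult flip: powr_realpow)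
    finally have "1/2 * exp (ln 2 / real M * real n) \<le> 2 ^ (n div M)" by simp
    also have "\<dots> \<le> real (card (word_ball S (M * (n div M))))"
      using big[of "n div M"] by (metis of_nat_le_iff of_nat_numeral of_nat_power)
    also have "\<dots> \<le> real (card (word_ball S n))"
      using card_mono[OF fin word_ball_mono[of "M * (n div M)" n S]] by simp
    finally show "1/2 * exp (ln 2 / real M * real n) \<le> real (card (word_ball S n))" .
  qed simp
qed

theorem theorem1p3:
  shows "\<exists>f t. obstructed f \<and> t \<in> S2 - post f \<and> exponential_growth (IMG f t)"
  using obstructed_tmap base_notin_crit4 exponential_growth_IMG
  by (intro exI[of _ tmap] exI[of _ base]) (simp add: post_tmap)

end
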